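(* Let $a\in L^\infty(\Omega)$ with $a\ge 0$ and $a\not\equiv 0$; let $K,Q\in L^\infty(\Omega\times\Omega)$ satisfy $K(x,y)=K(y,x)$, $Q(x,y)=Q(y,x)$ and $Q(x,y)\ge 0$ for a.e. $(x,y)\in\Omega\times\Omega$; let $\lambda<0$ and $f\in X^{-s}(\Omega)$. Assume that there is $\alpha_0>0$ such that $\mathcal A_s(u,u)\ge \alpha_0\|u\|_{X_0^s}^2$ for every $u\in X_0^s(\Omega)$. Define $$\mathcal J_\lambda(u)=\frac12\mathcal A_s(u,u)-\frac{\lambda}{2q}\iint_{\Omega\times\Omega}Q(x,y)|u(x)|^q|u(y)|^q\,dx\,dy-\langle f,u\rangle,\qquad u\in X_0^s(\Omega).$$ Then $\mathcal J_\lambda$ admits a global minimizer in $X_0^s(\Omega)$, which is a weak solution of problem (P). If $f\ne 0$, every weak solution of (P) is nontrivial. If, in addition, $K\ge 0$ a.e. in $\Omega\times\Omega$ and $f\ge 0$ in $X^{-s}(\Omega)$, then every weak solution of (P) is nonnegative a.e. in $\Omega$.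
   Context: Throughout, $\Omega\subset\mathbb R^N$, $N\ge 2$, is a bounded domain with Lipschitz boundary, $s\in(0,1)$, $2_s^*=\frac{2N}{N-2s}$ and $1<q<2_s^*$. $X_0^s(\Omega)=\{u\in H^s(\mathbb R^N): u=0 \text{ a.e. in }\mathbb R^N\setminus\Omega\}$, with the form $$\mathcal E_s(u,v)=\frac{C_{N,s}}2\iint_{\mathbb R^{2N}}\frac{(u(x)-u(y))(v(x)-v(y))}{|x-y|^{N+2s}}\,dx\,dy,\qquad C_{N,s}=\frac{4^s s\,\Gamma(N/2+s)}{\pi^{N/2}\Gamma(1-s)},$$ and norm $\|u\|_{X_0^s}=\mathcal E_s(u,u)^{1/2}$, which makes it a Hilbert space. $X^{-s}(\Omega)$ is its dual, with pairing $\langle\cdot,\cdot\rangle$. For $f\in X^{-s}(\Omega)$, $f\ge 0$ means $\langle f,\varphi\rangle\ge 0$ for every nonnegative $\varphi\in X_0^s(\Omega)$. $(T_Ku)(x)=\int_\Omega K(x,y)u(y)\,dy$, $B_Q(u)(x)=\int_\Omega Q(x,y)|u(y)|^q\,dy$, $\mathcal N_Q(u)=|u|^{q-2}u\,B_Q(u)$ (with $|u|^{q-2}u:=0$ where $u=0$), and $$\mathcal A_s(u,v)=\mathcal E_s(u,v)-\int_\Omega (T_Ku)v\,dx-\int_\Omega a\,uv\,dx.$$ Problem (P) is: $(-\Delta)^su-T_Ku=au+\lambda\mathcal N_Q(u)+f$ in $\Omega$, $u=0$ in $\mathbb R^N\setminus\Omega$. A weak solution of (P) is a function $u\in X_0^s(\Omega)$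 with $\mathcal A_s(u,\varphi)=\lambda\int_\Omega\mathcal N_Q(u)\varphi\,dx+\langle f,\varphi\rangle$ for every $\varphi\in X_0^s(\Omega)$. *)

theory Defs
  imports "HOL-Analysis.Analysis"
begin

text \<open>
  The ambient space $R^N$ is a type \<open>'a :: euclidean_space\<close> with $N$ = \<open>DIM('a)\<close>.
  Elements of function spaces are represented by Lebesgue measurable functions; two functions that
  agree almost everywhere stand for the same element, so all conditions on them are stated
  almost everywhere.
\<close>

text \<open>Near each boundary point the set is the strict epigraph, in some direction \<open>\<nu>\<close>, of a Lipschitz
  function on the hyperplane orthogonal to \<open>\<nu>\<close>.\<close>

definition lipschitz_boundary :: "'a::euclidean_space set \<Rightarrow> bool" where
  "lipschitz_boundary \<Omega> \<longleftrightarrow>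
     (\<forall>p\<in>frontier \<Omega>. \<exists>\<nu> r L g.
        norm \<nu> = 1 \<and> 0 < r \<and> L-lipschitz_on {y. y \<bullet> \<nu> = 0} (g :: 'a \<Rightarrow> real) \<and>
        \<Omega> \<inter> ball p r = {x \<in> ball p r. g (x - (x \<bullet> \<nu>) *\<^sub>R \<nu>) < x \<bullet> \<nu>})"

definition bounded_lipschitz_domain :: "'a::euclidean_space set \<Rightarrow> bool" where
  "bounded_lipschitz_domain \<Omega> \<longleftrightarrow>
     open \<Omega> \<and> connected \<Omega> \<and> \<Omega> \<noteq> {} \<and> bounded \<Omega> \<and> lipschitz_boundary \<Omega>"

definition L_infinity :: "'b measure \<Rightarrow> ('b \<Rightarrow> real) set" where
  "L_infinity M = {g \<in> borel_measurable M. \<exists>C. AE x in M. \<bar>g x\<bar> \<le> C}"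

definition gagliardo_integrand ::
    "real \<Rightarrow> ('a::euclidean_space \<Rightarrow> real) \<Rightarrow> ('a \<Rightarrow> real) \<Rightarrow> 'a \<times> 'a \<Rightarrow> real" where
  "gagliardo_integrand s u v = (\<lambda>(x, y).
     (u x - u y) * (v x - v y) / norm (x - y) powr (real DIM('a) + 2 * s))"

definition H_frac :: "real \<Rightarrow> ('a::euclidean_space \<Rightarrow> real) set" where
  "H_frac s = {u \<in> borel_measurable lebesgue.
     integrable lebesgue (\<lambda>x. (u x)\<^sup>2) \<and> integrable lebesgue (gagliardo_integrand s u u)}"

definition X0 :: "real \<Rightarrow> 'a::euclidean_space set \<Rightarrow> ('a \<Rightarrow> real) set" where
  "X0 s \<Omega> = {u \<in> H_frac s. AE x in lebesgue. x \<notin> \<Omega> \<longrightarrow> u x = 0}"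

definition frac_const :: "nat \<Rightarrow> real \<Rightarrow> real" where
  "frac_const N s =
     4 powr s * s * Gamma (real N / 2 + s) / (pi powr (real N / 2) * Gamma (1 - s))"

definition frac_form :: "real \<Rightarrow> ('a::euclidean_space \<Rightarrow> real) \<Rightarrow> ('a \<Rightarrow> real) \<Rightarrow> real" where
  "frac_form s u v =
     frac_const DIM('a) s / 2 * (LINT p|lebesgue. gagliardo_integrand s u v p)"

definition X0_norm :: "real \<Rightarrow> ('a::euclidean_space \<Rightarrow> real) \<Rightarrow> real" where
  "X0_norm s u = sqrt (frac_form s u u)"

text \<open>Elements of the dual are functionals on representatives, so the pairing is application;
  linearity and boundedness force them to respect almost everywhere equality. Their values outside
  \<open>X0 s \<Omega>\<close> are irrelevant.\<close>

definition X0_dual :: "real \<Rightarrow> 'a::euclidean_space set \<Rightarrow> (('a \<Rightarrow> real) \<Rightarrow> real) set" where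
  "X0_dual s \<Omega> = {f.
     (\<forall>u\<in>X0 s \<Omega>. \<forall>v\<in>X0 s \<Omega>. f (\<lambda>x. u x + v x) = f u + f v) \<and>
     (\<forall>c. \<forall>u\<in>X0 s \<Omega>. f (\<lambda>x. c * u x) = c * f u) \<and>
     (\<exists>C. \<forall>u\<in>X0 s \<Omega>. \<bar>f u\<bar> \<le> C * X0_norm s u)}"

definition dual_nonneg ::
    "real \<Rightarrow> 'a::euclidean_space set \<Rightarrow> (('a \<Rightarrow> real) \<Rightarrow> real) \<Rightarrow> bool" where
  "dual_nonneg s \<Omega> f \<longleftrightarrow>
     (\<forall>\<phi>\<in>X0 s \<Omega>. (AE x in lebesgue. 0 \<le> \<phi> x) \<longrightarrow> 0 \<le> f \<phi>)"

definition T_op ::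
    "'a::euclidean_space set \<Rightarrow> ('a \<times> 'a \<Rightarrow> real) \<Rightarrow> ('a \<Rightarrow> real) \<Rightarrow> 'a \<Rightarrow> real" where
  "T_op \<Omega> K u x = (LINT y|lebesgue_on \<Omega>. K (x, y) * u y)"

definition B_op ::
    "real \<Rightarrow> 'a::euclidean_space set \<Rightarrow> ('a \<times> 'a \<Rightarrow> real) \<Rightarrow> ('a \<Rightarrow> real) \<Rightarrow> 'a \<Rightarrow> real" where
  "B_op q \<Omega> Q u x = (LINT y|lebesgue_on \<Omega>. Q (x, y) * \<bar>u y\<bar> powr q)"

text \<open>The factor \<open>\<bar>u x\<bar> powr (q - 2) * u x\<close> vanishes where \<open>u x = 0\<close>, for all \<open>q\<close>.\<close>

definition N_op ::
    "real \<Rightarrow> 'a::euclidean_space set \<Rightarrow> ('a \<times> 'a \<Rightarrow> real) \<Rightarrow> ('a \<Rightarrow> real) \<Rightarrow> 'a \<Rightarrow> real" where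
  "N_op q \<Omega> Q u x = \<bar>u x\<bar> powr (q - 2) * u x * B_op q \<Omega> Q u x"

definition A_form ::
    "real \<Rightarrow> 'a::euclidean_space set \<Rightarrow> ('a \<times> 'a \<Rightarrow> real) \<Rightarrow> ('a \<Rightarrow> real) \<Rightarrow>
     ('a \<Rightarrow> real) \<Rightarrow> ('a \<Rightarrow> real) \<Rightarrow> real" where
  "A_form s \<Omega> K a u v =
     frac_form s u v - (LINT x|lebesgue_on \<Omega>. T_op \<Omega> K u x * v x)
       - (LINT x|lebesgue_on \<Omega>. a x * u x * v x)"

definition weak_solution ::
    "real \<Rightarrow> real \<Rightarrow> 'a::euclidean_space set \<Rightarrow> ('a \<times> 'a \<Rightarrow> real) \<Rightarrow> ('a \<times> 'a \<Rightarrow> real) \<Rightarrow>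
     ('a \<Rightarrow> real) \<Rightarrow> real \<Rightarrow> (('a \<Rightarrow> real) \<Rightarrow> real) \<Rightarrow> ('a \<Rightarrow> real) \<Rightarrow> bool" where
  "weak_solution s q \<Omega> K Q a lam f u \<longleftrightarrow>
     u \<in> X0 s \<Omega> \<and>
     (\<forall>\<phi>\<in>X0 s \<Omega>. A_form s \<Omega> K a u \<phi>
        = lam * (LINT x|lebesgue_on \<Omega>. N_op q \<Omega> Q u x * \<phi> x) + f \<phi>)"

definition J_functional ::
    "real \<Rightarrow> real \<Rightarrow> 'a::euclidean_space set \<Rightarrow> ('a \<times> 'a \<Rightarrow> real) \<Rightarrow> ('a \<times> 'a \<Rightarrow> real) \<Rightarrow>
     ('a \<Rightarrow> real) \<Rightarrow> real \<Rightarrow> (('a \<Rightarrow> real) \<Rightarrow> real) \<Rightarrow> ('a \<Rightarrow> real) \<Rightarrow> real" where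
  "J_functional s q \<Omega> K Q a lam f u =
     1 / 2 * A_form s \<Omega> K a u u
       - lam / (2 * q) *
           (LINT (x, y)|lebesgue_on (\<Omega> \<times> \<Omega>). Q (x, y) * \<bar>u x\<bar> powr q * \<bar>u y\<bar> powr q)
       - f u"

end

theory Submission
  imports Defs
begin

text \<open>
  The direct method. Fix \<open>u\<close> in \<open>X0\<close> and let \<open>D x\<close> be the integral of its squared difference quotient
  over the slice at \<open>x\<close>. Jensen's inequality bounds \<open>\<bar>u x - m\<bar>\<close> by \<open>C * r powr s * sqrt (D x)\<close>, where
  \<open>m\<close> is the average of \<open>u\<close> over any ball of radius \<open>r\<close> whose distance to \<open>x\<close> is comparable to \<open>r\<close>,
  and \<open>D\<close> is integrable. This single pointwise estimate yields the Poincare inequality (choose a ball where \<open>u\<close> vanishes), the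
  subcritical Sobolev embedding (optimise \<open>r\<close> and iterate the gain of integrability
  \<open>p \<mapsto> 2 + 2 s p / N\<close>, whose fixed point is the critical exponent), and compactness in \<open>L2\<close>
  (approximate by countably many averages).

  The quadratic part of \<open>J\<close> is a coercive form, weakly lower semicontinuous up to \<open>L2\<close>-continuous terms,
  and since \<open>\<lambda> < 0\<close> the nonlocal term is nonnegative, so Fatou's lemma applies to it along a
  minimizing sequence. Differentiating under the integral gives the weak equation. The sign of weak
  solutions follows by testing with the negative part.
\<close>

section \<open>Lebesgue measure on products\<close>

text \<open>Elements of \<open>X0\<close> are functions rather than classes, so no Hilbert space
  structure is at hand. Weak convergence is replaced by almost everywhere convergence together with
  an energy bound: paired with a fixed L2 function, such a sequence already converges, and the form
  is an L2 pairing of difference quotients on the doubled space. The functional \<open>f\<close> is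
  only known to be bounded, so its convergence along such sequences is reduced to that of the form
  by a representing element of \<open>X0\<close>, itself found by minimization.

  Semicontinuity of the energy E enters through 2 E(v, u_n) - E(v, v) \<le> E(u_n, u_n), whose left
  side is affine in u_n and converges.

  Integrals over the doubled space use the completed Lebesgue measure, which is not the product of
  the two completed measures. Tonelli, Fubini and the exchange of variables are therefore first
  transferred from Borel measure.\<close>

lemma measurable_fst_lebesgue:
  "fst \<in> (lebesgue :: ('a::euclidean_space \<times> 'b::euclidean_space) measure) \<rightarrow>\<^sub>M lebesgue"
proof (rule completion.measurable_completion2)
  show "fst \<in> (lebesgue :: ('a \<times> 'b) measure) \<rightarrow>\<^sub>M lborel"
    by (auto simp: borel_prod[symmetric] intro!: measurable_completion)
  \<comment> \<open>Measurability between completed sigma-algebras needs preimages of null sets to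
    be null; \<open>N \<times> UNIV\<close> has volume zero times infinity, which is zero in
    \<open>ennreal\<close>.\<close>
  show "null_sets lborel \<subseteq> null_sets (distr (lebesgue :: ('a \<times> 'b) measure) lborel fst)"
  proof
    fix N :: "'a set" assume N: "N \<in> null_sets lborel"
    then have "emeasure (lborel \<Otimes>\<^sub>M lborel) (N \<times> (UNIV :: 'b set)) = 0"
      by (subst lborel.emeasure_pair_measure_Times) auto
    moreover have "N \<times> (UNIV::'b set) \<in> sets (lborel \<Otimes>\<^sub>M lborel)"
      using N by auto
    ultimately have "N \<times> (UNIV::'b set) \<in> null_sets lborel"
      unfolding lborel_prod null_sets_def by simp
    moreover have "fst -` N = N \<times> (UNIV::'b set)" by auto
    ultimately show "N \<in> null_sets (distr (lebesgue :: ('a \<times> 'b) measure) lborel fst)"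
      using N \<open>fst \<in> (lebesgue :: ('a \<times> 'b) measure) \<rightarrow>\<^sub>M lborel\<close>
      by (auto simp: null_sets_def emeasure_distr)
  qed
qed

lemma measurable_swap_lebesgue:
  "(\<lambda>(x, y). (y, x)) \<in> (lebesgue :: ('a::euclidean_space \<times> 'b::euclidean_space) measure) \<rightarrow>\<^sub>M lebesgue"
  and distr_swap_lborel:
  "distr (lborel :: ('a \<times> 'b) measure) lborel (\<lambda>(x, y). (y, x)) = lborel"
proof -
  have d: "lborel = distr (lborel :: ('a \<times> 'b) measure) (lborel :: ('b \<times> 'a) measure) (\<lambda>(x, y). (y, x))"
    using lborel_pair.distr_pair_swap[where 'a='b and 'b='a] by (simp add: lborel_prod)
  then show "distr (lborel :: ('a \<times> 'b) measure) lborel (\<lambda>(x, y). (y, x)) = lborel" by simp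
  have m: "(\<lambda>(x, y). (y, x)) \<in> (lborel :: ('a \<times> 'b) measure) \<rightarrow>\<^sub>M lborel"
    using measurable_pair_swap'[of "lborel :: 'a measure" "lborel :: 'b measure"] by (simp add: lborel_prod)
  show "(\<lambda>(x, y). (y, x)) \<in> (lebesgue :: ('a \<times> 'b) measure) \<rightarrow>\<^sub>M lebesgue"
  proof (rule completion.measurable_completion2)
    show "(\<lambda>(x, y). (y, x)) \<in> (lebesgue :: ('a \<times> 'b) measure) \<rightarrow>\<^sub>M lborel"
      by (rule measurable_completion[OF m])
    show "null_sets lborel \<subseteq> null_sets (distr (lebesgue :: ('a \<times> 'b) measure) lborel (\<lambda>(x, y). (y, x)))"
      by (subst distr_completion[OF m]) (use d in simp)
  qed
qed

lemma measurable_snd_lebesgue: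
  "snd \<in> (lebesgue :: ('a::euclidean_space \<times> 'b::euclidean_space) measure) \<rightarrow>\<^sub>M lebesgue"
proof -
  have "fst \<circ> (\<lambda>(x, y). (y, x)) \<in> (lebesgue :: ('a \<times> 'b) measure) \<rightarrow>\<^sub>M lebesgue"
    by (rule measurable_comp[OF measurable_swap_lebesgue measurable_fst_lebesgue])
  moreover have "fst \<circ> (\<lambda>(x, y). (y, x)) = (snd :: 'a \<times> 'b \<Rightarrow> 'b)" by auto
  ultimately show ?thesis by simp
qed

lemmas measurable_comp_fst_lebesgue [measurable (raw)] = measurable_compose[OF measurable_fst_lebesgue]
lemmas measurable_comp_snd_lebesgue [measurable (raw)] = measurable_compose[OF measurable_snd_lebesgue]

lemma AE_lebesgue_fst:
  assumes "AE x in lebesgue. P x"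
  shows "AE p in (lebesgue :: ('a::euclidean_space \<times> 'b::euclidean_space) measure). P (fst p)"
proof -
  from assms have "AE x in lborel. P x" by (simp add: AE_completion_iff)
  then obtain N' where N': "N' \<in> null_sets lborel" and P: "\<And>x. x \<in> space lborel - N' \<Longrightarrow> P x"
    by (rule AE_E3) auto
  have [measurable]: "N' \<in> sets borel" using N' by auto
  have "{p \<in> space (lborel \<Otimes>\<^sub>M lborel). fst p \<notin> N'} \<in> sets (lborel \<Otimes>\<^sub>M (lborel :: 'b measure))"
    by measurable
  then have "AE p in lborel \<Otimes>\<^sub>M (lborel :: 'b measure). fst p \<notin> N'"
    by (rule lborel_pair.AE_pair_measure) (use N' in \<open>auto dest!: AE_not_in\<close>)
  then have "AE p in (lebesgue :: ('a \<times> 'b) measure). fst p \<notin> N'"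
    unfolding AE_completion_iff lborel_prod .
  then show ?thesis by eventually_elim (use P in auto)
qed

lemma AE_lebesgue_swap:
  assumes "AE p in (lebesgue :: ('a::euclidean_space \<times> 'b::euclidean_space) measure). P p"
  shows "AE p in lebesgue. P (snd p, fst p)"
proof -
  have m: "(\<lambda>(x, y). (y, x)) \<in> (lborel :: ('b \<times> 'a) measure) \<rightarrow>\<^sub>M lborel"
    using measurable_pair_swap'[of "lborel :: 'b measure" "lborel :: 'a measure"] by (simp add: lborel_prod)
  have "AE p in lborel. P p" using assms by (simp add: AE_completion_iff)
  then have "AE p in distr (lborel :: ('b \<times> 'a) measure) lborel (\<lambda>(x, y). (y, x)). P p"
    unfolding distr_swap_lborel .
  then have "AE p in lborel. P (case p of (x, y) \<Rightarrow> (y, x))"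
    using AE_distrD[OF m] by blast
  then show ?thesis by (simp add: AE_completion_iff case_prod_beta)
qed

lemma AE_lebesgue_snd:
  assumes "AE x in lebesgue. P x"
  shows "AE p in (lebesgue :: ('a::euclidean_space \<times> 'b::euclidean_space) measure). P (snd p)"
  using AE_lebesgue_swap[OF AE_lebesgue_fst[OF assms]] by simp

lemma borel_measurable_lebesgue_AE_eq:
  assumes "f \<in> borel_measurable lebesgue" "AE x in lebesgue. f x = g x"
  shows "g \<in> borel_measurable (lebesgue :: 'a::euclidean_space measure)"
proof (rule measurableI)
  fix A :: "'b set" assume "A \<in> sets borel"
  then have "f -` A \<in> sets lebesgue" using measurable_sets[OF assms(1)] by simp
  then show "g -` A \<inter> space lebesgue \<in> sets lebesgue"
    by (rule completion.in_sets_AE[rotated]) (use assms(2) in auto)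
qed auto

text \<open>Tonelli for the completed product: a Borel version \<open>g\<close> of \<open>f\<close>
  has slices that agree with those of \<open>f\<close> for almost every \<open>x\<close>, and
  completion does not change \<open>nn_integral\<close>, so the Borel theorem transfers.\<close>

lemma
  fixes f :: "'a::euclidean_space \<times> 'b::euclidean_space \<Rightarrow> ennreal"
  assumes "f \<in> borel_measurable lebesgue"
  shows nn_integral_lebesgue_fst:
      "(\<integral>\<^sup>+ x. \<integral>\<^sup>+ y. f (x, y) \<partial>lebesgue \<partial>lebesgue) = (\<integral>\<^sup>+ p. f p \<partial>lebesgue)" 
    and borel_measurable_nn_integral_lebesgue:
      "(\<lambda>x. \<integral>\<^sup>+ y. f (x, y) \<partial>lebesgue) \<in> borel_measurable lebesgue"
proof -
  obtain g where g: "g \<in> borel_measurable lborel" and eq: "AE p in lborel. f p = g p"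
    using completion_ex_borel_measurable[OF assms] by blast
  have g': "g \<in> borel_measurable (lborel \<Otimes>\<^sub>M lborel)" using g by (simp add: lborel_prod)
  have ae: "AE x in lborel. AE y in lborel. f (x, y) = g (x, y)"
    by (rule lborel_pair.AE_pair[of "\<lambda>p. f p = g p", unfolded lborel_prod, OF eq])
  have ae2: "AE x in lborel. (\<integral>\<^sup>+ y. f (x, y) \<partial>lborel) = (\<integral>\<^sup>+ y. g (x, y) \<partial>lborel)"
    using ae by eventually_elim (rule nn_integral_cong_AE)
  have "(\<integral>\<^sup>+ x. \<integral>\<^sup>+ y. f (x, y) \<partial>lborel \<partial>lborel) = (\<integral>\<^sup>+ x. \<integral>\<^sup>+ y. g (x, y) \<partial>lborel \<partial>lborel)"
    by (rule nn_integral_cong_AE[OF ae2])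
  also have "\<dots> = (\<integral>\<^sup>+ p. g p \<partial>lborel)"
    using lborel.nn_integral_fst[OF g'] by (simp add: lborel_prod)
  also have "\<dots> = (\<integral>\<^sup>+ p. f p \<partial>lborel)" by (rule nn_integral_cong_AE) (use eq in auto)
  finally show "(\<integral>\<^sup>+ x. \<integral>\<^sup>+ y. f (x, y) \<partial>lebesgue \<partial>lebesgue) = (\<integral>\<^sup>+ p. f p \<partial>lebesgue)"
    by (simp add: nn_integral_completion)
  have "(\<lambda>x. \<integral>\<^sup>+ y. g (x, y) \<partial>lborel) \<in> borel_measurable lebesgue"
    by (intro measurable_completion lborel.borel_measurable_nn_integral_fst g')
  then show "(\<lambda>x. \<integral>\<^sup>+ y. f (x, y) \<partial>lebesgue) \<in> borel_measurable lebesgue"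
    by (rule borel_measurable_lebesgue_AE_eq)
       (use ae2 in \<open>auto simp: nn_integral_completion AE_completion_iff\<close>)
qed

lemma integral_lebesgue_fst:
  fixes f :: "'a::euclidean_space \<times> 'b::euclidean_space \<Rightarrow> real"
  assumes f: "integrable lebesgue f"
  shows "(LINT x|lebesgue. LINT y|lebesgue. f (x, y)) = (LINT p|lebesgue. f p)"
proof -
  obtain g where g: "g \<in> borel_measurable lborel" and eq: "AE p in lborel. f p = g p"
    using completion_ex_borel_measurable_real[OF borel_measurable_integrable[OF f]] by blast
  have "integrable lebesgue g"
    using f by (rule Bochner_Integration.integrable_cong_AE_imp)
      (use g eq in \<open>auto simp: AE_completion_iff intro: measurable_completion\<close>)
  then have gi: "integrable lborel g" using g integrable_completion by blast
  have g': "integrable (lborel \<Otimes>\<^sub>M lborel) g" using gi by (simp add: lborel_prod)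
  have ae: "AE x in lborel. AE y in lborel. f (x, y) = g (x, y)"
    by (rule lborel_pair.AE_pair[of "\<lambda>p. f p = g p", unfolded lborel_prod, OF eq])
  have gm: "(\<lambda>y. g (x, y)) \<in> borel_measurable lborel" for x
    using borel_measurable_integrable[OF g'] by measurable
  \<comment> \<open>A slice of \<open>f\<close> may fail to be measurable for a null set of
    \<open>x\<close>; measurability is claimed only where the slice agrees almost everywhere with
    that of \<open>g\<close>.\<close>
  have ms: "(\<lambda>y. f (x, y)) \<in> borel_measurable lebesgue" if "AE y in lborel. f (x, y) = g (x, y)" for x
    by (rule borel_measurable_lebesgue_AE_eq[OF measurable_completion[OF gm]])
       (use that in \<open>auto simp: AE_completion_iff\<close>)
  have ae2: "AE x in lebesgue. (LINT y|lborel. g (x, y)) = (LINT y|lebesgue. f (x, y))"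
    using AE_completion[OF ae]
  proof eventually_elim
    case (elim x)
    have "(LINT y|lborel. g (x, y)) = (LINT y|lebesgue. g (x, y))"
      by (rule integral_completion[OF gm, symmetric])
    also have "\<dots> = (LINT y|lebesgue. f (x, y))"
      by (rule integral_cong_AE) (use elim ms gm in \<open>auto simp: AE_completion_iff intro: measurable_completion\<close>)
    finally show ?case .
  qed
  have Gi: "integrable lebesgue (\<lambda>x. LINT y|lborel. g (x, y))"
    using lborel_pair.integrable_fst'[OF g'] integrable_completion by blast
  have fm: "(\<lambda>x. LINT y|lebesgue. f (x, y)) \<in> borel_measurable lebesgue"
    by (rule borel_measurable_lebesgue_AE_eq[OF _ ae2]) (use Gi in auto)
  have "(LINT x|lebesgue. LINT y|lebesgue. f (x, y)) = (LINT x|lebesgue. LINT y|lborel. g (x, y))"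
    by (rule integral_cong_AE) (use fm Gi ae2 in auto)
  also have "\<dots> = (LINT x|lborel. LINT y|lborel. g (x, y))"
    using lborel_pair.integrable_fst'[OF g'] by (intro integral_completion) auto
  also have "\<dots> = (LINT p|lborel. g p)"
    using lborel_pair.integral_fst'[OF g'] by (simp add: lborel_prod)
  also have "\<dots> = (LINT p|lebesgue. g p)"
    using g by (simp add: integral_completion)
  also have "\<dots> = (LINT p|lebesgue. f p)"
    by (rule integral_cong_AE) (use g f eq in \<open>auto simp: AE_completion_iff intro: measurable_completion\<close>)
  finally show "(LINT x|lebesgue. LINT y|lebesgue. f (x, y)) = (LINT p|lebesgue. f p)" .
qed

lemma integrable_lebesgue_tensor:
  fixes f :: "'a::euclidean_space \<Rightarrow> real" and g :: "'b::euclidean_space \<Rightarrow> real"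
  assumes f: "integrable lebesgue f" and g: "integrable lebesgue g"
  shows "integrable lebesgue (\<lambda>p. f (fst p) * g (snd p))"
    and "(LINT p|lebesgue. f (fst p) * g (snd p)) = integral\<^sup>L lebesgue f * integral\<^sup>L lebesgue g"
proof -
  note [measurable] = borel_measurable_integrable[OF f] borel_measurable_integrable[OF g]
  show *: "integrable lebesgue (\<lambda>p. f (fst p) * g (snd p))"
  proof (rule integrableI_bounded)
    have "(\<integral>\<^sup>+ p. ennreal (norm (f (fst p) * g (snd p))) \<partial>lebesgue)
        = (\<integral>\<^sup>+ x. \<integral>\<^sup>+ y. ennreal \<bar>f x\<bar> * ennreal \<bar>g y\<bar> \<partial>lebesgue \<partial>lebesgue)"
      by (subst nn_integral_lebesgue_fst[symmetric]) (auto simp: abs_mult ennreal_mult)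
    also have "\<dots> = (\<integral>\<^sup>+ x. ennreal \<bar>f x\<bar> \<partial>lebesgue) * (\<integral>\<^sup>+ y. ennreal \<bar>g y\<bar> \<partial>lebesgue)"
      by (simp add: nn_integral_cmult nn_integral_multc)
    also have "\<dots> < \<infinity>"
      using f g by (auto simp: integrable_iff_bounded ennreal_mult_less_top)
    finally show "(\<integral>\<^sup>+ p. ennreal (norm (f (fst p) * g (snd p))) \<partial>lebesgue) < \<infinity>" .
  qed auto
  show "(LINT p|lebesgue. f (fst p) * g (snd p)) = integral\<^sup>L lebesgue f * integral\<^sup>L lebesgue g"
    by (subst integral_lebesgue_fst[OF *, symmetric]) simp
qed

text \<open>The swap preserves Borel Lebesgue measure and its null sets, hence also the completed
  measure; this covers \<open>f\<close> that are only Lebesgue measurable.\<close>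

lemma integral_lebesgue_swap:
  fixes f :: "'a::euclidean_space \<times> 'b::euclidean_space \<Rightarrow> real"
  assumes f: "integrable lebesgue f"
  shows "integrable lebesgue (\<lambda>p. f (snd p, fst p))"
    and "(LINT p|lebesgue. f (snd p, fst p)) = (LINT p|lebesgue. f p)"
proof -
  have m: "(\<lambda>(x, y). (y, x)) \<in> (lborel :: ('b \<times> 'a) measure) \<rightarrow>\<^sub>M lborel"
    using measurable_pair_swap'[of "lborel :: 'b measure" "lborel :: 'a measure"] by (simp add: lborel_prod)
  have nul: "null_sets (distr (lebesgue :: ('b \<times> 'a) measure) lborel (\<lambda>(x, y). (y, x))) = null_sets lborel"
    by (simp add: distr_completion[OF m] distr_swap_lborel)
  have d: "distr (lebesgue :: ('b \<times> 'a) measure) lebesgue (\<lambda>(x, y). (y, x)) = lebesgue"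
    using completion.completion_distr_eq[OF measurable_completion[OF m] nul]
    by (simp add: distr_completion[OF m] distr_swap_lborel)
  have fm: "f \<in> borel_measurable lebesgue" using f by simp
  have "integrable (distr (lebesgue :: ('b \<times> 'a) measure) lebesgue (\<lambda>(x, y). (y, x))) f"
    using f d by simp
  then show "integrable lebesgue (\<lambda>p. f (snd p, fst p))"
    using integrable_distr_eq[OF measurable_swap_lebesgue fm] by (simp add: case_prod_beta)
  show "(LINT p|lebesgue. f (snd p, fst p)) = (LINT p|lebesgue. f p)"
    using integral_distr[OF measurable_swap_lebesgue fm] d by (simp add: case_prod_beta)
qed

section \<open>Square-integrable functions\<close>

definition L2 :: "'a measure \<Rightarrow> ('a \<Rightarrow> real) set" where
  "L2 M = {f \<in> borel_measurable M. integrable M (\<lambda>x. (f x)\<^sup>2)}"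

lemma L2_measurable: "f \<in> L2 M \<Longrightarrow> f \<in> borel_measurable M"
  and L2_square_integrable: "f \<in> L2 M \<Longrightarrow> integrable M (\<lambda>x. (f x)\<^sup>2)"
  by (auto simp: L2_def)

lemma L2_dominated:
  assumes "g \<in> borel_measurable M" "f \<in> L2 M" "AE x in M. \<bar>g x\<bar> \<le> \<bar>f x\<bar>"
  shows "g \<in> L2 M"
  unfolding L2_def
proof (safe intro!: assms(1))
  show "integrable M (\<lambda>x. (g x)\<^sup>2)"
    by (rule Bochner_Integration.integrable_bound[OF L2_square_integrable[OF assms(2)]])
       (use assms in \<open>auto simp: abs_le_square_iff\<close>)
qed

lemma L2_mult_integrable:
  assumes "f \<in> L2 M" "g \<in> L2 M"
  shows "integrable M (\<lambda>x. f x * g x)"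
proof (rule Bochner_Integration.integrable_bound)
  show "integrable M (\<lambda>x. (f x)\<^sup>2 + (g x)\<^sup>2)"
    using assms by (auto simp: L2_def)
  show "(\<lambda>x. f x * g x) \<in> borel_measurable M" using assms by (auto simp: L2_def)
  have "\<bar>a * b\<bar> \<le> a\<^sup>2 + b\<^sup>2" for a b :: real
  proof -
    have "0 \<le> \<bar>a\<bar> * \<bar>b\<bar>" by simp
    moreover have "2 * (\<bar>a\<bar> * \<bar>b\<bar>) \<le> a\<^sup>2 + b\<^sup>2"
      using sum_squares_bound[of "\<bar>a\<bar>" "\<bar>b\<bar>"] by (simp add: mult.assoc)
    ultimately show ?thesis unfolding abs_mult by linarith
  qed
  then show "AE x in M. norm (f x * g x) \<le> norm ((f x)\<^sup>2 + (g x)\<^sup>2)" by simp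
qed

lemma L2_cmult: "f \<in> L2 M \<Longrightarrow> (\<lambda>x. c * f x) \<in> L2 M"
  by (auto simp: L2_def power_mult_distrib)

lemma L2_add:
  assumes "f \<in> L2 M" "g \<in> L2 M"
  shows "(\<lambda>x. f x + g x) \<in> L2 M"
  using assms L2_mult_integrable[OF assms]
  by (auto simp: L2_def power2_sum mult.assoc)

lemma L2_diff: "f \<in> L2 M \<Longrightarrow> g \<in> L2 M \<Longrightarrow> (\<lambda>x. f x - g x) \<in> L2 M"
  using L2_add[of f M "\<lambda>x. -1 * g x"] L2_cmult[of g M "-1"] by simp

lemma integral_square_diff_le:
  assumes "f \<in> L2 M" "g \<in> L2 M"
  shows "(LINT x|M. (f x - g x)\<^sup>2) \<le> 2 * (LINT x|M. (f x)\<^sup>2) + 2 * (LINT x|M. (g x)\<^sup>2)"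
proof -
  have "(a - b)\<^sup>2 \<le> 2 * a\<^sup>2 + 2 * b\<^sup>2" for a b :: real
    using sum_squares_bound[of a "-b"] by (simp add: power2_diff)
  then have "(LINT x|M. (f x - g x)\<^sup>2) \<le> (LINT x|M. 2 * (f x)\<^sup>2 + 2 * (g x)\<^sup>2)"
    using assms by (intro integral_mono Bochner_Integration.integrable_add integrable_mult_right
        L2_square_integrable L2_diff) auto
  also have "\<dots> = 2 * (LINT x|M. (f x)\<^sup>2) + 2 * (LINT x|M. (g x)\<^sup>2)"
    using assms by (simp add: L2_square_integrable)
  finally show ?thesis .
qed

text \<open>Fatou's lemma with bounds \<open>c n\<close> that may vary: a minimizing sequence
  provides only such bounds, and their limit controls the limit function.\<close>

lemma
  fixes g :: "'a \<Rightarrow> real"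
  assumes gn: "\<And>n. integrable M (gs n)" "\<And>n. AE x in M. 0 \<le> gs n x"
    and g: "g \<in> borel_measurable M" and lim: "AE x in M. (\<lambda>n. gs n x) \<longlonglongrightarrow> g x"
    and le: "\<And>n. integral\<^sup>L M (gs n) \<le> c n" and c: "c \<longlonglongrightarrow> C"
  shows integrable_Fatou: "integrable M g"
    and integral_Fatou: "integral\<^sup>L M g \<le> C"
proof -
  have nn: "AE x in M. \<forall>n. 0 \<le> gs n x" using gn(2) by (simp add: AE_all_countable)
  have g0: "AE x in M. 0 \<le> g x" using lim nn
  proof eventually_elim
    case (elim x) then show ?case using LIMSEQ_le_const[of "\<lambda>n. gs n x" "g x" 0] by auto
  qed
  have c0: "0 \<le> c n" for n using le[of n] integral_nonneg_AE[OF gn(2)[of n]] by linarith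
  then have C0: "0 \<le> C" using LIMSEQ_le_const[OF c, of 0] by auto
  have "(\<integral>\<^sup>+ x. ennreal (g x) \<partial>M) = (\<integral>\<^sup>+ x. liminf (\<lambda>n. ennreal (gs n x)) \<partial>M)"
  proof (rule nn_integral_cong_AE, use lim in eventually_elim)
    case (elim x)
    then have "(\<lambda>n. ennreal (gs n x)) \<longlonglongrightarrow> ennreal (g x)" by (rule tendsto_ennrealI)
    then show ?case using lim_imp_Liminf[OF sequentially_bot] by metis
  qed
  also have "\<dots> \<le> liminf (\<lambda>n. \<integral>\<^sup>+ x. ennreal (gs n x) \<partial>M)"
    using gn by (intro nn_integral_liminf) auto
  also have "\<dots> \<le> liminf (\<lambda>n. ennreal (c n))"
  proof (rule Liminf_mono, intro always_eventually allI)
    fix n show "(\<integral>\<^sup>+ x. ennreal (gs n x) \<partial>M) \<le> ennreal (c n)"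
      using nn_integral_eq_integral[OF gn] le by (simp add: ennreal_leI)
  qed
  also have "\<dots> = ennreal C" by (rule lim_imp_Liminf[OF sequentially_bot tendsto_ennrealI[OF c]])
  finally have *: "(\<integral>\<^sup>+ x. ennreal (g x) \<partial>M) \<le> ennreal C" .
  have "(\<integral>\<^sup>+ x. ennreal (norm (g x)) \<partial>M) = (\<integral>\<^sup>+ x. ennreal (g x) \<partial>M)"
    by (rule nn_integral_cong_AE) (use g0 in auto)
  then show gi: "integrable M g"
    using g * by (intro integrableI_bounded) (auto intro: le_less_trans)
  show "integral\<^sup>L M g \<le> C"
    using * nn_integral_eq_integral[OF gi g0] C0 by (simp add: ennreal_le_iff)
qed

text \<open>On \<open>\<bar>Z\<bar> \<le> m\<bar>W\<bar>\<close> the product \<open>\<bar>W Z\<bar>\<close> is dominated by \<open>m W\<^sup>2\<close>; elsewhere it is at most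
  \<open>Z\<^sup>2 / m\<close>, whose integral is uniformly small.\<close>

lemma
  assumes V: "\<And>n. V n \<in> L2 M" and V0: "V0 \<in> borel_measurable M"
    and lim: "AE x in M. (\<lambda>n. V n x) \<longlonglongrightarrow> V0 x"
    and bd: "\<And>n. (LINT x|M. (V n x)\<^sup>2) \<le> C" and W: "W \<in> L2 M"
  shows L2_AE_limit: "V0 \<in> L2 M"
    and L2_bounded_AE_weak_limit: "(\<lambda>n. LINT x|M. W x * V n x) \<longlonglongrightarrow> (LINT x|M. W x * V0 x)"
proof -
  have fat: "integrable M (\<lambda>x. (V0 x)\<^sup>2)" "(LINT x|M. (V0 x)\<^sup>2) \<le> C"
    by (rule integrable_Fatou integral_Fatou; (rule L2_square_integrable[OF V] bd tendsto_const)?;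
        use V0 lim in \<open>auto intro!: tendsto_intros\<close>)+
  show V0': "V0 \<in> L2 M" using V0 fat by (auto simp: L2_def)
  define Z where "Z n x = V n x - V0 x" for n x
  have Z: "Z n \<in> L2 M" for n using L2_diff[OF V[of n] V0'] by (simp add: Z_def[abs_def])
  note [measurable] = L2_measurable[OF Z] L2_measurable[OF W]
  have C0: "0 \<le> C" using order.trans[OF integral_nonneg_AE bd[of 0]] by simp
  have Zb: "(LINT x|M. (Z n x)\<^sup>2) \<le> 4 * C" for n
    using integral_square_diff_le[OF V[of n] V0'] bd[of n] fat by (simp add: Z_def)
  have Zlim: "AE x in M. (\<lambda>n. Z n x) \<longlonglongrightarrow> 0"
    using lim unfolding Z_def by eventually_elim (auto intro: LIM_zero)
  have WZ: "integrable M (\<lambda>x. W x * Z n x)" for n by (rule L2_mult_integrable[OF W Z])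
  have "(\<lambda>n. LINT x|M. W x * Z n x) \<longlonglongrightarrow> 0"
  proof (rule LIMSEQ_I)
    fix e :: real assume e: "0 < e"
    \<comment> \<open>The differences \<open>Z n\<close> have squared norm at most
      \<open>4 * C\<close>, so the part beyond the truncation costs at most 4 C / m \<le> e / 2; the
      added 1 keeps \<open>m\<close> positive when \<open>C\<close> is zero.\<close>
    define m where "m = (8 * C + 1) / e"
    have m: "m > 0" using e C0 by (auto simp: m_def)
    define h where "h n x = min \<bar>W x * Z n x\<bar> (m * (W x)\<^sup>2)" for n x
    have hi: "integrable M (h n)" for n
      by (rule Bochner_Integration.integrable_bound[OF WZ[of n]])
         (use m in \<open>auto simp: h_def[abs_def]\<close>)
    have "(\<lambda>n. integral\<^sup>L M (h n)) \<longlonglongrightarrow> (LINT x|M. 0)"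
    proof (rule integral_dominated_convergence[where w="\<lambda>x. m * (W x)\<^sup>2"])
      show "AE x in M. (\<lambda>n. h n x) \<longlonglongrightarrow> 0" using Zlim
      proof eventually_elim
        case (elim x)
        have "(\<lambda>n. min \<bar>W x * Z n x\<bar> (m * (W x)\<^sup>2)) \<longlonglongrightarrow> min \<bar>W x * 0\<bar> (m * (W x)\<^sup>2)"
          by (intro tendsto_intros elim)
        then show ?case using m by (simp add: h_def)
      qed
    qed (use m W in \<open>auto simp: h_def[abs_def] L2_def\<close>)
    then have "\<forall>\<^sub>F n in sequentially. integral\<^sup>L M (h n) < e / 2"
      using e by (intro order_tendstoD(2)) auto
    then obtain n0 where n0: "\<And>n. n \<ge> n0 \<Longrightarrow> integral\<^sup>L M (h n) < e / 2"
      by (auto simp: eventually_sequentially)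
    have "norm ((LINT x|M. W x * Z n x) - 0) < e" if "n \<ge> n0" for n
    proof -
      have pw: "\<bar>w * z\<bar> \<le> min \<bar>w * z\<bar> (m * w\<^sup>2) + z\<^sup>2 / m" for w z :: real
      proof (cases "\<bar>z\<bar> \<le> m * \<bar>w\<bar>")
        case True
        then have "\<bar>w * z\<bar> \<le> m * w\<^sup>2"
          using mult_left_mono[OF True, of "\<bar>w\<bar>"] by (simp add: abs_mult power2_eq_square algebra_simps)
        then show ?thesis using m by simp
      next
        case False
        then have "m * \<bar>w * z\<bar> \<le> z\<^sup>2"
          using mult_right_mono[of "m * \<bar>w\<bar>" "\<bar>z\<bar>" "\<bar>z\<bar>"] by (simp add: abs_mult power2_eq_square algebra_simps)
        then have "\<bar>w * z\<bar> \<le> z\<^sup>2 / m" using m by (simp add: field_simps)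
        moreover have "0 \<le> min \<bar>w * z\<bar> (m * w\<^sup>2)" using m by simp
        ultimately show ?thesis by linarith
      qed
      have "\<bar>LINT x|M. W x * Z n x\<bar> \<le> (LINT x|M. \<bar>W x * Z n x\<bar>)" by (rule integral_abs_bound)
      also have "\<dots> \<le> (LINT x|M. h n x + (Z n x)\<^sup>2 / m)"
      proof (rule integral_mono)
        show "integrable M (\<lambda>x. h n x + (Z n x)\<^sup>2 / m)"
          by (intro Bochner_Integration.integrable_add hi integrable_divide_zero L2_square_integrable Z)
      qed (use WZ pw in \<open>auto simp: h_def\<close>)
      also have "\<dots> = integral\<^sup>L M (h n) + (LINT x|M. (Z n x)\<^sup>2) / m"
        using hi Z by (simp add: L2_square_integrable)
      also have "(LINT x|M. (Z n x)\<^sup>2) / m \<le> (4 * C) / m"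
        using Zb m by (intro divide_right_mono) auto
      also have "4 * C / m \<le> e / 2" using e C0 by (simp add: m_def field_simps)
      finally show ?thesis using n0[OF that] by simp
    qed
    then show "\<exists>no. \<forall>n\<ge>no. norm ((LINT x|M. W x * Z n x) - 0) < e" by blast
  qed
  moreover have "(LINT x|M. W x * Z n x) = (LINT x|M. W x * V n x) - (LINT x|M. W x * V0 x)" for n
    using L2_mult_integrable[OF W V[of n]] L2_mult_integrable[OF W V0']
    by (simp add: Z_def right_diff_distrib)
  ultimately show "(\<lambda>n. LINT x|M. W x * V n x) \<longlonglongrightarrow> (LINT x|M. W x * V0 x)"
    by (simp add: LIM_zero_iff)
qed

text \<open>The Riesz-Fischer argument, keeping the almost everywhere convergence that the later
  limit passages rely on.\<close>

lemma L2_Cauchy_subseq: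
  assumes v: "\<And>n. v n \<in> L2 M"
    and Cauchy: "\<And>e. 0 < e \<Longrightarrow> \<exists>n0. \<forall>m\<ge>n0. \<forall>n\<ge>n0. (LINT x|M. (v m x - v n x)\<^sup>2) \<le> e"
  obtains r u where "strict_mono (r :: nat \<Rightarrow> nat)" "u \<in> L2 M"
    "AE x in M. (\<lambda>k. v (r k) x) \<longlonglongrightarrow> u x"
    "(\<lambda>k. LINT x|M. (v (r k) x - u x)\<^sup>2) \<longlonglongrightarrow> 0"
proof -
  \<comment> \<open>The rate 4^-k leaves room for the weight 2^k in \<open>G\<close>: the weighted
    squared increments still have summable integrals.\<close>
  have "\<forall>k. \<exists>n0. \<forall>m\<ge>n0. \<forall>n\<ge>n0. (LINT x|M. (v m x - v n x)\<^sup>2) \<le> (1/4) ^ k"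
    using Cauchy by simp
  then obtain N where N: "\<And>k m n. m \<ge> N k \<Longrightarrow> n \<ge> N k \<Longrightarrow> (LINT x|M. (v m x - v n x)\<^sup>2) \<le> (1/4) ^ k"
    by metis
  \<comment> \<open>The summand \<open>k\<close> makes \<open>r\<close> strictly increasing; the sum
    makes \<open>r k\<close> dominate every \<open>N i\<close> with i \<le> k.\<close>
  define r where "r k = k + (\<Sum>i\<le>k. N i)" for k :: nat
  have r: "strict_mono r" by (auto simp: strict_mono_Suc_iff r_def)
  have rN: "r j \<ge> N k" if "k \<le> j" for j k
  proof -
    have "N k \<le> (\<Sum>i\<le>j. N i)" by (rule member_le_sum) (use that in auto)
    then show ?thesis by (simp add: r_def)
  qed
  define w where "w k = v (r k)" for k
  have w: "w k \<in> L2 M" for k by (simp add: w_def v)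
  note [measurable] = L2_measurable[OF w]
  have wC: "(LINT x|M. (w k x - w j x)\<^sup>2) \<le> (1/4) ^ k" if "k \<le> j" for j k
    unfolding w_def by (rule N) (use rN that in auto)
  define G where "G k x = 2 ^ k * (w (Suc k) x - w k x)\<^sup>2" for k x
  have Gm[measurable]: "G k \<in> borel_measurable M" for k unfolding G_def[abs_def] by measurable
  have "(\<integral>\<^sup>+ x. (\<Sum>k. ennreal (G k x)) \<partial>M) = (\<Sum>k. \<integral>\<^sup>+ x. ennreal (G k x) \<partial>M)"
    by (rule nn_integral_suminf) auto
  also have "\<dots> \<le> (\<Sum>k. ennreal ((1/2) ^ k))"
  proof (rule suminf_le)
    fix k
    have i: "integrable M (\<lambda>x. (w (Suc k) x - w k x)\<^sup>2)" by (intro L2_square_integrable L2_diff w)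
    have "(\<integral>\<^sup>+ x. ennreal (G k x) \<partial>M) = ennreal (LINT x|M. G k x)"
      by (rule nn_integral_eq_integral) (use i in \<open>auto simp: G_def[abs_def]\<close>)
    also have "(LINT x|M. G k x) \<le> 2 ^ k * (1/4) ^ k"
      using wC[of k "Suc k"] by (simp add: G_def power2_commute)
    also have "(2 ^ k * (1/4) ^ k :: real) = (1/2) ^ k" by (simp add: power_mult_distrib[symmetric])
    finally show "(\<integral>\<^sup>+ x. ennreal (G k x) \<partial>M) \<le> ennreal ((1/2) ^ k)" by (simp add: ennreal_leI)
  qed auto
  also have "\<dots> < \<infinity>"
    by (subst suminf_ennreal2) (auto simp: summable_geometric)
  finally have "AE x in M. (\<Sum>k. ennreal (G k x)) \<noteq> \<infinity>"
    by (intro nn_integral_noteq_infinite) auto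
  then have conv: "AE x in M. convergent (\<lambda>k. w k x)"
  proof eventually_elim
    case (elim x)
    define B where "B = enn2real (\<Sum>k. ennreal (G k x))"
    have GB: "G k x \<le> B" for k
    proof -
      have "ennreal (G k x) \<le> (\<Sum>k. ennreal (G k x))"
        using sum_le_suminf[of "\<lambda>k. ennreal (G k x)" "{k}"] by simp
      also have "\<dots> = ennreal B" using elim by (simp add: B_def less_top)
      finally show ?thesis by (subst (asm) ennreal_le_iff) (simp_all add: B_def)
    qed
    \<comment> \<open>Since the weighted sum is finite, each term is at most \<open>B\<close>, so
      the increments are dominated by a geometric sequence of ratio sqrt (1/2) and the telescoping
      series converges.\<close>
    have dw: "norm (w (Suc k) x - w k x) \<le> sqrt B * (sqrt (1/2)) ^ k" for k
    proof -
      have "(w (Suc k) x - w k x)\<^sup>2 \<le> B * (1/2) ^ k"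
        using GB[of k] by (simp add: G_def power_divide field_simps)
      then have "sqrt ((w (Suc k) x - w k x)\<^sup>2) \<le> sqrt (B * (1/2) ^ k)" by (rule real_sqrt_le_mono)
      then show ?thesis unfolding real_sqrt_abs real_norm_def by (simp add: real_sqrt_mult real_sqrt_power)
    qed
    have "summable (\<lambda>k. sqrt B * (sqrt (1/2)) ^ k)"
      by (intro summable_mult summable_geometric) (simp add: real_sqrt_lt_1_iff)
    from summable_comparison_test'[OF this dw] have "summable (\<lambda>k. w (Suc k) x - w k x)" .
    then have "convergent (\<lambda>n. \<Sum>k<n. w (Suc k) x - w k x)" by (simp add: summable_iff_convergent)
    then have "convergent (\<lambda>n. w n x - w 0 x)" unfolding sum_lessThan_telescope[of "\<lambda>n. w n x"] .
    from convergent_add[OF this convergent_const[of "w 0 x"]] show ?case by simp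
  qed
  define u where "u x = lim (\<lambda>k. w k x)" for x
  have um[measurable]: "u \<in> borel_measurable M" unfolding u_def[abs_def] by measurable
  have lim: "AE x in M. (\<lambda>k. w k x) \<longlonglongrightarrow> u x"
    using conv by eventually_elim (auto simp: u_def convergent_LIMSEQ_iff)
  have fat: "integrable M (\<lambda>x. (w k x - u x)\<^sup>2)" "(LINT x|M. (w k x - u x)\<^sup>2) \<le> (1/4) ^ k" for k
  proof -
    \<comment> \<open>Sending the second index to infinity under Fatou turns the Cauchy bound into a
      bound on the distance to \<open>u\<close>.\<close>
    have l: "AE x in M. (\<lambda>j. (w k x - w (j + k) x)\<^sup>2) \<longlonglongrightarrow> (w k x - u x)\<^sup>2"
      using lim by eventually_elim (auto intro!: tendsto_intros LIMSEQ_ignore_initial_segment)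
    have i: "integrable M (\<lambda>x. (w k x - w (j + k) x)\<^sup>2)" for j by (intro L2_square_integrable L2_diff w)
    show "integrable M (\<lambda>x. (w k x - u x)\<^sup>2)" "(LINT x|M. (w k x - u x)\<^sup>2) \<le> (1/4) ^ k"
      by (rule integrable_Fatou integral_Fatou; (rule i wC tendsto_const l)?; simp)+
  qed
  then have "(\<lambda>x. w 0 x - u x) \<in> L2 M" by (auto simp: L2_def)
  from L2_diff[OF w[of 0] this] have uL2: "u \<in> L2 M" by simp
  have "(\<lambda>k. LINT x|M. (w k x - u x)\<^sup>2) \<longlonglongrightarrow> 0"
  proof (rule tendsto_sandwich[OF _ _ tendsto_const])
    show "(\<lambda>k. (1/4::real) ^ k) \<longlonglongrightarrow> 0" by (rule LIMSEQ_realpow_zero) auto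
  qed (use fat in auto)
  then show ?thesis using that[OF r uL2] lim by (simp add: w_def)
qed

section \<open>The Gagliardo quotient and ball averages\<close>

text \<open>The exponent is half of that in the Gagliardo kernel: up to a constant, the form becomes
  the L2 product of two quotients, and every L2 fact applies to it.\<close>

definition gquot :: "real \<Rightarrow> ('a::euclidean_space \<Rightarrow> real) \<Rightarrow> 'a \<times> 'a \<Rightarrow> real" where
  "gquot s u p = (u (fst p) - u (snd p)) / norm (fst p - snd p) powr ((real DIM('a) + 2 * s) / 2)"

lemma gagliardo_integrand_gquot: "gagliardo_integrand s u v p = gquot s u p * gquot s v p"
  by (cases p) (simp add: gagliardo_integrand_def gquot_def powr_add[symmetric])

lemma gquot_add: "gquot s (\<lambda>x. u x + v x) p = gquot s u p + gquot s v p"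
  and gquot_cmult: "gquot s (\<lambda>x. c * u x) p = c * gquot s u p"
  by (auto simp: gquot_def algebra_simps add_divide_distrib diff_divide_distrib)

lemma borel_measurable_gquot:
  fixes u :: "'a::euclidean_space \<Rightarrow> real"
  assumes [measurable]: "u \<in> borel_measurable lebesgue"
  shows "gquot s u \<in> borel_measurable lebesgue"
proof -
  have "(\<lambda>p::'a \<times> 'a. norm (fst p - snd p)) \<in> borel_measurable borel"
    by (intro borel_measurable_continuous_onI continuous_intros)
  then have "(\<lambda>p::'a \<times> 'a. norm (fst p - snd p) powr ((real DIM('a) + 2 * s) / 2)) \<in> borel_measurable lborel"
    by simp
  from measurable_completion[OF this] show ?thesis
    unfolding gquot_def[abs_def] by measurable
qed

lemma X0_iff:
  "u \<in> X0 s \<Omega> \<longleftrightarrow> u \<in> L2 lebesgue \<and> gquot s u \<in> L2 lebesgue \<and> (AE x in lebesgue. x \<notin> \<Omega> \<longrightarrow> u x = 0)"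
  by (auto simp: X0_def H_frac_def L2_def gagliardo_integrand_gquot[abs_def] power2_eq_square
      borel_measurable_gquot)

lemma X0_L2: "u \<in> X0 s \<Omega> \<Longrightarrow> u \<in> L2 lebesgue"
  and X0_gquot_L2: "u \<in> X0 s \<Omega> \<Longrightarrow> gquot s u \<in> L2 lebesgue"
  and X0_AE_zero: "u \<in> X0 s \<Omega> \<Longrightarrow> AE x in lebesgue. x \<notin> \<Omega> \<longrightarrow> u x = 0"
  and X0_measurable: "u \<in> X0 s \<Omega> \<Longrightarrow> u \<in> borel_measurable lebesgue"
  by (auto simp: X0_iff L2_measurable)

lemma X0_add: "u \<in> X0 s \<Omega> \<Longrightarrow> v \<in> X0 s \<Omega> \<Longrightarrow> (\<lambda>x. u x + v x) \<in> X0 s \<Omega>"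
  by (auto simp: X0_iff gquot_add[abs_def] L2_add)

lemma X0_cmult: "u \<in> X0 s \<Omega> \<Longrightarrow> (\<lambda>x. c * u x) \<in> X0 s \<Omega>"
  by (auto simp: X0_iff gquot_cmult[abs_def] L2_cmult)

text \<open>Valued in \<open>ennreal\<close> because it is finite only for almost every
  \<open>x\<close>; its \<open>enn2real\<close> version is integrable and carries the whole
  Gagliardo integral.\<close>

definition gagliardo_slice :: "real \<Rightarrow> ('a::euclidean_space \<Rightarrow> real) \<Rightarrow> 'a \<Rightarrow> ennreal" where
  "gagliardo_slice s u x = (\<integral>\<^sup>+ y. ennreal ((gquot s u (x, y))\<^sup>2) \<partial>lebesgue)"

lemma gagliardo_slice:
  fixes u :: "'a::euclidean_space \<Rightarrow> real"
  assumes "u \<in> borel_measurable lebesgue" and g: "gquot s u \<in> L2 lebesgue"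
  shows "AE x in lebesgue. gagliardo_slice s u x < \<infinity>"
    and "integrable lebesgue (\<lambda>x. enn2real (gagliardo_slice s u x))"
    and "(LINT x|lebesgue. enn2real (gagliardo_slice s u x)) = (LINT p|lebesgue. (gquot s u p)\<^sup>2)"
proof -
  have m: "(\<lambda>p. ennreal ((gquot s u p)\<^sup>2)) \<in> borel_measurable lebesgue"
    using L2_measurable[OF g] by measurable
  have sm[measurable]: "gagliardo_slice s u \<in> borel_measurable lebesgue"
    unfolding gagliardo_slice_def[abs_def] by (rule borel_measurable_nn_integral_lebesgue[OF m])
  have eq: "(\<integral>\<^sup>+ x. gagliardo_slice s u x \<partial>lebesgue) = ennreal (LINT p|lebesgue. (gquot s u p)\<^sup>2)"
    unfolding gagliardo_slice_def nn_integral_lebesgue_fst[OF m]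
    by (rule nn_integral_eq_integral) (use L2_square_integrable[OF g] in auto)
  show fin: "AE x in lebesgue. gagliardo_slice s u x < \<infinity>"
    using nn_integral_noteq_infinite[OF sm] eq by (auto simp: less_top)
  have eq2: "(\<integral>\<^sup>+ x. ennreal (enn2real (gagliardo_slice s u x)) \<partial>lebesgue)
      = ennreal (LINT p|lebesgue. (gquot s u p)\<^sup>2)"
    unfolding eq[symmetric] by (rule nn_integral_cong_AE) (use fin in \<open>auto simp: less_top\<close>)
  show "integrable lebesgue (\<lambda>x. enn2real (gagliardo_slice s u x))"
    by (rule integrableI_nonneg) (use eq2 in auto)
  show "(LINT x|lebesgue. enn2real (gagliardo_slice s u x)) = (LINT p|lebesgue. (gquot s u p)\<^sup>2)"
    by (subst integral_eq_nn_integral) (auto simp: eq2)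
qed

definition ball_avg :: "real \<Rightarrow> ('a::euclidean_space \<Rightarrow> real) \<Rightarrow> 'a \<Rightarrow> real" where
  "ball_avg r u c = (LINT y|lebesgue. indicator (ball c r) y * u y) / measure lebesgue (ball c r)"

lemma measure_lebesgue_ball:
  fixes c :: "'a::euclidean_space"
  assumes "0 < r"
  shows "measure lebesgue (ball c r) = unit_ball_vol (real DIM('a)) * r powr real DIM('a)"
    and "measure lebesgue (ball c r) > 0"
proof -
  have "measure lebesgue (ball c r) = measure lborel (ball c r)" by (rule measure_completion) auto
  then show *: "measure lebesgue (ball c r) = unit_ball_vol (real DIM('a)) * r powr real DIM('a)"
    using assms by (simp add: content_ball powr_realpow)
  show "measure lebesgue (ball c r) > 0" unfolding * using assms by simp
qed

lemma
  assumes "S \<in> lmeasurable"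
  shows integrable_indicator_lmeasurable: "integrable lebesgue (indicator S :: 'a::euclidean_space \<Rightarrow> real)"
    and indicator_L2: "(indicator S :: 'a \<Rightarrow> real) \<in> L2 lebesgue"
proof -
  show i: "integrable lebesgue (indicator S :: 'a \<Rightarrow> real)"
    using assms by (intro integrable_real_indicator) (auto simp: fmeasurable_def)
  then show "(indicator S :: 'a \<Rightarrow> real) \<in> L2 lebesgue"
    by (simp add: L2_def power2_eq_square indicator_inter_arith[symmetric] borel_measurable_integrable del: integrable_indicator_iff)
qed

text \<open>For \<open>y\<close> in the ball, |x - y| \<le> h + r, so the squared difference is at
  most (h + r)^(N + 2s) times the squared quotient at (x, y); averaging in \<open>y\<close> is
  Jensen's inequality. The centre may differ from \<open>x\<close>, which both Poincare and the
  approximation with countably many centres exploit.\<close>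

lemma ball_avg_deviation:
  fixes u :: "'a::euclidean_space \<Rightarrow> real"
  assumes [measurable]: "u \<in> borel_measurable lebesgue" and fin: "gagliardo_slice s u x < \<infinity>"
    and x: "dist x c \<le> h" and h: "0 \<le> h" and r: "0 < r" and s: "0 < s"
  shows "(u x - ball_avg r u c)\<^sup>2
    \<le> (h + r) powr (real DIM('a) + 2 * s) / measure lebesgue (ball c r) * enn2real (gagliardo_slice s u x)"
proof -
  define \<beta> where "\<beta> = measure lebesgue (ball c r)"
  have \<beta>: "\<beta> > 0" using measure_lebesgue_ball(2)[OF r] by (simp add: \<beta>_def)
  define I :: "'a \<Rightarrow> real" where "I = indicator (ball c r)"
  have I2: "I y * I y = I y" "I y = 0 \<or> I y = 1" for y by (auto simp: I_def indicator_def)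
  have I: "I \<in> L2 lebesgue" and Ii: "integrable lebesgue I" and Iint: "integral\<^sup>L lebesgue I = \<beta>"
    unfolding I_def by (intro indicator_L2 integrable_indicator_lmeasurable lmeasurable_ball)+
      (simp add: \<beta>_def)
  note [measurable] = L2_measurable[OF I]
  define P where "P = (h + r) powr (real DIM('a) + 2 * s)"
  define q where "q y = gquot s u (x, y)" for y
  have qm[measurable]: "q \<in> borel_measurable lebesgue"
  proof -
    have "(\<lambda>y. norm (x - y)) \<in> borel_measurable borel"
      by (intro borel_measurable_continuous_onI continuous_intros)
    then have "(\<lambda>y. norm (x - y) powr ((real DIM('a) + 2 * s) / 2)) \<in> borel_measurable lborel"
      by simp
    from measurable_completion[OF this] show ?thesis
      unfolding q_def[abs_def] gquot_def by simp
  qed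
  have qi: "integrable lebesgue (\<lambda>y. (q y)\<^sup>2)"
  proof (rule integrableI_nonneg)
    show "(\<integral>\<^sup>+ y. ennreal ((q y)\<^sup>2) \<partial>lebesgue) < \<infinity>"
      using fin by (simp add: gagliardo_slice_def q_def)
  qed auto
  have qI: "(LINT y|lebesgue. (q y)\<^sup>2) = enn2real (gagliardo_slice s u x)"
    by (subst integral_eq_nn_integral) (auto simp: gagliardo_slice_def q_def[symmetric])
  define g where "g y = I y * (u x - u y)" for y
  have gm[measurable]: "g \<in> borel_measurable lebesgue" unfolding g_def[abs_def] by measurable
  have gq: "(g y)\<^sup>2 \<le> P * (q y)\<^sup>2" for y
  proof (cases "y \<in> ball c r \<and> x \<noteq> y")
    case False then show ?thesis by (auto simp: g_def I_def P_def indicator_def)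
  next
    case True
    then have n: "norm (x - y) \<le> h + r" "norm (x - y) > 0"
      using x dist_triangle[of x y c] by (auto simp: dist_norm norm_minus_commute)
    have "(g y)\<^sup>2 = norm (x - y) powr (real DIM('a) + 2 * s) * (q y)\<^sup>2"
      using True by (simp add: g_def I_def q_def gquot_def power_divide power2_eq_square[of "_ powr _"] powr_add[symmetric])
    also have "\<dots> \<le> P * (q y)\<^sup>2"
      unfolding P_def using n s by (intro mult_right_mono powr_mono2) auto
    finally show ?thesis .
  qed
  have gi2: "integrable lebesgue (\<lambda>y. (g y)\<^sup>2)"
    by (rule Bochner_Integration.integrable_bound[OF integrable_mult_right[OF qi, of P]])
       (use gq in \<open>auto simp: P_def\<close>)
  have gL2: "g \<in> L2 lebesgue" using gi2 by (auto simp: L2_def)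
  have "integrable lebesgue (\<lambda>y. I y * g y)" by (rule L2_mult_integrable[OF I gL2])
  moreover have "I y * g y = g y" for y by (simp add: g_def mult.assoc[symmetric] I2(1))
  ultimately have gi: "integrable lebesgue g" by simp
  define t where "t = integral\<^sup>L lebesgue g / \<beta>"
  \<comment> \<open>Integrability of \<open>u\<close> over the ball is inherited from
    \<open>g\<close>, whose square is dominated by the finite slice integral.\<close>
  have Iu: "I y * u y = u x * I y - g y" for y by (simp add: g_def algebra_simps)
  have "(LINT y|lebesgue. I y * u y) = u x * \<beta> - integral\<^sup>L lebesgue g"
    unfolding Iu using gi Ii by (simp add: Iint)
  then have t: "u x - ball_avg r u c = t"
    using \<beta> by (simp add: ball_avg_def t_def I_def[symmetric] \<beta>_def[symmetric] diff_divide_distrib)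
  \<comment> \<open>Jensen by expanding a square: \<open>t\<close> is the mean of \<open>g\<close>
    over the ball, so the expansion leaves the integral of g^2 minus t^2 times the volume.\<close>
  have "0 \<le> (LINT y|lebesgue. (g y - t * I y)\<^sup>2)" by simp
  also have "\<dots> = (LINT y|lebesgue. (g y)\<^sup>2 - 2 * t * g y + t\<^sup>2 * I y)"
  proof (rule Bochner_Integration.integral_cong[OF refl])
    show "(g y - t * I y)\<^sup>2 = (g y)\<^sup>2 - 2 * t * g y + t\<^sup>2 * I y" for y
      using I2(2)[of y] by (auto simp: g_def power2_eq_square algebra_simps)
  qed
  also have "\<dots> = (LINT y|lebesgue. (g y)\<^sup>2) - 2 * t * (t * \<beta>) + t\<^sup>2 * \<beta>"
    using gi2 gi Ii \<beta> by (simp add: Iint t_def)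
  finally have "t\<^sup>2 * \<beta> \<le> (LINT y|lebesgue. (g y)\<^sup>2)" by (simp add: power2_eq_square ac_simps)
  also have "\<dots> \<le> (LINT y|lebesgue. P * (q y)\<^sup>2)"
    by (rule integral_mono) (use gi2 qi gq in auto)
  also have "\<dots> = P * enn2real (gagliardo_slice s u x)" by (simp add: qI)
  finally show ?thesis using \<beta> unfolding t \<beta>_def[symmetric] P_def[symmetric] by (simp add: field_simps)
qed

text \<open>A unit ball whose centre has norm R + 1 misses \<open>ball 0 R\<close>, hence \<Omega>,
  so the average of \<open>u\<close> over it is zero; its centre is within 2R + 1 of every point of
  \<Omega>. The deviation estimate then bounds u^2 by a fixed multiple of the slice.\<close>

lemma X0_poincare:
  fixes \<Omega> :: "'a::euclidean_space set"
  assumes \<Omega>: "bounded \<Omega>" and s: "0 < s"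
  obtains C where "0 \<le> C"
    "\<And>u. u \<in> X0 s \<Omega> \<Longrightarrow> (LINT x|lebesgue. (u x)\<^sup>2) \<le> C * (LINT p|lebesgue. (gquot s u p)\<^sup>2)"
proof -
  obtain R where R: "0 < R" "\<Omega> \<subseteq> ball 0 R"
    using bounded_subset_ballD[OF \<Omega>, of 0] by auto
  obtain c :: 'a where c: "norm c = R + 1"
    using vector_choose_size[of "R + 1"] R by auto
  define C where "C = (2 * R + 1 + 1) powr (real DIM('a) + 2 * s) / measure lebesgue (ball c 1)"
  have C: "0 \<le> C" by (simp add: C_def)
  have "(LINT x|lebesgue. (u x)\<^sup>2) \<le> C * (LINT p|lebesgue. (gquot s u p)\<^sup>2)" if u: "u \<in> X0 s \<Omega>" for u
  proof -
    note um[measurable] = X0_measurable[OF u]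
    note sl = gagliardo_slice[OF um X0_gquot_L2[OF u]]
    have "(LINT y|lebesgue. indicator (ball c 1) y * u y) = 0"
    proof (rule integral_eq_zero_AE)
      show "AE y in lebesgue. indicator (ball c 1) y * u y = 0"
        using X0_AE_zero[OF u]
      proof eventually_elim
        case (elim y)
        have "y \<notin> ball c 1" if "y \<in> \<Omega>"
          using R(2) that c norm_triangle_ineq2[of c y] by (auto simp: dist_norm)
        then show ?case using elim by (auto simp: indicator_def)
      qed
    qed
    then have avg: "ball_avg 1 u c = 0" by (simp add: ball_avg_def)
    have "AE x in lebesgue. (u x)\<^sup>2 \<le> C * enn2real (gagliardo_slice s u x)"
      using sl(1) X0_AE_zero[OF u]
    proof eventually_elim
      case (elim x)
      show ?case
      proof (cases "x \<in> \<Omega>")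
        case True
        then have "dist x c \<le> 2 * R + 1"
          using R(2) c norm_triangle_ineq4[of x c] by (auto simp: dist_norm)
        then show ?thesis
          using ball_avg_deviation[OF um elim(1) _ _ _ s, of c "2 * R + 1" 1] R(1) avg by (simp add: C_def)
      qed (use elim C in auto)
    qed
    then have "(LINT x|lebesgue. (u x)\<^sup>2) \<le> (LINT x|lebesgue. C * enn2real (gagliardo_slice s u x))"
      by (intro integral_mono_AE) (use sl L2_square_integrable[OF X0_L2[OF u]] in auto)
    then show ?thesis using sl by simp
  qed
  then show ?thesis using that C by blast
qed

text \<open>In place of Hoelder's inequality: t \<le> d + d^(1-p) t^p for t \<ge> 0, by cases t
  \<le> d and t > d. The level \<open>d\<close> is free; the embedding balances it against the
  radius, compactness takes it to be 1.\<close>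

lemma abs_ball_avg_le:
  fixes u :: "'a::euclidean_space \<Rightarrow> real"
  assumes [measurable]: "u \<in> borel_measurable lebesgue"
    and P: "integrable lebesgue (\<lambda>x. \<bar>u x\<bar> powr p)" and p: "1 < p" and r: "0 < r" and d: "0 < d"
  shows "\<bar>ball_avg r u c\<bar>
    \<le> d + d powr (1 - p) * (LINT x|lebesgue. \<bar>u x\<bar> powr p) / measure lebesgue (ball c r)"
proof -
  define \<beta> where "\<beta> = measure lebesgue (ball c r)"
  have \<beta>: "\<beta> > 0" using measure_lebesgue_ball(2)[OF r] by (simp add: \<beta>_def)
  define I :: "'a \<Rightarrow> real" where "I = indicator (ball c r)"
  have Ii: "integrable lebesgue I" and Iint: "integral\<^sup>L lebesgue I = \<beta>"
    unfolding I_def by (intro integrable_indicator_lmeasurable lmeasurable_ball)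
      (simp add: \<beta>_def)
  have pw: "t \<le> d + d powr (1 - p) * t powr p" if "0 \<le> t" for t
  proof (cases "t \<le> d")
    case True then show ?thesis by (simp add: add_increasing2)
  next
    case False
    then have "t = t powr (1 - p) * t powr p" using d by (simp add: powr_add[symmetric])
    also have "\<dots> \<le> d powr (1 - p) * t powr p"
      using False d p by (intro mult_right_mono powr_mono2') auto
    finally show ?thesis using d by simp
  qed
  have bd: "\<bar>I y * u y\<bar> \<le> d * I y + d powr (1 - p) * \<bar>u y\<bar> powr p" for y
    using pw[of "\<bar>u y\<bar>"] by (auto simp: I_def indicator_def)
  have i1: "integrable lebesgue (\<lambda>y. d * I y + d powr (1 - p) * \<bar>u y\<bar> powr p)" using Ii P by auto
  have "\<bar>LINT y|lebesgue. I y * u y\<bar> \<le> (LINT y|lebesgue. \<bar>I y * u y\<bar>)" by (rule integral_abs_bound)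
  also have "\<dots> \<le> (LINT y|lebesgue. d * I y + d powr (1 - p) * \<bar>u y\<bar> powr p)"
    by (rule integral_mono_AE'[OF i1]) (use bd order.trans[OF abs_ge_zero bd] in auto)
  also have "\<dots> = d * \<beta> + d powr (1 - p) * (LINT x|lebesgue. \<bar>u x\<bar> powr p)"
    using Ii P by (simp add: Iint)
  finally have "\<bar>LINT y|lebesgue. I y * u y\<bar> / \<beta> \<le> (d * \<beta> + d powr (1 - p) * (LINT x|lebesgue. \<bar>u x\<bar> powr p)) / \<beta>"
    using \<beta> by (intro divide_right_mono) auto
  then show ?thesis using \<beta> by (simp add: ball_avg_def I_def[symmetric] \<beta>_def[symmetric] add_divide_distrib)
qed

section \<open>Fractional Sobolev embedding\<close>

text \<open>With \<open>E = D + 1\<close>, \<open>D\<close> the slice of the Gagliardo integral at \<open>x\<close>, compare \<open>u x\<close> with its average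
  over a ball of radius \<open>\<rho>\<close>: the deviation is at most a multiple of \<open>\<rho> powr s * sqrt E\<close>, the average at
  most a multiple of \<open>\<rho> powr (-N/p)\<close>. The radius chosen below makes both equal to \<open>E powr \<kappa>\<close>.\<close>

lemma X0_powr_integrable_step:
  fixes \<Omega> :: "'a::euclidean_space set"
  assumes u: "u \<in> X0 s \<Omega>" and \<Omega>: "\<Omega> \<in> lmeasurable" and s: "0 < s" and p: "1 < p"
    and P: "integrable lebesgue (\<lambda>x. \<bar>u x\<bar> powr p)"
  shows "integrable lebesgue (\<lambda>x. \<bar>u x\<bar> powr (2 + 2 * s * p / DIM('a)))"
proof -
  define N where "N = real DIM('a)"
  have N: "0 < N" by (simp add: N_def)
  define \<omega> where "\<omega> = unit_ball_vol N"
  have \<omega>: "0 < \<omega>" by (simp add: \<omega>_def N_def)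
  \<comment> \<open>The solution of \<kappa> = 1/2 - s \<kappa> p / N: with \<rho> = E^(-\<kappa> p
    / N), both \<rho>^s sqrt E and \<rho>^(-N/p) equal E^\<kappa>.\<close>
  define \<kappa> where "\<kappa> = N / (2 * (s * p + N))"
  have spN: "s * p + N > 0" using s p N by (simp add: add_pos_pos)
  have \<kappa>: "0 < \<kappa>" using spN N by (simp add: \<kappa>_def)
  have \<kappa>1: "1 - 2 * s * \<kappa> * p / N = 2 * \<kappa>"
  proof -
    have "2 * s * (N / (2 * X)) * p / N = s * p / X" for X using N by simp
    then have "2 * s * \<kappa> * p / N = s * p / (s * p + N)" unfolding \<kappa>_def .
    moreover have "2 * (N / (2 * X)) = N / X" for X by simp
    then have "2 * \<kappa> = N / (s * p + N)" unfolding \<kappa>_def .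
    moreover have "1 - s * p / (s * p + N) = N / (s * p + N)" using spN by (simp add: field_simps)
    ultimately show ?thesis by simp
  qed
  have \<kappa>2: "2 + 2 * s * p / N = 1 / \<kappa>" using spN N by (simp add: \<kappa>_def field_simps)
  note um[measurable] = X0_measurable[OF u]
  note sl = gagliardo_slice[OF um X0_gquot_L2[OF u]]
  define I where "I = (LINT x|lebesgue. \<bar>u x\<bar> powr p)"
  have I: "0 \<le> I" by (simp add: I_def)
  define A where "A = 2 powr (N + 2 * s) / \<omega>"
  have A: "0 \<le> A" using \<omega> by (simp add: A_def)
  define C where "C = sqrt A + 1 + I / \<omega>"
  have C: "0 < C"
    unfolding C_def by (intro add_pos_nonneg add_nonneg_pos divide_nonneg_pos) (use A I \<omega> in auto)
  have key: "\<bar>u x\<bar> powr (1 / \<kappa>) \<le> C powr (1 / \<kappa>) * (enn2real (gagliardo_slice s u x) + 1)"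
    if fin: "gagliardo_slice s u x < \<infinity>" for x
  proof -
    define D where "D = enn2real (gagliardo_slice s u x)"
    have D: "0 \<le> D" by (simp add: D_def)
    \<comment> \<open>Adding 1 keeps the base of the powers positive where the slice integral
      vanishes.\<close>
    define E where "E = D + 1"
    have E: "0 < E" "D \<le> E" using D by (auto simp: E_def)
    define \<rho> where "\<rho> = E powr (- \<kappa> * p / N)"
    have \<rho>: "0 < \<rho>" using E by (simp add: \<rho>_def)
    define m where "m = ball_avg \<rho> u x"
    have vol: "measure lebesgue (ball x \<rho>) = \<omega> * \<rho> powr N"
      using measure_lebesgue_ball(1)[OF \<rho>, of x] by (simp add: \<omega>_def N_def)
    have "(u x - m)\<^sup>2 \<le> (\<rho> + \<rho>) powr (N + 2 * s) / (\<omega> * \<rho> powr N) * D"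
      using ball_avg_deviation[OF um fin _ _ \<rho> s, of x \<rho>, unfolded vol] \<rho>
      by (simp add: m_def D_def N_def)
    also have "\<dots> = A * \<rho> powr (2 * s) * D"
    proof -
      have "(\<rho> + \<rho>) powr (N + 2 * s) = 2 powr (N + 2 * s) * (\<rho> powr N * \<rho> powr (2 * s))"
        using \<rho> by (simp add: powr_mult[symmetric] powr_add[symmetric])
      then show ?thesis using \<rho> \<omega> by (simp add: A_def)
    qed
    also have "\<dots> \<le> A * \<rho> powr (2 * s) * E" using A E by (intro mult_left_mono) auto
    also have "\<dots> = A * E powr (2 * \<kappa>)"
    proof -
      have "\<rho> powr (2 * s) * E = E powr (- \<kappa> * p / N * (2 * s)) * E powr 1"
        using E by (simp add: \<rho>_def powr_powr)
      also have "\<dots> = E powr (1 - 2 * s * \<kappa> * p / N)"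
        unfolding powr_add[symmetric] by (simp add: algebra_simps)
      finally show ?thesis by (simp add: \<kappa>1)
    qed
    also have "\<dots> = (sqrt A * E powr \<kappa>)\<^sup>2"
      using A by (simp add: power_mult_distrib power2_eq_square[of "_ powr _"] powr_add[symmetric])
    finally have d1: "\<bar>u x - m\<bar> \<le> sqrt A * E powr \<kappa>"
      using A by (simp add: power2_le_iff_abs_le)
    \<comment> \<open>The level \<open>d\<close> is taken to be E^\<kappa>, which makes both terms
      of the bound multiples of E^\<kappa>.\<close>
    have "\<bar>m\<bar> \<le> E powr \<kappa> + (E powr \<kappa>) powr (1 - p) * I / (\<omega> * \<rho> powr N)"
      using abs_ball_avg_le[OF um P p \<rho>, of "E powr \<kappa>" x, unfolded vol] E by (simp add: m_def I_def)
    also have "(E powr \<kappa>) powr (1 - p) * I / (\<omega> * \<rho> powr N) = I / \<omega> * E powr \<kappa>"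
    proof -
      have "(E powr \<kappa>) powr (1 - p) / \<rho> powr N = E powr (\<kappa> * (1 - p)) / E powr (- \<kappa> * p)"
        using N by (simp add: \<rho>_def powr_powr)
      also have "\<dots> = E powr \<kappa>"
        unfolding powr_diff[symmetric] by (simp add: algebra_simps)
      finally have "(E powr \<kappa>) powr (1 - p) / \<rho> powr N = E powr \<kappa>" .
      then have "I / \<omega> * ((E powr \<kappa>) powr (1 - p) / \<rho> powr N) = I / \<omega> * E powr \<kappa>" by simp
      then show ?thesis by (simp add: field_simps)
    qed
    finally have "\<bar>u x\<bar> \<le> C * E powr \<kappa>"
      using d1 by (simp add: C_def algebra_simps)
    then have "\<bar>u x\<bar> powr (1 / \<kappa>) \<le> (C * E powr \<kappa>) powr (1 / \<kappa>)"
      using \<kappa> by (intro powr_mono2) auto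
    also have "\<dots> = C powr (1 / \<kappa>) * E"
      using C E \<kappa> by (simp add: powr_mult powr_powr)
    finally show ?thesis by (simp add: E_def D_def)
  qed
  \<comment> \<open>The constant 1 in \<open>E\<close> is not integrable over the whole space; it is
    replaced by the indicator of \<Omega>, outside of which \<open>u\<close> vanishes.\<close>
  have i: "integrable lebesgue (\<lambda>x. C powr (1 / \<kappa>) * (enn2real (gagliardo_slice s u x) + indicator \<Omega> x))"
    using sl integrable_indicator_lmeasurable[OF \<Omega>]
    by (intro integrable_mult_right Bochner_Integration.integrable_add)
  have "integrable lebesgue (\<lambda>x. \<bar>u x\<bar> powr (1 / \<kappa>))"
  proof (rule Bochner_Integration.integrable_bound[OF i])
    show "AE x in lebesgue. norm (\<bar>u x\<bar> powr (1 / \<kappa>))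
        \<le> norm (C powr (1 / \<kappa>) * (enn2real (gagliardo_slice s u x) + indicator \<Omega> x))"
      using sl(1) X0_AE_zero[OF u]
    proof eventually_elim
      case (elim x)
      show ?case
      proof (cases "x \<in> \<Omega>")
        case True
        then show ?thesis using key[OF elim(1)] by (simp add: abs_mult)
      qed (use elim in auto)
    qed
  qed auto
  then show ?thesis using \<kappa>2 by (simp add: N_def)
qed

lemma X0_powr_integrable:
  fixes \<Omega> :: "'a::euclidean_space set"
  assumes u: "u \<in> X0 s \<Omega>" and \<Omega>: "\<Omega> \<in> lmeasurable" and s: "0 < s" and sN: "2 * s < DIM('a)"
    and q: "0 < q" "q < 2 * real DIM('a) / (real DIM('a) - 2 * s)"
  shows "integrable lebesgue (\<lambda>x. \<bar>u x\<bar> powr q)"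
proof -
  define N where "N = real DIM('a)"
  have N: "0 < N" by (simp add: N_def)
  define \<tau> where "\<tau> = 2 * s / N"
  have \<tau>: "0 < \<tau>" "\<tau> < 1" using s sN N by (auto simp: \<tau>_def N_def)
  define P where "P = 2 / (1 - \<tau>)"
  have P: "2 \<le> P" using \<tau> by (simp add: P_def field_simps)
  have PN: "P = 2 * N / (N - 2 * s)" using N sN by (simp add: P_def \<tau>_def field_simps N_def)
  have rec: "2 + \<tau> * P = P" using \<tau> by (simp add: P_def field_simps)
  \<comment> \<open>The orbit of 2 under p -> 2 + \<tau> p in closed form. This map contracts by
    \<tau> < 1 towards its fixed point \<open>P\<close>, the critical exponent, so the orbit passes
    every \<open>q\<close> below it.\<close>
  define p where "p j = P - \<tau> ^ j * (P - 2)" for j :: nat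
  have p2: "2 \<le> p j" for j
  proof -
    have "\<tau> ^ j * (P - 2) \<le> 1 * (P - 2)"
      using \<tau> P by (intro mult_right_mono power_le_one) auto
    then show ?thesis by (simp add: p_def)
  qed
  have int: "integrable lebesgue (\<lambda>x. \<bar>u x\<bar> powr p j)" for j
  proof (induction j)
    case 0
    then show ?case using L2_square_integrable[OF X0_L2[OF u]] by (simp add: p_def)
  next
    case (Suc j)
    have "p (Suc j) = 2 + \<tau> * P - \<tau> * (\<tau> ^ j * (P - 2))" by (simp add: p_def rec)
    also have "\<dots> = 2 + \<tau> * p j" by (simp add: p_def right_diff_distrib)
    also have "\<dots> = 2 + 2 * s * p j / N" by (simp add: \<tau>_def)
    finally show ?case
      using X0_powr_integrable_step[OF u \<Omega> s _ Suc] p2[of j] by (simp add: N_def)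
  qed
  have "(\<lambda>j. P - \<tau> ^ j * (P - 2)) \<longlonglongrightarrow> P - 0 * (P - 2)"
    using \<tau> by (intro tendsto_intros LIMSEQ_realpow_zero) auto
  then have "\<forall>\<^sub>F j in sequentially. q < p j"
    using q PN by (intro order_tendstoD(1)) (auto simp: p_def N_def)
  then obtain j where j: "q < p j" by (auto simp: eventually_sequentially)
  note [measurable] = X0_measurable[OF u]
  show ?thesis
  proof (rule Bochner_Integration.integrable_bound)
    \<comment> \<open>On \<Omega>, which has finite measure, |u|^q \<le> 1 + |u|^(p j).\<close>
    show "integrable lebesgue (\<lambda>x. indicator \<Omega> x + \<bar>u x\<bar> powr p j)"
      using int integrable_indicator_lmeasurable[OF \<Omega>] by auto
    show "AE x in lebesgue. norm (\<bar>u x\<bar> powr q) \<le> norm (indicator \<Omega> x + \<bar>u x\<bar> powr p j)"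
      using X0_AE_zero[OF u]
    proof eventually_elim
      case (elim x)
      show ?case
      proof (cases "x \<in> \<Omega>")
        case True
        show ?thesis
        proof (cases "\<bar>u x\<bar> \<le> 1")
          case True
          then have "\<bar>u x\<bar> powr q \<le> 1" using q powr_mono2[of q "\<bar>u x\<bar>" 1] by simp
          then show ?thesis using \<open>x \<in> \<Omega>\<close> by (simp add: add_increasing2)
        next
          case False
          then show ?thesis using j by (simp add: add_increasing powr_mono)
        qed
      qed (use elim in auto)
    qed
  qed auto
qed

section \<open>Almost everywhere limits and convergent subsequences\<close>

lemma gquot_AE_limit:
  assumes "AE x in lebesgue. (\<lambda>n. u n x) \<longlonglongrightarrow> v x"
  shows "AE p in lebesgue. (\<lambda>n. gquot s (u n) p) \<longlonglongrightarrow> gquot s v p"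
  using AE_lebesgue_fst[OF assms] AE_lebesgue_snd[OF assms]
  \<comment> \<open>As multiplication by a constant inverse, the division needs no separate case for
    the vanishing denominator on the diagonal.\<close>
  by eventually_elim (unfold gquot_def divide_inverse, intro tendsto_mult tendsto_diff tendsto_const)

text \<open>The diagonal argument in topological form: a product of compact intervals is compact,
  and over a countable index type the function space is metrizable, so compactness is
  sequential.\<close>

lemma pointwise_bounded_convergent_subseq:
  fixes F :: "nat \<Rightarrow> 'i::countable \<Rightarrow> real"
  assumes "\<And>n j. \<bar>F n j\<bar> \<le> M j"
  obtains r l where "strict_mono (r :: nat \<Rightarrow> nat)" "\<And>j. (\<lambda>n. F (r n) j) \<longlonglongrightarrow> l j"
proof -
  have "compactin (product_topology (\<lambda>_. euclidean) UNIV) (PiE UNIV (\<lambda>j. {- M j..M j}))"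
    by (subst compactin_PiE) auto
  then have "compact (PiE UNIV (\<lambda>j. {- M j..M j}))"
    by (simp add: euclidean_product_topology)
  then have sc: "seq_compact (PiE UNIV (\<lambda>j. {- M j..M j}))"
    by (simp add: compact_eq_seq_compact_metric)
  have "\<forall>n. F n \<in> PiE UNIV (\<lambda>j. {- M j..M j})"
    using assms by (auto simp: abs_le_iff minus_le_iff)
  from seq_compactE[OF sc this] obtain l r
    where r: "strict_mono r" and l: "(F \<circ> r) \<longlonglongrightarrow> l" by metis
  have "(\<lambda>n. (F \<circ> r) n j) \<longlonglongrightarrow> l j" for j
    by (rule continuous_on_tendsto_compose[OF continuous_on_product_coordinates l]) auto
  then show ?thesis using that[OF r] by (auto simp: o_def)
qed

section \<open>Compactness\<close>

text \<open>Square integrability of the quotient passes to the limit by Fatou under the uniform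
  energy bound; the exterior condition does because one null set serves all
  \<open>n\<close>.\<close>

lemma X0_limit:
  assumes u: "\<And>n. u n \<in> X0 s \<Omega>" and v: "v \<in> L2 lebesgue"
    and lim: "AE x in lebesgue. (\<lambda>n. u n x) \<longlonglongrightarrow> v x"
    and bd: "\<And>n. (LINT p|lebesgue. (gquot s (u n) p)\<^sup>2) \<le> C"
  shows "v \<in> X0 s \<Omega>"
proof -
  have "gquot s v \<in> L2 lebesgue"
    by (rule L2_AE_limit[OF X0_gquot_L2[OF u] borel_measurable_gquot[OF L2_measurable[OF v]]
          gquot_AE_limit[OF lim] bd X0_gquot_L2[OF u[of 0]]])
  moreover have "AE x in lebesgue. \<forall>n. x \<notin> \<Omega> \<longrightarrow> u n x = 0"
    unfolding AE_all_countable using X0_AE_zero[OF u] by blast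
  then have "AE x in lebesgue. x \<notin> \<Omega> \<longrightarrow> v x = 0"
    using lim by eventually_elim (auto intro: LIMSEQ_unique)
  ultimately show ?thesis using v by (simp add: X0_iff)
qed

text \<open>The first index within distance \<open>h\<close>, not the closest one: a least index is
  a measurable choice of a nearby centre.\<close>

lemma measurable_nearest_index:
  fixes d :: "nat \<Rightarrow> 'a::euclidean_space"
  shows "(\<lambda>x. (g (LEAST i. dist x (d i) < h) :: real)) \<in> borel_measurable lebesgue"
proof -
  have "(\<lambda>x. LEAST i. dist x (d i) < h) \<in> measurable borel (count_space UNIV)"
    by measurable
  then have "(\<lambda>x. (g (LEAST i. dist x (d i) < h) :: real)) \<in> borel_measurable lborel"
    by simp
  then show ?thesis by (rule measurable_completion)
qed

text \<open>Approximate \<open>u n\<close> by its averages over balls of radius \<open>h\<close> centred at points of a countable dense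
  set. The error is of order \<open>h powr s\<close> in \<open>L2\<close>, uniformly in \<open>n\<close>, and along a diagonal subsequence all
  these countably many averages converge.\<close>

lemma X0_compact:
  fixes \<Omega> :: "'a::euclidean_space set" and u :: "nat \<Rightarrow> 'a \<Rightarrow> real"
  assumes \<Omega>: "\<Omega> \<in> lmeasurable" "bounded \<Omega>" and s: "0 < s"
    and u: "\<And>n. u n \<in> X0 s \<Omega>" and bd: "\<And>n. (LINT p|lebesgue. (gquot s (u n) p)\<^sup>2) \<le> C"
  obtains r v where "strict_mono (r :: nat \<Rightarrow> nat)" "v \<in> X0 s \<Omega>"
    "AE x in lebesgue. (\<lambda>n. u (r n) x) \<longlonglongrightarrow> v x"
    "(\<lambda>n. LINT x|lebesgue. (u (r n) x - v x)\<^sup>2) \<longlonglongrightarrow> 0"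
proof -
  define N where "N = real DIM('a)"
  have N: "0 < N" by (simp add: N_def)
  define \<omega> where "\<omega> = unit_ball_vol N"
  have \<omega>: "0 < \<omega>" by (simp add: \<omega>_def N_def)
  have vol: "measure lebesgue (ball c h) = \<omega> * h powr N" if "0 < h" for c :: 'a and h
    using measure_lebesgue_ball(1)[OF that, of c] by (simp add: \<omega>_def N_def)
  obtain CP where CP: "0 \<le> CP"
    "\<And>u. u \<in> X0 s \<Omega> \<Longrightarrow> (LINT x|lebesgue. (u x)\<^sup>2) \<le> CP * (LINT p|lebesgue. (gquot s u p)\<^sup>2)"
    using X0_poincare[OF \<Omega>(2) s] by blast
  have u2: "(LINT x|lebesgue. (u n x)\<^sup>2) \<le> CP * C" for n
    using CP(2)[OF u[of n]] mult_left_mono[OF bd[of n] CP(1)] by linarith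
  have C: "0 \<le> C" using order.trans[OF integral_nonneg_AE bd[of 0]] by simp
  obtain D :: "'a set" where D: "countable D" "\<And>X. open X \<Longrightarrow> X \<noteq> {} \<Longrightarrow> \<exists>d\<in>D. d \<in> X"
    using countable_dense_setE by blast
  then have "D \<noteq> {}" using open_UNIV by blast
  define d where "d = from_nat_into D"
  define idx where "idx h x = (LEAST i. dist x (d i) < h)" for h x
  have idx: "dist x (d (idx h x)) < h" if "0 < h" for h x
  proof -
    obtain z where "z \<in> D" "z \<in> ball x h" using D(2)[of "ball x h"] \<open>0 < h\<close> by auto
    then obtain i where "d i = z" using from_nat_into_surj[OF D(1)] by (auto simp: d_def)
    then have "dist x (d i) < h" using \<open>z \<in> ball x h\<close> by simp
    then show ?thesis unfolding idx_def by (rule LeastI)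
  qed
  define h where "h k = 1 / real (Suc k)" for k
  have h: "0 < h k" for k by (simp add: h_def)
  define F where "F n ki = ball_avg (h (fst ki)) (u n) (d (snd ki))" for n and ki :: "nat \<times> nat"
  \<comment> \<open>The averaging bound with p = 2 and d = 1; Poincare controls the L2 norm
    uniformly in \<open>n\<close>.\<close>
  define B where "B k = 1 + CP * C / (\<omega> * h k powr N)" for k
  have F: "\<bar>F n ki\<bar> \<le> B (fst ki)" for n ki
  proof -
    have "\<bar>F n ki\<bar> \<le> 1 + (LINT x|lebesgue. (u n x)\<^sup>2) / (\<omega> * h (fst ki) powr N)"
      using abs_ball_avg_le[OF X0_measurable[OF u[of n]] _ _ h[of "fst ki"], of 2 1 "d (snd ki)",
          unfolded vol[OF h]] L2_square_integrable[OF X0_L2[OF u[of n]]] by (simp add: F_def)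
    also have "\<dots> \<le> B (fst ki)"
      unfolding B_def using u2 \<omega> by (intro add_left_mono divide_right_mono) auto
    finally show ?thesis .
  qed
  obtain r l where r: "strict_mono (r :: nat \<Rightarrow> nat)" and l: "\<And>ki. (\<lambda>n. F (r n) ki) \<longlonglongrightarrow> l ki"
    using pointwise_bounded_convergent_subseq[of F "\<lambda>ki. B (fst ki)"] F by metis
  have lB: "\<bar>l ki\<bar> \<le> B (fst ki)" for ki
    by (rule LIMSEQ_le_const2[OF tendsto_rabs[OF l[of ki]]]) (use F in blast)
  define v where "v n = u (r n)" for n
  have v: "v n \<in> X0 s \<Omega>" for n by (simp add: v_def u)
  define A where "A k n x = indicator \<Omega> x * F (r n) (k, idx (h k) x)" for k n x
  define L where "L k x = indicator \<Omega> x * l (k, idx (h k) x)" for k x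
  have [measurable]: "(\<lambda>x. g (idx (h k) x)) \<in> borel_measurable lebesgue" for g :: "nat \<Rightarrow> real" and k
    unfolding idx_def by (rule measurable_nearest_index)
  have [measurable]: "\<Omega> \<in> sets lebesgue" using \<Omega>(1) by auto
  have AL2: "A k n \<in> L2 lebesgue" and LL2: "L k \<in> L2 lebesgue" for k n
  proof -
    have "(\<lambda>x. B k * indicator \<Omega> x) \<in> L2 lebesgue" by (intro L2_cmult indicator_L2 \<Omega>)
    moreover have "A k n \<in> borel_measurable lebesgue" "L k \<in> borel_measurable lebesgue"
      unfolding A_def[abs_def] L_def[abs_def] by measurable
    moreover have "\<bar>A k n x\<bar> \<le> \<bar>B k * indicator \<Omega> x\<bar>" "\<bar>L k x\<bar> \<le> \<bar>B k * indicator \<Omega> x\<bar>" for x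
      using order.trans[OF F[of "r n" "(k, idx (h k) x)"] abs_ge_self]
        order.trans[OF lB[of "(k, idx (h k) x)"] abs_ge_self]
      by (auto simp: A_def L_def indicator_def)
    ultimately show "A k n \<in> L2 lebesgue" "L k \<in> L2 lebesgue"
      by (auto intro: L2_dominated)
  qed
  \<comment> \<open>Both the distance to the centre and the radius are \<open>h k\<close>, and
    (2h)^(N + 2s) / (\<omega> h^N) = c h^(2s).\<close>
  define c where "c = 2 powr (N + 2 * s) / \<omega>"
  have c: "0 \<le> c" using \<omega> by (simp add: c_def)
  have vA: "(LINT x|lebesgue. (v n x - A k n x)\<^sup>2) \<le> c * h k powr (2 * s) * C" for k n
  proof -
    note sl = gagliardo_slice[OF X0_measurable[OF v] X0_gquot_L2[OF v], of n]
    have "(LINT x|lebesgue. (v n x - A k n x)\<^sup>2)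
        \<le> (LINT x|lebesgue. c * h k powr (2 * s) * enn2real (gagliardo_slice s (v n) x))"
    proof (rule integral_mono_AE)
      show "AE x in lebesgue. (v n x - A k n x)\<^sup>2 \<le> c * h k powr (2 * s) * enn2real (gagliardo_slice s (v n) x)"
        using sl(1) X0_AE_zero[OF v[of n]]
      proof eventually_elim
        case (elim x)
        show ?case
        proof (cases "x \<in> \<Omega>")
          case False
          then show ?thesis using elim c by (simp add: A_def)
        next
          case True
          have "(v n x - A k n x)\<^sup>2
            \<le> (h k + h k) powr (N + 2 * s) / (\<omega> * h k powr N) * enn2real (gagliardo_slice s (v n) x)"
            using ball_avg_deviation[OF X0_measurable[OF v] elim(1) less_imp_le[OF idx[OF h]] _ h s, of k k, unfolded vol[OF h]]
              True h[of k] by (simp add: A_def F_def v_def N_def)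
          also have "(h k + h k) powr (N + 2 * s) = 2 powr (N + 2 * s) * (h k powr N * h k powr (2 * s))"
            using h[of k] by (simp add: powr_mult[symmetric] powr_add[symmetric])
          finally show ?thesis using h[of k] \<omega> by (simp add: c_def)
        qed
      qed
    qed (use sl in \<open>auto intro!: L2_square_integrable L2_diff X0_L2[OF v] AL2\<close>)
    also have "\<dots> = c * h k powr (2 * s) * (LINT p|lebesgue. (gquot s (v n) p)\<^sup>2)"
      using sl by simp
    also have "\<dots> \<le> c * h k powr (2 * s) * C"
      using c bd by (intro mult_left_mono) (auto simp: v_def)
    finally show ?thesis .
  qed
  \<comment> \<open>For fixed \<open>k\<close> the approximants are bounded in terms of
    \<open>B k\<close> and live on a set of finite measure, so pointwise convergence of the averages
    is enough.\<close>
  have AL: "(\<lambda>n. LINT x|lebesgue. (A k n x - L k x)\<^sup>2) \<longlonglongrightarrow> 0" for k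
  proof -
    have "(\<lambda>n. LINT x|lebesgue. (A k n x - L k x)\<^sup>2) \<longlonglongrightarrow> (LINT x|(lebesgue :: 'a measure). 0)"
    proof (rule integral_dominated_convergence[where w="\<lambda>x. (2 * B k)\<^sup>2 * indicator \<Omega> x"])
      show "integrable lebesgue (\<lambda>x. (2 * B k)\<^sup>2 * indicator \<Omega> x :: real)"
        by (intro integrable_mult_right integrable_indicator_lmeasurable \<Omega>)
      show "AE x in lebesgue. (\<lambda>n. (A k n x - L k x)\<^sup>2) \<longlonglongrightarrow> 0"
      proof (rule AE_I2)
        fix x
        have "(\<lambda>n. (A k n x - L k x)\<^sup>2) \<longlonglongrightarrow> (L k x - L k x)\<^sup>2"
          unfolding A_def L_def by (intro tendsto_intros l)
        then show "(\<lambda>n. (A k n x - L k x)\<^sup>2) \<longlonglongrightarrow> 0" by simp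
      qed
      show "AE x in lebesgue. norm ((A k n x - L k x)\<^sup>2) \<le> (2 * B k)\<^sup>2 * indicator \<Omega> x" for n
      proof (rule AE_I2)
        fix x
        have "\<bar>F (r n) (k, idx (h k) x) - l (k, idx (h k) x)\<bar> \<le> 2 * B k"
          using F[of "r n" "(k, idx (h k) x)"] lB[of "(k, idx (h k) x)"] by simp
        then have "(F (r n) (k, idx (h k) x) - l (k, idx (h k) x))\<^sup>2 \<le> (2 * B k)\<^sup>2"
          by (rule power2_le_iff_abs_le[THEN iffD2, rotated]) (use lB[of "(k, 0)"] in auto)
        then show "norm ((A k n x - L k x)\<^sup>2) \<le> (2 * B k)\<^sup>2 * indicator \<Omega> x"
          by (simp add: A_def L_def indicator_def)
      qed
    qed (use L2_measurable[OF AL2] L2_measurable[OF LL2] in \<open>auto intro!: borel_measurable_power borel_measurable_diff\<close>)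
    then show ?thesis by simp
  qed
  have Cauchy: "\<exists>n0. \<forall>m\<ge>n0. \<forall>n\<ge>n0. (LINT x|lebesgue. (v m x - v n x)\<^sup>2) \<le> e" if e: "0 < e" for e
  proof -
    \<comment> \<open>Each triangle step doubles the two squared errors: 2 c h^(2s) C < e/8 and an
      error below e/16 from \<open>A\<close> to \<open>L\<close> put \<open>v n\<close> within
      squared distance e/4 of \<open>L k\<close>, and two such distances give at most e.\<close>
    have "h \<longlonglongrightarrow> 0" unfolding h_def[abs_def] by (rule LIMSEQ_Suc[OF lim_1_over_n])
    then have "(\<lambda>k. h k powr (2 * s)) \<longlonglongrightarrow> 0"
      using s h by (intro tendsto_zero_powrI[where b="2 * s"]) (auto intro!: always_eventually less_imp_le)
    then have "(\<lambda>k. 2 * (c * h k powr (2 * s) * C)) \<longlonglongrightarrow> 2 * (c * 0 * C)" by (intro tendsto_intros)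
    from order_tendstoD(2)[OF this, of "e / 8"] e
    have "\<forall>\<^sub>F k in sequentially. 2 * (c * h k powr (2 * s) * C) < e / 8" by simp
    then obtain k where k: "2 * (c * h k powr (2 * s) * C) < e / 8" by (auto simp: eventually_sequentially)
    have "\<forall>\<^sub>F n in sequentially. (LINT x|lebesgue. (A k n x - L k x)\<^sup>2) < e / 16"
      using AL[of k] e by (intro order_tendstoD(2)) auto
    then obtain n0 where n0: "\<And>n. n \<ge> n0 \<Longrightarrow> (LINT x|lebesgue. (A k n x - L k x)\<^sup>2) < e / 16"
      by (auto simp: eventually_sequentially)
    have vL: "(LINT x|lebesgue. (v n x - L k x)\<^sup>2) \<le> e / 4" if "n \<ge> n0" for n
    proof -
      have "(LINT x|lebesgue. ((v n x - A k n x) - (L k x - A k n x))\<^sup>2)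
          \<le> 2 * (LINT x|lebesgue. (v n x - A k n x)\<^sup>2) + 2 * (LINT x|lebesgue. (L k x - A k n x)\<^sup>2)"
        by (intro integral_square_diff_le L2_diff X0_L2[OF v] AL2 LL2)
      then show ?thesis using vA[of n k] n0[OF that] k by (simp add: power2_commute[of "L k _"])
    qed
    have "(LINT x|lebesgue. (v m x - v n x)\<^sup>2) \<le> e" if "m \<ge> n0" "n \<ge> n0" for m n
    proof -
      have "(LINT x|lebesgue. ((v m x - L k x) - (v n x - L k x))\<^sup>2)
          \<le> 2 * (LINT x|lebesgue. (v m x - L k x)\<^sup>2) + 2 * (LINT x|lebesgue. (v n x - L k x)\<^sup>2)"
        by (intro integral_square_diff_le L2_diff X0_L2[OF v] LL2)
      then show ?thesis using vL[OF that(1)] vL[OF that(2)] by simp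
    qed
    then show ?thesis by blast
  qed
  obtain r' w where r': "strict_mono (r' :: nat \<Rightarrow> nat)" and w: "w \<in> L2 lebesgue"
    and lim: "AE x in lebesgue. (\<lambda>k. v (r' k) x) \<longlonglongrightarrow> w x"
    and lim2: "(\<lambda>k. LINT x|lebesgue. (v (r' k) x - w x)\<^sup>2) \<longlonglongrightarrow> 0"
    using L2_Cauchy_subseq[OF X0_L2[OF v] Cauchy] by blast
  have "w \<in> X0 s \<Omega>"
    by (rule X0_limit[OF v w lim]) (use bd in \<open>auto simp: v_def\<close>)
  with that[OF strict_mono_o[OF r r']] lim lim2 show ?thesis by (simp add: v_def)
qed

section \<open>The quadratic form and representation of functionals\<close>

lemma linear_term_zero:
  fixes b c :: real
  assumes "\<And>t. 0 \<le> t * b + t\<^sup>2 * c"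
  shows "b = 0"
proof (rule ccontr)
  assume b: "b \<noteq> 0"
  \<comment> \<open>The choice t = -y makes the expression at most -y^2, which is negative.\<close>
  define y where "y = b / (1 + \<bar>c\<bar>)"
  have b_eq: "b = y * (1 + \<bar>c\<bar>)" by (simp add: y_def)
  have "0 \<le> (- y) * b + (- y)\<^sup>2 * c" by (rule assms)
  also have "\<dots> \<le> (- y) * b + (- y)\<^sup>2 * \<bar>c\<bar>" by (intro add_left_mono mult_left_mono) auto
  also have "\<dots> = - y\<^sup>2" unfolding b_eq by (simp add: power2_eq_square algebra_simps)
  finally show False using b b_eq by simp
qed

locale frac_domain =
  fixes \<Omega> :: "'a::euclidean_space set" and s :: real
  assumes open_domain: "open \<Omega>" and bounded_domain: "bounded \<Omega>"
    and s_pos: "0 < s" and s_less: "s < 1" and DIM_ge: "2 \<le> DIM('a)"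
begin

lemma lmeasurable_domain: "\<Omega> \<in> lmeasurable"
  using open_domain bounded_domain by (rule lmeasurable_open[rotated])

lemma lmeasurable_domain_Times: "\<Omega> \<times> \<Omega> \<in> lmeasurable"
  by (intro lmeasurable_open bounded_Times open_Times open_domain bounded_domain)

lemma frac_const_pos: "0 < frac_const DIM('a) s"
proof -
  have "Gamma (real DIM('a) / 2 + s) > 0" "Gamma (1 - s) > 0"
    using s_pos s_less by (auto intro!: Gamma_real_pos add_nonneg_pos)
  then show ?thesis using s_pos by (simp add: frac_const_def)
qed

lemma frac_form_gquot:
  "frac_form s u v = frac_const DIM('a) s / 2 * (LINT p|lebesgue. gquot s (u :: 'a \<Rightarrow> real) p * gquot s v p)"
  by (simp add: frac_form_def gagliardo_integrand_gquot)

lemma frac_form_commute: "frac_form s u v = frac_form s v (u :: 'a \<Rightarrow> real)"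
  by (simp add: frac_form_gquot mult.commute)

lemma frac_form_add_left:
  assumes "u \<in> X0 s \<Omega>" "v \<in> X0 s \<Omega>" "w \<in> X0 s \<Omega>"
  shows "frac_form s (\<lambda>x. u x + v x) w = frac_form s u w + frac_form s v w"
  using assms by (simp add: frac_form_gquot gquot_add distrib_right distrib_left L2_mult_integrable X0_gquot_L2)

lemma frac_form_cmult_left: "frac_form s (\<lambda>x. c * u x) v = c * frac_form s (u :: 'a \<Rightarrow> real) v"
  by (simp add: frac_form_gquot gquot_cmult mult.assoc)

lemma frac_form_nonneg: "0 \<le> frac_form s u (u :: 'a \<Rightarrow> real)"
  using frac_const_pos by (simp add: frac_form_gquot)

lemma X0_norm_square: "(X0_norm s u)\<^sup>2 = frac_form s u (u :: 'a \<Rightarrow> real)"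
  by (simp add: X0_norm_def frac_form_nonneg)

lemma X0_norm_nonneg: "0 \<le> X0_norm s (u :: 'a \<Rightarrow> real)"
  by (simp add: X0_norm_def frac_form_nonneg)

lemma gquot_square_integral:
  "(LINT p|lebesgue. (gquot s u p)\<^sup>2) = 2 / frac_const DIM('a) s * frac_form s u (u :: 'a \<Rightarrow> real)"
  using frac_const_pos by (simp add: frac_form_gquot power2_eq_square)

lemma X0_bounded_subseq:
  fixes u :: "nat \<Rightarrow> 'a \<Rightarrow> real"
  assumes u: "\<And>n. u n \<in> X0 s \<Omega>" and bd: "\<And>n. frac_form s (u n) (u n) \<le> C"
  obtains r v where "strict_mono (r :: nat \<Rightarrow> nat)" "v \<in> X0 s \<Omega>"
    "AE x in lebesgue. (\<lambda>n. u (r n) x) \<longlonglongrightarrow> v x"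
    "(\<lambda>n. LINT x|lebesgue. (u (r n) x - v x)\<^sup>2) \<longlonglongrightarrow> 0"
proof -
  have "(LINT p|lebesgue. (gquot s (u n) p)\<^sup>2) \<le> 2 / frac_const DIM('a) s * C" for n
    unfolding gquot_square_integral using bd[of n] frac_const_pos by (intro mult_left_mono) auto
  then show ?thesis
    by (rule X0_compact[of \<Omega> s u, OF lmeasurable_domain bounded_domain s_pos u]) (rule that)
qed

text \<open>Weak convergence in \<open>X0\<close>: the quotients converge almost everywhere on the
  doubled space and are bounded in L2, so they may be paired with the fixed quotient of
  \<open>w\<close>.\<close>

lemma frac_form_weak_limit:
  fixes u :: "nat \<Rightarrow> 'a \<Rightarrow> real"
  assumes u: "\<And>n. u n \<in> X0 s \<Omega>" and bd: "\<And>n. frac_form s (u n) (u n) \<le> C"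
    and v: "v \<in> X0 s \<Omega>" and lim: "AE x in lebesgue. (\<lambda>n. u n x) \<longlonglongrightarrow> v x" and w: "w \<in> X0 s \<Omega>"
  shows "(\<lambda>n. frac_form s w (u n)) \<longlonglongrightarrow> frac_form s w v"
  unfolding frac_form_gquot
proof (intro tendsto_intros)
  have "(LINT p|lebesgue. (gquot s (u n) p)\<^sup>2) \<le> 2 / frac_const DIM('a) s * C" for n
    unfolding gquot_square_integral using bd[of n] frac_const_pos by (intro mult_left_mono) auto
  then show "(\<lambda>n. LINT p|lebesgue. gquot s w p * gquot s (u n) p)
      \<longlonglongrightarrow> (LINT p|lebesgue. gquot s w p * gquot s v p)"
    by (rule L2_bounded_AE_weak_limit[OF X0_gquot_L2[OF u] L2_measurable[OF X0_gquot_L2[OF v]]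
          gquot_AE_limit[OF lim] _ X0_gquot_L2[OF w]])
qed

lemma X0_zero: "(\<lambda>x. 0) \<in> X0 s \<Omega>"
proof -
  have "gquot s (\<lambda>x::'a. 0) = (\<lambda>p. 0)" by (simp add: gquot_def fun_eq_iff)
  then show ?thesis by (simp add: X0_iff L2_def)
qed

lemma X0_minimizing_sequence:
  assumes "\<And>v. v \<in> X0 s \<Omega> \<Longrightarrow> L \<le> g v"
  obtains I :: real and u where "\<And>n. u n \<in> X0 s \<Omega>" "\<And>n::nat. g (u n) < I + 1 / real (Suc n)"
    "\<And>v. v \<in> X0 s \<Omega> \<Longrightarrow> I \<le> g v"
proof -
  define I where "I = Inf (g ` X0 s \<Omega>)"
  have bb: "bdd_below (g ` X0 s \<Omega>)" using assms by (intro bdd_belowI2)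
  have "\<exists>v\<in>X0 s \<Omega>. g v < I + 1 / real (Suc n)" for n
  proof -
    have "Inf (g ` X0 s \<Omega>) < I + 1 / real (Suc n)" by (simp add: I_def)
    then show ?thesis using X0_zero by (subst (asm) cInf_less_iff[OF _ bb]) auto
  qed
  then obtain u where u: "\<And>n. u n \<in> X0 s \<Omega>" "\<And>n. g (u n) < I + 1 / real (Suc n)" by metis
  have "I \<le> g v" if "v \<in> X0 s \<Omega>" for v
    unfolding I_def using that bb by (intro cInf_lower) auto
  then show ?thesis by (rule that[OF u])
qed

lemma X0_dual_add: "f \<in> X0_dual s \<Omega> \<Longrightarrow> u \<in> X0 s \<Omega> \<Longrightarrow> v \<in> X0 s \<Omega> \<Longrightarrow> f (\<lambda>x. u x + v x) = f u + f v"
  and X0_dual_cmult: "f \<in> X0_dual s \<Omega> \<Longrightarrow> u \<in> X0 s \<Omega> \<Longrightarrow> f (\<lambda>x. c * u x) = c * f u"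
  by (auto simp: X0_dual_def)

lemma X0_dual_bound:
  assumes "f \<in> X0_dual s \<Omega>"
  obtains C where "0 \<le> C" "\<And>u. u \<in> X0 s \<Omega> \<Longrightarrow> \<bar>f u\<bar> \<le> C * X0_norm s u"
proof -
  from assms obtain C where C: "\<And>u. u \<in> X0 s \<Omega> \<Longrightarrow> \<bar>f u\<bar> \<le> C * X0_norm s u"
    unfolding X0_dual_def by blast
  have "\<bar>f u\<bar> \<le> \<bar>C\<bar> * X0_norm s u" if "u \<in> X0 s \<Omega>" for u
    using C[OF that] mult_right_mono[OF abs_ge_self[of C] X0_norm_nonneg[of u]] by linarith
  then show ?thesis using that[of "\<bar>C\<bar>"] by simp
qed

lemma frac_form_add_cmult:
  assumes "u \<in> X0 s \<Omega>" "v \<in> X0 s \<Omega>"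
  shows "frac_form s (\<lambda>x. u x + t * v x) (\<lambda>x. u x + t * v x)
    = frac_form s u u + 2 * t * frac_form s u v + t\<^sup>2 * frac_form s v v"
proof -
  define w where "w = (\<lambda>x. u x + t * v x)"
  have w: "w \<in> X0 s \<Omega>" unfolding w_def by (intro X0_add X0_cmult assms)
  have *: "frac_form s w z = frac_form s u z + t * frac_form s v z" if "z \<in> X0 s \<Omega>" for z
    unfolding w_def frac_form_add_left[OF assms(1) X0_cmult[OF assms(2)] that] frac_form_cmult_left ..
  have "frac_form s w w = frac_form s w u + t * frac_form s w v"
    using *[OF w] by (simp add: frac_form_commute[of u w] frac_form_commute[of v w])
  then show ?thesis
    unfolding w_def[symmetric] *[OF assms(1)] *[OF assms(2)] frac_form_commute[of v u]
    by (simp add: power2_eq_square algebra_simps)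
qed

text \<open>A minimizing sequence of \<open>v \<mapsto> \<parallel>v\<parallel>\<^sup>2 / 2 - f v\<close> is bounded, and any weak limit represents \<open>f\<close>: passing
  to the limit in the variational inequality only uses terms linear in the sequence.\<close>

lemma X0_riesz:
  assumes f: "f \<in> X0_dual s \<Omega>"
  obtains w where "w \<in> X0 s \<Omega>" "\<And>\<phi>. \<phi> \<in> X0 s \<Omega> \<Longrightarrow> f \<phi> = frac_form s w \<phi>"
proof -
  obtain C where C: "0 \<le> C" "\<And>u. u \<in> X0 s \<Omega> \<Longrightarrow> \<bar>f u\<bar> \<le> C * X0_norm s u"
    using X0_dual_bound[OF f] by blast
  define g where "g v = frac_form s v v / 2 - f v" for v
  \<comment> \<open>Half of the quadratic term absorbs the linear one: (norm/2 - C)^2 \<ge> 0 gives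
    C norm \<le> norm^2/4 + C^2.\<close>
  have coer: "frac_form s v v / 4 - C\<^sup>2 \<le> g v" if "v \<in> X0 s \<Omega>" for v
  proof -
    have "0 \<le> (X0_norm s v / 2 - C)\<^sup>2" by simp
    then have "C * X0_norm s v \<le> frac_form s v v / 4 + C\<^sup>2"
      by (simp add: power2_diff power_divide X0_norm_square algebra_simps)
    then show ?thesis using C(2)[OF that] by (simp add: g_def abs_le_iff)
  qed
  then have lower: "- C\<^sup>2 \<le> g v" if "v \<in> X0 s \<Omega>" for v
    using coer[OF that] frac_form_nonneg[of v] by simp
  obtain I :: real and u where u: "\<And>n. u n \<in> X0 s \<Omega>" "\<And>n. g (u n) < I + 1 / real (Suc n)"
    and I: "\<And>v. v \<in> X0 s \<Omega> \<Longrightarrow> I \<le> g v"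
    by (rule X0_minimizing_sequence[of "- C\<^sup>2" g, OF lower]) (simp, rule that)
  have bd: "frac_form s (u n) (u n) \<le> 4 * (I + 1 + C\<^sup>2)" for n
  proof -
    have "1 / real (Suc n) \<le> 1" by simp
    from less_le_trans[OF u(2)[of n] add_left_mono[OF this]] have "g (u n) \<le> I + 1" by simp
    with coer[OF u(1)[of n]] show ?thesis by (simp add: field_simps)
  qed
  obtain r w where r: "strict_mono (r :: nat \<Rightarrow> nat)" and w: "w \<in> X0 s \<Omega>"
    and lim: "AE x in lebesgue. (\<lambda>n. u (r n) x) \<longlonglongrightarrow> w x"
    by (rule X0_bounded_subseq[of u, OF u(1) bd]) (rule that)
  have "f \<phi> = frac_form s w \<phi>" if \<phi>: "\<phi> \<in> X0 s \<Omega>" for \<phi>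
  proof -
    \<comment> \<open>Comparing \<open>u m\<close> with its shift by t \<phi>, the energy of
      \<open>u m\<close> stays inside \<open>g (u m)\<close> and is removed at the cost of 1/(m +
      1); what remains passes to the limit.\<close>
    have "0 \<le> t * (frac_form s \<phi> w - f \<phi>) + t\<^sup>2 * (frac_form s \<phi> \<phi> / 2)" for t
    proof (rule LIMSEQ_le_const)
      have "(\<lambda>n. 1 / real (Suc (r n))) \<longlonglongrightarrow> 0"
        using LIMSEQ_subseq_LIMSEQ[OF LIMSEQ_Suc[OF lim_1_over_n] r] by (simp add: o_def)
      then have "(\<lambda>n. t * (frac_form s \<phi> (u (r n)) - f \<phi>) + t\<^sup>2 * (frac_form s \<phi> \<phi> / 2) + 1 / real (Suc (r n)))
          \<longlonglongrightarrow> t * (frac_form s \<phi> w - f \<phi>) + t\<^sup>2 * (frac_form s \<phi> \<phi> / 2) + 0"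
        using frac_form_weak_limit[of "\<lambda>n. u (r n)", OF u(1) bd w lim \<phi>] by (intro tendsto_intros)
      then show "(\<lambda>n. t * (frac_form s \<phi> (u (r n)) - f \<phi>) + t\<^sup>2 * (frac_form s \<phi> \<phi> / 2) + 1 / real (Suc (r n)))
          \<longlonglongrightarrow> t * (frac_form s \<phi> w - f \<phi>) + t\<^sup>2 * (frac_form s \<phi> \<phi> / 2)"
        by simp
      have "0 \<le> t * (frac_form s \<phi> (u m) - f \<phi>) + t\<^sup>2 * (frac_form s \<phi> \<phi> / 2) + 1 / real (Suc m)" for m
      proof -
        have "I \<le> g (\<lambda>x. u m x + t * \<phi> x)" by (intro I X0_add X0_cmult u \<phi>)
        also have "\<dots> = g (u m) + t * (frac_form s \<phi> (u m) - f \<phi>) + t\<^sup>2 * (frac_form s \<phi> \<phi> / 2)"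
          by (simp add: g_def frac_form_add_cmult u \<phi> X0_dual_add[OF f] X0_dual_cmult[OF f] X0_cmult
              frac_form_commute[of \<phi> "u m"] field_simps)
        finally show ?thesis using u(2)[of m] by linarith
      qed
      then show "\<exists>N. \<forall>n\<ge>N. 0 \<le> t * (frac_form s \<phi> (u (r n)) - f \<phi>) + t\<^sup>2 * (frac_form s \<phi> \<phi> / 2) + 1 / real (Suc (r n))"
        by blast
    qed
    from linear_term_zero[OF this] show ?thesis by (simp add: frac_form_commute[of w \<phi>])
  qed
  then show ?thesis by (rule that[OF w])
qed

text \<open>Boundedness of \<open>f\<close> alone controls only sequences converging in norm; its
  representing element turns \<open>f (u n)\<close> into a pairing with a fixed function.\<close>

lemma X0_dual_weak_limit:
  fixes u :: "nat \<Rightarrow> 'a \<Rightarrow> real"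
  assumes f: "f \<in> X0_dual s \<Omega>"
    and u: "\<And>n. u n \<in> X0 s \<Omega>" and bd: "\<And>n. frac_form s (u n) (u n) \<le> C"
    and v: "v \<in> X0 s \<Omega>" and lim: "AE x in lebesgue. (\<lambda>n. u n x) \<longlonglongrightarrow> v x"
  shows "(\<lambda>n. f (u n)) \<longlonglongrightarrow> f v"
proof -
  obtain w where w: "w \<in> X0 s \<Omega>" "\<And>\<phi>. \<phi> \<in> X0 s \<Omega> \<Longrightarrow> f \<phi> = frac_form s w \<phi>"
    by (rule X0_riesz[OF f]) (rule that)
  show ?thesis using frac_form_weak_limit[OF u bd v lim w(1)] by (simp add: w(2) u v)
qed

end

section \<open>Forms with bounded kernels\<close>

lemma DERIV_abs_powr:
  fixes q z :: real
  assumes q: "1 < q"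
  shows "((\<lambda>z. \<bar>z\<bar> powr q) has_real_derivative q * (\<bar>z\<bar> powr (q - 2) * z)) (at z)"
proof -
  consider "0 < z" | "z < 0" | "z = 0" by linarith
  then show ?thesis
  proof cases
    case 1
    have "((\<lambda>z. z powr q) has_real_derivative q * z powr (q - 1)) (at z)"
      by (rule has_real_derivative_powr[OF 1])
    moreover have "z powr (q - 1) = \<bar>z\<bar> powr (q - 2) * z"
      using 1 powr_add[of z "q - 2" 1] by simp
    ultimately have "((\<lambda>z. z powr q) has_real_derivative q * (\<bar>z\<bar> powr (q - 2) * z)) (at z)" by simp
    then show ?thesis
      by (rule has_field_derivative_transform_within_open[where S="{0<..}"]) (use 1 in auto)
  next
    case 2
    have "((\<lambda>z. (- z) powr q) has_real_derivative q * (- z) powr (q - 1) * - 1) (at z)"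
      using 2 by (auto intro!: derivative_eq_intros simp: powr_diff)
    moreover have eq: "(- z) powr (q - 1) * - 1 = \<bar>z\<bar> powr (q - 2) * z"
      using 2 powr_add[of "- z" "q - 2" 1] by simp
    ultimately have "((\<lambda>z. (- z) powr q) has_real_derivative q * (\<bar>z\<bar> powr (q - 2) * z)) (at z)"
      unfolding mult.assoc eq by simp
    then show ?thesis
      by (rule has_field_derivative_transform_within_open[where S="{..<0}"]) (use 2 in auto)
  next
    case 3
    \<comment> \<open>At zero the difference quotient has absolute value |h|^(q-1), which vanishes
      in the limit since q > 1; this includes q < 2, where the power in the formula has a negative
      exponent.\<close>
    have "((\<lambda>h. \<bar>h\<bar> powr (q - 1)) \<longlongrightarrow> \<bar>0::real\<bar> powr (q - 1)) (at 0)"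
      using q by (intro tendsto_intros) (auto intro: always_eventually)
    then have "((\<lambda>h. \<bar>h\<bar> powr (q - 1)) \<longlongrightarrow> 0) (at (0::real))" using q by simp
    then have "((\<lambda>h. \<bar>h\<bar> powr q / h) \<longlongrightarrow> 0) (at (0::real))"
    proof (rule Lim_null_comparison[rotated], intro always_eventually allI)
      fix h :: real
      show "norm (\<bar>h\<bar> powr q / h) \<le> \<bar>h\<bar> powr (q - 1)"
        by (cases "h = 0") (simp_all add: abs_divide powr_diff)
    qed
    then show ?thesis using 3 q by (simp add: has_field_derivative_iff)
  qed
qed

lemma abs_powr_mult: "\<bar>\<bar>z\<bar> powr (q - 2) * z\<bar> = \<bar>z :: real\<bar> powr (q - 1)"
  using powr_add[of "\<bar>z\<bar>" "q - 2" 1] by (cases "z = 0") (simp_all add: abs_mult)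

text \<open>Mean value theorem on [-M, M] with M = |a| + |b|, which contains both points as t \<le>
  1. Dividing by \<open>t\<close> yields a majorant of difference quotients that is independent of
  \<open>t\<close>.\<close>

lemma abs_powr_diff_le:
  fixes a b t q :: real
  assumes q: "1 < q" and t: "0 \<le> t" "t \<le> 1"
  shows "\<bar>\<bar>a + t * b\<bar> powr q - \<bar>a\<bar> powr q\<bar> \<le> t * (q * (\<bar>a\<bar> + \<bar>b\<bar>) powr q)"
proof -
  define M where "M = \<bar>a\<bar> + \<bar>b\<bar>"
  have tb: "\<bar>t * b\<bar> \<le> \<bar>b\<bar>" using t by (simp add: abs_mult mult_left_le_one_le)
  have "norm (\<bar>a + t * b\<bar> powr q - \<bar>a\<bar> powr q) \<le> q * M powr (q - 1) * norm (a + t * b - a)"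
  proof (rule field_differentiable_bound[where S="{- M..M}"])
    show "((\<lambda>z. \<bar>z\<bar> powr q) has_field_derivative q * (\<bar>z\<bar> powr (q - 2) * z)) (at z within {- M..M})" for z
      by (rule has_field_derivative_at_within[OF DERIV_abs_powr[OF q]])
    show "norm (q * (\<bar>z\<bar> powr (q - 2) * z)) \<le> q * M powr (q - 1)" if "z \<in> {- M..M}" for z
    proof -
      have "\<bar>z\<bar> powr (q - 1) \<le> M powr (q - 1)" using that q by (intro powr_mono2) auto
      then show ?thesis using q by (simp add: abs_mult[of q] abs_powr_mult)
    qed
    show "a + t * b \<in> {- M..M}" "a \<in> {- M..M}" using tb by (auto simp: M_def abs_le_iff)
  qed auto
  also have "\<dots> = t * (q * (M powr (q - 1) * \<bar>b\<bar>))" using t by (simp add: abs_mult)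
  also have "\<dots> \<le> t * (q * M powr q)"
  proof (intro mult_left_mono)
    have "M powr (q - 1) * \<bar>b\<bar> \<le> M powr (q - 1) * M powr 1"
      by (intro mult_left_mono) (auto simp: M_def)
    also have "\<dots> = M powr q" unfolding powr_add[symmetric] by simp
    finally show "M powr (q - 1) * \<bar>b\<bar> \<le> M powr q" .
  qed (use t q in auto)
  finally show ?thesis by (simp add: M_def)
qed

lemma powr_add_le:
  fixes a b q :: real
  assumes "0 \<le> a" "0 \<le> b" "0 \<le> q"
  shows "(a + b) powr q \<le> 2 powr q * (a powr q + b powr q)"
proof -
  have "(a + b) powr q \<le> (2 * max a b) powr q" using assms by (intro powr_mono2) auto
  also have "\<dots> = 2 powr q * max a b powr q" using assms by (simp add: powr_mult)
  also have "\<dots> \<le> 2 powr q * (a powr q + b powr q)"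
    by (intro mult_left_mono) (auto simp: max_def)
  finally show ?thesis .
qed

text \<open>Moves integrals over \<Omega> or its square to the whole space, where Fubini and the
  exchange of variables are available.\<close>

definition zero_ext :: "'b set \<Rightarrow> ('b \<Rightarrow> real) \<Rightarrow> 'b \<Rightarrow> real" where
  "zero_ext S Z p = indicator S p * Z p"

lemma integral_lebesgue_on:
  fixes g :: "'a::euclidean_space \<Rightarrow> real"
  assumes "S \<in> sets lebesgue"
  shows "(LINT x|lebesgue_on S. g x) = (LINT x|lebesgue. indicator S x * g x)"
  using assms by (subst integral_restrict_space) auto

lemma L_infinity_zero_ext:
  fixes Z :: "'a::euclidean_space \<Rightarrow> real"
  assumes S: "S \<in> sets lebesgue" and Z: "Z \<in> L_infinity (lebesgue_on S)"
  shows "zero_ext S Z \<in> borel_measurable lebesgue"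
    and "\<exists>C\<ge>0. AE p in lebesgue. \<bar>zero_ext S Z p\<bar> \<le> C"
proof -
  have "Z \<in> borel_measurable (lebesgue_on S)" using Z by (simp add: L_infinity_def)
  then show "zero_ext S Z \<in> borel_measurable lebesgue"
    using borel_measurable_restrict_space_iff[of S lebesgue Z] S by (simp add: zero_ext_def[abs_def])
  obtain C where "AE p in lebesgue_on S. \<bar>Z p\<bar> \<le> C" using Z by (auto simp: L_infinity_def)
  then have "AE p in lebesgue. p \<in> S \<longrightarrow> \<bar>Z p\<bar> \<le> C" using S by (simp add: AE_restrict_space_iff)
  then have "AE p in lebesgue. \<bar>zero_ext S Z p\<bar> \<le> \<bar>C\<bar>"
    by eventually_elim (auto simp: zero_ext_def indicator_def)
  then show "\<exists>C\<ge>0. AE p in lebesgue. \<bar>zero_ext S Z p\<bar> \<le> C" by (intro exI[of _ "\<bar>C\<bar>"]) auto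
qed

lemma integrable_zero_ext_mult:
  fixes Z :: "'a::euclidean_space \<Rightarrow> real"
  assumes S: "S \<in> sets lebesgue" and Z: "Z \<in> L_infinity (lebesgue_on S)" and g: "integrable lebesgue g"
  shows "integrable lebesgue (\<lambda>p. zero_ext S Z p * g p)"
proof -
  note [measurable] = L_infinity_zero_ext(1)[OF S Z] borel_measurable_integrable[OF g]
  obtain C where C: "0 \<le> C" "AE p in lebesgue. \<bar>zero_ext S Z p\<bar> \<le> C"
    using L_infinity_zero_ext(2)[OF S Z] by blast
  show ?thesis
  proof (rule Bochner_Integration.integrable_bound[OF integrable_mult_right[OF g, of C]])
    show "AE p in lebesgue. norm (zero_ext S Z p * g p) \<le> norm (C * g p)"
      using C(2) by eventually_elim (use C(1) in \<open>auto simp: abs_mult intro!: mult_right_mono\<close>)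
  qed auto
qed

text \<open>Fubini turns the pairing with an integral operator into one integral over the doubled
  space. The two uses are \<open>T_op\<close> with h = u and \<open>B_op\<close> with h =
  |u|^q.\<close>

lemma iterated_kernel_integral:
  fixes Z :: "'a::euclidean_space \<times> 'a \<Rightarrow> real"
  assumes \<Omega>: "\<Omega> \<in> sets lebesgue" "\<Omega> \<times> \<Omega> \<in> sets lebesgue"
    and Z: "Z \<in> L_infinity (lebesgue_on (\<Omega> \<times> \<Omega>))"
    and g: "integrable lebesgue g" and h: "integrable lebesgue h"
  shows "(LINT x|lebesgue_on \<Omega>. (LINT y|lebesgue_on \<Omega>. Z (x, y) * h y) * g x)
    = (LINT p|lebesgue. zero_ext (\<Omega> \<times> \<Omega>) Z p * (g (fst p) * h (snd p)))"
proof -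
  have i: "integrable lebesgue (\<lambda>p. zero_ext (\<Omega> \<times> \<Omega>) Z p * (g (fst p) * h (snd p)))"
    by (intro integrable_zero_ext_mult \<Omega> Z integrable_lebesgue_tensor g h)
  have "(LINT x|lebesgue_on \<Omega>. (LINT y|lebesgue_on \<Omega>. Z (x, y) * h y) * g x)
    = (LINT x|lebesgue. indicator \<Omega> x * g x * (LINT y|lebesgue. indicator \<Omega> y * (Z (x, y) * h y)))"
    by (simp add: integral_lebesgue_on \<Omega> ac_simps)
  also have "\<dots> = (LINT x|lebesgue. LINT y|lebesgue. zero_ext (\<Omega> \<times> \<Omega>) Z (x, y) * (g x * h y))"
    unfolding integral_mult_right_zero[symmetric]
    by (intro Bochner_Integration.integral_cong refl) (auto simp: zero_ext_def indicator_def)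
  also have "\<dots> = (LINT p|lebesgue. zero_ext (\<Omega> \<times> \<Omega>) Z p * (g (fst p) * h (snd p)))"
    using integral_lebesgue_fst[OF i] by simp
  finally show ?thesis .
qed

text \<open>Exchange of variables and symmetry of the kernel. This is the source of the symmetry of
  \<open>A_form\<close>, and it merges the two halves of the derivative of the nonlocal
  term.\<close>

lemma kernel_integral_swap:
  fixes Z :: "'a::euclidean_space \<times> 'a \<Rightarrow> real"
  assumes sym: "AE p in lebesgue. Z (snd p, fst p) = Z p"
    and i: "integrable lebesgue (\<lambda>p. Z p * (g (fst p) * h (snd p)))" and Z: "Z \<in> borel_measurable lebesgue"
    and m: "g \<in> borel_measurable lebesgue" "h \<in> borel_measurable lebesgue"
  shows "(LINT p|lebesgue. Z p * (g (fst p) * h (snd p))) = (LINT p|lebesgue. Z p * (h (fst p) * g (snd p)))"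
proof -
  note [measurable] = Z m
  have "(LINT p|lebesgue. Z p * (g (fst p) * h (snd p)))
      = (LINT p|lebesgue. Z (snd p, fst p) * (g (snd p) * h (fst p)))"
    using integral_lebesgue_swap(2)[OF i] by simp
  also have "\<dots> = (LINT p|lebesgue. Z p * (h (fst p) * g (snd p)))"
  proof (rule integral_cong_AE)
    show "AE p in lebesgue. Z (snd p, fst p) * (g (snd p) * h (fst p)) = Z p * (h (fst p) * g (snd p))"
      using sym by eventually_elim simp
    have "(\<lambda>p. Z (snd p, fst p)) \<in> borel_measurable lebesgue"
      using measurable_compose[OF measurable_swap_lebesgue Z] by (simp add: case_prod_beta)
    then show "(\<lambda>p. Z (snd p, fst p) * (g (snd p) * h (fst p))) \<in> borel_measurable lebesgue" by measurable
  qed measurable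
  finally show ?thesis .
qed

context frac_domain
begin

lemma sets_domain: "\<Omega> \<in> sets lebesgue" "\<Omega> \<times> \<Omega> \<in> sets lebesgue"
  using lmeasurable_domain lmeasurable_domain_Times by auto

lemma zero_ext_sym:
  assumes "AE (x, y) in lebesgue_on (\<Omega> \<times> \<Omega>). Z (x, y) = (Z (y, x) :: real)"
  shows "AE p in lebesgue. zero_ext (\<Omega> \<times> \<Omega>) Z (snd p, fst p) = zero_ext (\<Omega> \<times> \<Omega>) Z p"
proof -
  have "AE p in lebesgue. p \<in> \<Omega> \<times> \<Omega> \<longrightarrow> Z p = Z (snd p, fst p)"
    using assms sets_domain by (simp add: AE_restrict_space_iff case_prod_beta)
  then show ?thesis by eventually_elim (auto simp: zero_ext_def indicator_def)
qed

lemma zero_ext_nonneg: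
  assumes "AE (x, y) in lebesgue_on (\<Omega> \<times> \<Omega>). 0 \<le> (Z (x, y) :: real)"
  shows "AE p in lebesgue. 0 \<le> zero_ext (\<Omega> \<times> \<Omega>) Z p"
proof -
  have "AE p in lebesgue. p \<in> \<Omega> \<times> \<Omega> \<longrightarrow> 0 \<le> Z p"
    using assms sets_domain by (simp add: AE_restrict_space_iff case_prod_beta)
  then show ?thesis by eventually_elim (auto simp: zero_ext_def indicator_def)
qed

lemma X0_integrable:
  assumes "u \<in> X0 s \<Omega>" shows "integrable lebesgue u"
proof -
  have "integrable lebesgue (\<lambda>x. indicator \<Omega> x * u x)"
    by (intro L2_mult_integrable indicator_L2 lmeasurable_domain X0_L2[OF assms])
  then show ?thesis
    by (rule Bochner_Integration.integrable_cong_AE_imp)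
       (use X0_AE_zero[OF assms] X0_measurable[OF assms] in \<open>auto elim!: AE_mp simp: indicator_def\<close>)
qed

lemma domain_powr_integrable:
  assumes "u \<in> X0 s \<Omega>" "0 < q" "q < 2 * real DIM('a) / (real DIM('a) - 2 * s)"
  shows "integrable lebesgue (\<lambda>x. \<bar>u x\<bar> powr q)"
  using X0_powr_integrable[OF assms(1) lmeasurable_domain s_pos _ assms(2,3)] s_less DIM_ge by simp

end

section \<open>The bilinear form of the problem\<close>

locale nonlocal_problem = frac_domain \<Omega> s
  for \<Omega> :: "'a::euclidean_space set" and s :: real +
  fixes q lam :: real and a :: "'a \<Rightarrow> real" and K Q :: "'a \<times> 'a \<Rightarrow> real"
    and f :: "('a \<Rightarrow> real) \<Rightarrow> real" and \<alpha> :: real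
  assumes q_gt: "1 < q" and q_less: "q < 2 * real DIM('a) / (real DIM('a) - 2 * s)"
    and a_L_infinity: "a \<in> L_infinity (lebesgue_on \<Omega>)"
    and K_L_infinity: "K \<in> L_infinity (lebesgue_on (\<Omega> \<times> \<Omega>))"
    and Q_L_infinity: "Q \<in> L_infinity (lebesgue_on (\<Omega> \<times> \<Omega>))"
    and K_sym: "AE (x, y) in lebesgue_on (\<Omega> \<times> \<Omega>). K (x, y) = K (y, x)"
    and Q_sym: "AE (x, y) in lebesgue_on (\<Omega> \<times> \<Omega>). Q (x, y) = Q (y, x)"
    and Q_nonneg: "AE (x, y) in lebesgue_on (\<Omega> \<times> \<Omega>). 0 \<le> Q (x, y)"
    and lam_neg: "lam < 0"
    and f_dual: "f \<in> X0_dual s \<Omega>"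
    and \<alpha>_pos: "0 < \<alpha>"
    and coercive: "\<And>u. u \<in> X0 s \<Omega> \<Longrightarrow> \<alpha> * (X0_norm s u)\<^sup>2 \<le> A_form s \<Omega> K a u u"
begin

abbreviation "a0 \<equiv> zero_ext \<Omega> a"
abbreviation "K0 \<equiv> zero_ext (\<Omega> \<times> \<Omega>) K"
abbreviation "Q0 \<equiv> zero_ext (\<Omega> \<times> \<Omega>) Q"

text \<open>What \<open>A_form\<close> subtracts from the energy, isolated because it converges
  along the sequences considered, while for the energy only a lower bound passes to the limit. The
  first argument sits in the inner variable, as in \<open>T_op\<close>.\<close>

definition lower_form :: "('a \<Rightarrow> real) \<Rightarrow> ('a \<Rightarrow> real) \<Rightarrow> real" where
  "lower_form u v = (LINT p|lebesgue. K0 p * (v (fst p) * u (snd p))) + (LINT x|lebesgue. a0 x * (u x * v x))"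

lemma lower_form_integrable:
  assumes "u \<in> X0 s \<Omega>" "v \<in> X0 s \<Omega>"
  shows "integrable lebesgue (\<lambda>p. K0 p * (v (fst p) * u (snd p)))"
    and "integrable lebesgue (\<lambda>x. a0 x * (u x * v x))"
proof -
  show "integrable lebesgue (\<lambda>p. K0 p * (v (fst p) * u (snd p)))"
    by (rule integrable_zero_ext_mult[OF sets_domain(2) K_L_infinity
          integrable_lebesgue_tensor(1)[OF X0_integrable[OF assms(2)] X0_integrable[OF assms(1)]]])
  show "integrable lebesgue (\<lambda>x. a0 x * (u x * v x))"
    by (rule integrable_zero_ext_mult[OF sets_domain(1) a_L_infinity
          L2_mult_integrable[OF X0_L2[OF assms(1)] X0_L2[OF assms(2)]]])
qed

lemma A_form_eq:
  assumes "u \<in> X0 s \<Omega>" "v \<in> X0 s \<Omega>"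
  shows "A_form s \<Omega> K a u v = frac_form s u v - lower_form u v"
proof -
  have "(LINT x|lebesgue_on \<Omega>. T_op \<Omega> K u x * v x) = (LINT p|lebesgue. K0 p * (v (fst p) * u (snd p)))"
    unfolding T_op_def
    by (rule iterated_kernel_integral[OF sets_domain K_L_infinity X0_integrable[OF assms(2)] X0_integrable[OF assms(1)]])
  moreover have "(LINT x|lebesgue_on \<Omega>. a x * u x * v x) = (LINT x|lebesgue. a0 x * (u x * v x))"
    by (simp add: integral_lebesgue_on sets_domain zero_ext_def mult.assoc)
  ultimately show ?thesis by (simp add: A_form_def lower_form_def)
qed

lemma lower_form_commute:
  assumes "u \<in> X0 s \<Omega>" "v \<in> X0 s \<Omega>"
  shows "lower_form u v = lower_form v u"
  unfolding lower_form_def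
  using kernel_integral_swap[OF zero_ext_sym[OF K_sym] lower_form_integrable(1)[OF assms]
      L_infinity_zero_ext(1)[OF sets_domain(2) K_L_infinity] X0_measurable[OF assms(2)] X0_measurable[OF assms(1)]]
  by (simp add: mult.commute)

lemma A_form_commute:
  assumes "u \<in> X0 s \<Omega>" "v \<in> X0 s \<Omega>"
  shows "A_form s \<Omega> K a u v = A_form s \<Omega> K a v u"
  using assms by (simp add: A_form_eq frac_form_commute[of u v] lower_form_commute[OF assms])

lemma A_form_add_cmult_left:
  assumes "u \<in> X0 s \<Omega>" "v \<in> X0 s \<Omega>" "w \<in> X0 s \<Omega>"
  shows "A_form s \<Omega> K a (\<lambda>x. u x + t * v x) w = A_form s \<Omega> K a u w + t * A_form s \<Omega> K a v w"
proof -
  have 1: "K0 p * (w (fst p) * (u (snd p) + t * v (snd p)))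
    = K0 p * (w (fst p) * u (snd p)) + t * (K0 p * (w (fst p) * v (snd p)))" for p
    by (simp add: algebra_simps)
  have 2: "a0 x * ((u x + t * v x) * w x) = a0 x * (u x * w x) + t * (a0 x * (v x * w x))" for x
    by (simp add: algebra_simps)
  have "lower_form (\<lambda>x. u x + t * v x) w = lower_form u w + t * lower_form v w"
    unfolding lower_form_def 1 2
    using lower_form_integrable[OF assms(1,3)] lower_form_integrable[OF assms(2,3)]
    by (simp add: algebra_simps)
  moreover have "frac_form s (\<lambda>x. u x + t * v x) w = frac_form s u w + t * frac_form s v w"
    by (simp add: frac_form_add_left assms X0_cmult frac_form_cmult_left)
  ultimately show ?thesis using assms by (simp add: A_form_eq X0_add X0_cmult algebra_simps)
qed

lemma A_form_add_cmult:
  assumes "u \<in> X0 s \<Omega>" "v \<in> X0 s \<Omega>"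
  shows "A_form s \<Omega> K a (\<lambda>x. u x + t * v x) (\<lambda>x. u x + t * v x)
    = A_form s \<Omega> K a u u + 2 * t * A_form s \<Omega> K a u v + t\<^sup>2 * A_form s \<Omega> K a v v"
proof -
  define w where "w = (\<lambda>x. u x + t * v x)"
  have w: "w \<in> X0 s \<Omega>" unfolding w_def by (intro X0_add X0_cmult assms)
  have *: "A_form s \<Omega> K a w z = A_form s \<Omega> K a u z + t * A_form s \<Omega> K a v z" if "z \<in> X0 s \<Omega>" for z
    unfolding w_def by (rule A_form_add_cmult_left[OF assms that])
  have "A_form s \<Omega> K a w w = A_form s \<Omega> K a w u + t * A_form s \<Omega> K a w v"
    using *[OF w] A_form_commute[OF assms(1) w] A_form_commute[OF assms(2) w] by simp
  then show ?thesis
    unfolding w_def[symmetric] *[OF assms(1)] *[OF assms(2)] A_form_commute[OF assms(2,1)]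
    by (simp add: power2_eq_square algebra_simps)
qed

end

section \<open>The derivative of the nonlocal term\<close>

context nonlocal_problem
begin

definition R_functional :: "('a \<Rightarrow> real) \<Rightarrow> real" where
  "R_functional u = (LINT p|lebesgue. Q0 p * (\<bar>u (fst p)\<bar> powr q * \<bar>u (snd p)\<bar> powr q))"

definition N_form :: "('a \<Rightarrow> real) \<Rightarrow> ('a \<Rightarrow> real) \<Rightarrow> real" where
  "N_form u \<phi> = (LINT p|lebesgue.
     Q0 p * ((\<bar>u (fst p)\<bar> powr (q - 2) * u (fst p) * \<phi> (fst p)) * \<bar>u (snd p)\<bar> powr q))"

lemma powr_integrable: "u \<in> X0 s \<Omega> \<Longrightarrow> integrable lebesgue (\<lambda>x. \<bar>u x\<bar> powr q)"
  using domain_powr_integrable q_gt q_less by auto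

text \<open>A common majorant: it dominates the first factor of the integrand of
  \<open>N_form\<close> and, up to the factor q, the difference quotients of |u + t \<phi>|^q for 0
  < t \<le> 1.\<close>

lemma powr_sum_integrable:
  assumes "u \<in> X0 s \<Omega>" "\<phi> \<in> X0 s \<Omega>"
  shows "integrable lebesgue (\<lambda>x. (\<bar>u x\<bar> + \<bar>\<phi> x\<bar>) powr q)"
proof (rule Bochner_Integration.integrable_bound)
  note [measurable] = X0_measurable[OF assms(1)] X0_measurable[OF assms(2)]
  show "integrable lebesgue (\<lambda>x. 2 powr q * (\<bar>u x\<bar> powr q + \<bar>\<phi> x\<bar> powr q))"
    by (intro integrable_mult_right Bochner_Integration.integrable_add powr_integrable assms)
  show "(\<lambda>x. (\<bar>u x\<bar> + \<bar>\<phi> x\<bar>) powr q) \<in> borel_measurable lebesgue" by measurable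
  show "AE x in lebesgue. norm ((\<bar>u x\<bar> + \<bar>\<phi> x\<bar>) powr q) \<le> norm (2 powr q * (\<bar>u x\<bar> powr q + \<bar>\<phi> x\<bar> powr q))"
    using powr_add_le[of "\<bar>u _\<bar>" "\<bar>\<phi> _\<bar>" q] q_gt by (intro AE_I2) auto
qed

lemma N_slice_integrable:
  assumes "u \<in> X0 s \<Omega>" "\<phi> \<in> X0 s \<Omega>"
  shows "integrable lebesgue (\<lambda>x. \<bar>u x\<bar> powr (q - 2) * u x * \<phi> x)"
proof (rule Bochner_Integration.integrable_bound[OF powr_sum_integrable[OF assms]])
  note [measurable] = X0_measurable[OF assms(1)] X0_measurable[OF assms(2)]
  show "(\<lambda>x. \<bar>u x\<bar> powr (q - 2) * u x * \<phi> x) \<in> borel_measurable lebesgue" by measurable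
  have "\<bar>\<bar>a\<bar> powr (q - 2) * a * b\<bar> \<le> (\<bar>a\<bar> + \<bar>b\<bar>) powr q" for a b :: real
  proof -
    have "\<bar>\<bar>a\<bar> powr (q - 2) * a * b\<bar> = \<bar>a\<bar> powr (q - 1) * \<bar>b\<bar>"
      by (simp only: abs_mult[of _ b] abs_powr_mult)
    also have "\<dots> \<le> (\<bar>a\<bar> + \<bar>b\<bar>) powr (q - 1) * (\<bar>a\<bar> + \<bar>b\<bar>) powr 1"
      using q_gt by (intro mult_mono powr_mono2) auto
    also have "\<dots> = (\<bar>a\<bar> + \<bar>b\<bar>) powr q" unfolding powr_add[symmetric] by simp
    finally show ?thesis .
  qed
  then show "AE x in lebesgue. norm (\<bar>u x\<bar> powr (q - 2) * u x * \<phi> x) \<le> norm ((\<bar>u x\<bar> + \<bar>\<phi> x\<bar>) powr q)"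
    by simp
qed

lemma R_functional_integrable:
  assumes "u \<in> X0 s \<Omega>"
  shows "integrable lebesgue (\<lambda>p. Q0 p * (\<bar>u (fst p)\<bar> powr q * \<bar>u (snd p)\<bar> powr q))"
  by (rule integrable_zero_ext_mult[OF sets_domain(2) Q_L_infinity
        integrable_lebesgue_tensor(1)[OF powr_integrable[OF assms] powr_integrable[OF assms]]])

lemma R_functional_nonneg: "0 \<le> R_functional u"
  unfolding R_functional_def
  by (rule integral_nonneg_AE) (use zero_ext_nonneg[OF Q_nonneg] in \<open>auto elim!: AE_mp\<close>)

lemma N_form_integrable:
  assumes "u \<in> X0 s \<Omega>" "\<phi> \<in> X0 s \<Omega>"
  shows "integrable lebesgue (\<lambda>p. Q0 p * ((\<bar>u (fst p)\<bar> powr (q - 2) * u (fst p) * \<phi> (fst p)) * \<bar>u (snd p)\<bar> powr q))"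
  by (rule integrable_zero_ext_mult[OF sets_domain(2) Q_L_infinity
        integrable_lebesgue_tensor(1)[OF N_slice_integrable[OF assms] powr_integrable[OF assms(1)]]])

lemma J_functional_eq:
  "J_functional s q \<Omega> K Q a lam f u = A_form s \<Omega> K a u u / 2 - lam / (2 * q) * R_functional u - f u"
proof -
  have "(LINT (x, y)|lebesgue_on (\<Omega> \<times> \<Omega>). Q (x, y) * \<bar>u x\<bar> powr q * \<bar>u y\<bar> powr q) = R_functional u"
    unfolding R_functional_def integral_lebesgue_on[OF sets_domain(2)]
    by (intro Bochner_Integration.integral_cong refl) (auto simp: zero_ext_def)
  then show ?thesis by (simp add: J_functional_def)
qed

lemma N_op_integral:
  assumes "u \<in> X0 s \<Omega>" "\<phi> \<in> X0 s \<Omega>"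
  shows "(LINT x|lebesgue_on \<Omega>. N_op q \<Omega> Q u x * \<phi> x) = N_form u \<phi>"
  using iterated_kernel_integral[OF sets_domain Q_L_infinity N_slice_integrable[OF assms] powr_integrable[OF assms(1)]]
  by (simp add: N_op_def B_op_def N_form_def ac_simps)

text \<open>Dominated convergence along positive increments; the minimality argument obtains the
  opposite direction by replacing \<phi> with its negative.\<close>

lemma R_functional_derivative:
  assumes u: "u \<in> X0 s \<Omega>" and \<phi>: "\<phi> \<in> X0 s \<Omega>"
  defines "t \<equiv> \<lambda>n. 1 / real (Suc n)"
  shows "(\<lambda>n. (R_functional (\<lambda>x. u x + t n * \<phi> x) - R_functional u) / t n) \<longlonglongrightarrow> 2 * q * N_form u \<phi>"
proof -
  have t: "0 < t n" "t n \<le> 1" for n by (auto simp: t_def)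
  have t0: "t \<longlonglongrightarrow> 0" unfolding t_def by (rule LIMSEQ_Suc[OF lim_1_over_n])
  define F where "F n x = \<bar>u x + t n * \<phi> x\<bar> powr q" for n x
  define F0 where "F0 x = \<bar>u x\<bar> powr q" for x
  define G where "G x = (\<bar>u x\<bar> + \<bar>\<phi> x\<bar>) powr q" for x
  define P where "P x = \<bar>u x\<bar> powr (q - 2) * u x * \<phi> x" for x
  have un: "(\<lambda>x. u x + t n * \<phi> x) \<in> X0 s \<Omega>" for n by (intro X0_add X0_cmult u \<phi>)
  have Gi: "integrable lebesgue G" unfolding G_def by (rule powr_sum_integrable[OF u \<phi>])
  have Fi: "integrable lebesgue (F n)" for n unfolding F_def by (rule powr_integrable[OF un])
  have F0i: "integrable lebesgue F0" unfolding F0_def by (rule powr_integrable[OF u])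
  have Pi: "integrable lebesgue P" unfolding P_def by (rule N_slice_integrable[OF u \<phi>])
  note [measurable] = borel_measurable_integrable[OF Gi] borel_measurable_integrable[OF Fi]
    borel_measurable_integrable[OF F0i] borel_measurable_integrable[OF Pi]
    L_infinity_zero_ext(1)[OF sets_domain(2) Q_L_infinity]
  have FG: "F n x \<le> G x" "0 \<le> F n x" "F0 x \<le> G x" "0 \<le> F0 x" for n x
  proof -
    have "\<bar>u x + t n * \<phi> x\<bar> \<le> \<bar>u x\<bar> + \<bar>t n * \<phi> x\<bar>" by (rule abs_triangle_ineq)
    also have "\<bar>t n * \<phi> x\<bar> \<le> \<bar>\<phi> x\<bar>"
      using t[of n] by (simp add: abs_mult mult_left_le_one_le)
    finally show "F n x \<le> G x" unfolding F_def G_def using q_gt by (intro powr_mono2) auto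
    show "F0 x \<le> G x" unfolding F0_def G_def using q_gt by (intro powr_mono2) auto
  qed (auto simp: F_def F0_def)
  have diff: "\<bar>(F n x - F0 x) / t n\<bar> \<le> q * G x" for n x
    using abs_powr_diff_le[OF q_gt less_imp_le[OF t(1)] t(2), of "u x" n "\<phi> x"] t(1)[of n]
    by (simp add: F_def F0_def G_def abs_divide pos_divide_le_eq mult.commute)
  have lim: "(\<lambda>n. (F n x - F0 x) / t n) \<longlonglongrightarrow> q * P x" for x
  proof -
    have "((\<lambda>z. \<bar>z\<bar> powr q) has_real_derivative q * (\<bar>u x\<bar> powr (q - 2) * u x)) (at (u x + 0 * \<phi> x))"
      using DERIV_abs_powr[OF q_gt, of "u x"] by simp
    moreover have "((\<lambda>h. u x + h * \<phi> x) has_real_derivative \<phi> x) (at 0)"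
      by (auto intro!: derivative_eq_intros)
    ultimately have "((\<lambda>h. \<bar>u x + h * \<phi> x\<bar> powr q) has_real_derivative
        q * (\<bar>u x\<bar> powr (q - 2) * u x) * \<phi> x) (at 0)"
      by (rule DERIV_chain2)
    then have "((\<lambda>h. (\<bar>u x + h * \<phi> x\<bar> powr q - F0 x) / h) \<longlongrightarrow> q * P x) (at 0)"
      by (simp add: has_field_derivative_iff F0_def P_def mult.assoc)
    moreover have "filterlim t (at 0) sequentially"
      using t0 t(1) by (auto simp: filterlim_at less_imp_neq[symmetric] intro!: always_eventually)
    ultimately show ?thesis unfolding F_def by (rule filterlim_compose)
  qed
  have limF: "(\<lambda>n. F n x) \<longlonglongrightarrow> F0 x" for x
  proof -
    have "(\<lambda>n. (F n x - F0 x) / t n * t n + F0 x) \<longlonglongrightarrow> q * P x * 0 + F0 x"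
      by (intro tendsto_intros lim t0)
    moreover have "(F n x - F0 x) / t n * t n + F0 x = F n x" for n using t(1)[of n] by simp
    ultimately show ?thesis by simp
  qed
  \<comment> \<open>The difference of products is split as (F_n - F_0)(x) F_n(y) + F_0(x) (F_n -
    F_0)(y), so every difference quotient is multiplied by a factor below \<open>G\<close>.\<close>
  define H where "H n p = Q0 p * ((F n (fst p) - F0 (fst p)) / t n * F n (snd p)
    + F0 (fst p) * ((F n (snd p) - F0 (snd p)) / t n))" for n p
  obtain C where C: "0 \<le> C" "AE p in lebesgue. \<bar>Q0 p\<bar> \<le> C"
    using L_infinity_zero_ext(2)[OF sets_domain(2) Q_L_infinity] by blast
  have HR: "integral\<^sup>L lebesgue (H n) = (R_functional (\<lambda>x. u x + t n * \<phi> x) - R_functional u) / t n" for n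
  proof -
    have "H n p = (Q0 p * (F n (fst p) * F n (snd p)) - Q0 p * (F0 (fst p) * F0 (snd p))) / t n" for p
      using t(1)[of n] by (simp add: H_def field_simps)
    then have "integral\<^sup>L lebesgue (H n)
        = (LINT p|lebesgue. (Q0 p * (F n (fst p) * F n (snd p)) - Q0 p * (F0 (fst p) * F0 (snd p))) / t n)"
      by (intro Bochner_Integration.integral_cong refl)
    then show ?thesis
      using R_functional_integrable[OF un[of n]] R_functional_integrable[OF u]
      by (simp add: R_functional_def F_def F0_def)
  qed
  have "(\<lambda>n. integral\<^sup>L lebesgue (H n)) \<longlonglongrightarrow>
      (LINT p|lebesgue. Q0 p * (q * P (fst p) * F0 (snd p) + F0 (fst p) * (q * P (snd p))))"
  proof (rule integral_dominated_convergence[where w="\<lambda>p. (C * (2 * q)) * (G (fst p) * G (snd p))"])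
    show "AE p in lebesgue. (\<lambda>n. H n p) \<longlonglongrightarrow> Q0 p * (q * P (fst p) * F0 (snd p) + F0 (fst p) * (q * P (snd p)))"
      unfolding H_def by (intro AE_I2 tendsto_mult tendsto_add tendsto_const lim limF)
    show "integrable lebesgue (\<lambda>p. (C * (2 * q)) * (G (fst p) * G (snd p)))"
      by (intro integrable_mult_right integrable_lebesgue_tensor Gi)
    show "AE p in lebesgue. norm (H n p) \<le> (C * (2 * q)) * (G (fst p) * G (snd p))" for n
      using C(2)
    proof eventually_elim
      case (elim p)
      define X where "X = (F n (fst p) - F0 (fst p)) / t n"
      define Y where "Y = (F n (snd p) - F0 (snd p)) / t n"
      have G0: "0 \<le> G x" for x by (simp add: G_def)
      have X: "\<bar>X\<bar> \<le> q * G (fst p)" and Y: "\<bar>Y\<bar> \<le> q * G (snd p)" unfolding X_def Y_def by (rule diff)+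
      have "\<bar>X * F n (snd p) + F0 (fst p) * Y\<bar> \<le> \<bar>X\<bar> * F n (snd p) + F0 (fst p) * \<bar>Y\<bar>"
        using abs_triangle_ineq[of "X * F n (snd p)" "F0 (fst p) * Y"] FG by (simp add: abs_mult)
      also have "\<dots> \<le> (q * G (fst p)) * G (snd p) + G (fst p) * (q * G (snd p))"
        using X Y FG G0 q_gt by (intro add_mono mult_mono) auto
      finally have "\<bar>X * F n (snd p) + F0 (fst p) * Y\<bar> \<le> 2 * q * (G (fst p) * G (snd p))" by simp
      then have "\<bar>Q0 p\<bar> * \<bar>X * F n (snd p) + F0 (fst p) * Y\<bar> \<le> C * (2 * q * (G (fst p) * G (snd p)))"
        using elim C(1) by (intro mult_mono) auto
      then show ?case by (simp add: H_def abs_mult X_def Y_def mult.assoc)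
    qed
    show "H n \<in> borel_measurable lebesgue" for n unfolding H_def[abs_def] by measurable
  qed measurable
  also have "(LINT p|lebesgue. Q0 p * (q * P (fst p) * F0 (snd p) + F0 (fst p) * (q * P (snd p))))
      = 2 * q * N_form u \<phi>"
  proof -
    have i: "integrable lebesgue (\<lambda>p. Q0 p * (P (fst p) * F0 (snd p)))"
      using N_form_integrable[OF u \<phi>] by (simp add: P_def F0_def)
    have i2: "integrable lebesgue (\<lambda>p. Q0 p * (F0 (fst p) * P (snd p)))"
      by (rule integrable_zero_ext_mult[OF sets_domain(2) Q_L_infinity integrable_lebesgue_tensor(1)[OF F0i Pi]])
    have "Q0 p * (q * P (fst p) * F0 (snd p) + F0 (fst p) * (q * P (snd p)))
      = q * (Q0 p * (P (fst p) * F0 (snd p))) + q * (Q0 p * (F0 (fst p) * P (snd p)))" for p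
      by (simp add: algebra_simps)
    then have "(LINT p|lebesgue. Q0 p * (q * P (fst p) * F0 (snd p) + F0 (fst p) * (q * P (snd p))))
      = q * (LINT p|lebesgue. Q0 p * (P (fst p) * F0 (snd p))) + q * (LINT p|lebesgue. Q0 p * (F0 (fst p) * P (snd p)))"
      using i i2 by simp
    \<comment> \<open>Symmetry of \<open>Q\<close> makes the two halves equal, whence the factor
      2.\<close>
    also have "(LINT p|lebesgue. Q0 p * (F0 (fst p) * P (snd p))) = (LINT p|lebesgue. Q0 p * (P (fst p) * F0 (snd p)))"
      by (rule kernel_integral_swap[OF zero_ext_sym[OF Q_sym] i2]) measurable
    also have "(LINT p|lebesgue. Q0 p * (P (fst p) * F0 (snd p))) = N_form u \<phi>"
      by (simp add: N_form_def P_def F0_def)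
    finally show ?thesis by simp
  qed
  finally show ?thesis unfolding HR .
qed

lemma A_form_uminus_right:
  assumes "u \<in> X0 s \<Omega>" "\<phi> \<in> X0 s \<Omega>"
  shows "A_form s \<Omega> K a u (\<lambda>x. -1 * \<phi> x) = - A_form s \<Omega> K a u \<phi>"
proof -
  \<comment> \<open>Linearity is available in the form u + t v, so the negative is written as \<phi>
    - 2 \<phi>.\<close>
  have "A_form s \<Omega> K a (\<lambda>x. \<phi> x + -2 * \<phi> x) u = - A_form s \<Omega> K a \<phi> u"
    using A_form_add_cmult_left[OF assms(2,2,1), of "-2"] by simp
  moreover have "(\<lambda>x. \<phi> x + -2 * \<phi> x) = (\<lambda>x. -1 * \<phi> x)" by auto
  ultimately show ?thesis
    using A_form_commute[OF assms(1) X0_cmult[OF assms(2), of "-1"]] A_form_commute[OF assms] by simp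
qed

text \<open>Difference quotients with positive increments are nonnegative at a minimizer; their
  limit is linear in \<phi>, so \<phi> and its negative together give equality. The factor 1/(2q) in
  the functional cancels the 2q of the nonlocal derivative.\<close>

lemma minimizer_weak_solution:
  assumes u: "u \<in> X0 s \<Omega>"
    and min: "\<And>v. v \<in> X0 s \<Omega> \<Longrightarrow> J_functional s q \<Omega> K Q a lam f u \<le> J_functional s q \<Omega> K Q a lam f v"
  shows "weak_solution s q \<Omega> K Q a lam f u"
proof -
  have ge: "0 \<le> A_form s \<Omega> K a u \<phi> - lam * N_form u \<phi> - f \<phi>" if \<phi>: "\<phi> \<in> X0 s \<Omega>" for \<phi>
  proof (rule LIMSEQ_le_const)
    define t where "t n = 1 / real (Suc n)" for n
    define \<Delta> where "\<Delta> n = (R_functional (\<lambda>x. u x + t n * \<phi> x) - R_functional u) / t n" for n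
    have t: "0 < t n" for n by (simp add: t_def)
    have t0: "t \<longlonglongrightarrow> 0" unfolding t_def by (rule LIMSEQ_Suc[OF lim_1_over_n])
    have "\<Delta> \<longlonglongrightarrow> 2 * q * N_form u \<phi>"
      unfolding \<Delta>_def t_def by (rule R_functional_derivative[OF u \<phi>])
    then have "(\<lambda>n. A_form s \<Omega> K a u \<phi> + t n * (A_form s \<Omega> K a \<phi> \<phi> / 2) - lam / (2 * q) * \<Delta> n - f \<phi>)
      \<longlonglongrightarrow> A_form s \<Omega> K a u \<phi> + 0 * (A_form s \<Omega> K a \<phi> \<phi> / 2) - lam / (2 * q) * (2 * q * N_form u \<phi>) - f \<phi>"
      by (intro tendsto_intros t0)
    then show "(\<lambda>n. A_form s \<Omega> K a u \<phi> + t n * (A_form s \<Omega> K a \<phi> \<phi> / 2) - lam / (2 * q) * \<Delta> n - f \<phi>)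
      \<longlonglongrightarrow> A_form s \<Omega> K a u \<phi> - lam * N_form u \<phi> - f \<phi>"
      using q_gt by simp
    have "0 \<le> A_form s \<Omega> K a u \<phi> + t n * (A_form s \<Omega> K a \<phi> \<phi> / 2) - lam / (2 * q) * \<Delta> n - f \<phi>" for n
    proof -
      have "0 \<le> J_functional s q \<Omega> K Q a lam f (\<lambda>x. u x + t n * \<phi> x) - J_functional s q \<Omega> K Q a lam f u"
        using min[OF X0_add[OF u X0_cmult[OF \<phi>]]] by simp
      also have "\<dots> = t n * A_form s \<Omega> K a u \<phi> + (t n)\<^sup>2 * A_form s \<Omega> K a \<phi> \<phi> / 2
          - lam / (2 * q) * (R_functional (\<lambda>x. u x + t n * \<phi> x) - R_functional u) - t n * f \<phi>"
        by (simp add: J_functional_eq A_form_add_cmult u \<phi> X0_dual_add[OF f_dual] X0_dual_cmult[OF f_dual]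
            X0_cmult right_diff_distrib add_divide_distrib)
      also have "R_functional (\<lambda>x. u x + t n * \<phi> x) - R_functional u = t n * \<Delta> n"
        using t[of n] by (simp add: \<Delta>_def)
      finally have "0 \<le> t n * (A_form s \<Omega> K a u \<phi> + t n * (A_form s \<Omega> K a \<phi> \<phi> / 2) - lam / (2 * q) * \<Delta> n - f \<phi>)"
        by (simp add: algebra_simps power2_eq_square)
      then show ?thesis using t[of n] by (simp add: zero_le_mult_iff)
    qed
    then show "\<exists>M. \<forall>n\<ge>M. 0 \<le> A_form s \<Omega> K a u \<phi> + t n * (A_form s \<Omega> K a \<phi> \<phi> / 2) - lam / (2 * q) * \<Delta> n - f \<phi>"
      by blast
  qed
  have "A_form s \<Omega> K a u \<phi> = lam * N_form u \<phi> + f \<phi>" if \<phi>: "\<phi> \<in> X0 s \<Omega>" for \<phi>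
  proof -
    have "N_form u (\<lambda>x. -1 * \<phi> x) = - N_form u \<phi>" by (simp add: N_form_def)
    then show ?thesis
      using ge[OF \<phi>] ge[OF X0_cmult[OF \<phi>, of "-1"]] A_form_uminus_right[OF u \<phi>]
        X0_dual_cmult[OF f_dual \<phi>, of "-1"] by simp
  qed
  then show ?thesis using u by (simp add: weak_solution_def N_op_integral)
qed

end

section \<open>Existence, nontriviality and sign\<close>

lemma zero_ext_L2:
  fixes Z :: "'b::euclidean_space \<Rightarrow> real"
  assumes S: "S \<in> lmeasurable" and Z: "Z \<in> L_infinity (lebesgue_on S)"
  shows "zero_ext S Z \<in> L2 lebesgue"
proof -
  have S': "S \<in> sets lebesgue" using S by auto
  obtain C where C: "AE p in lebesgue. \<bar>zero_ext S Z p\<bar> \<le> C" using L_infinity_zero_ext(2)[OF S' Z] by blast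
  have "(\<lambda>x. C * indicator S x) \<in> L2 lebesgue" by (intro L2_cmult indicator_L2 S)
  then show ?thesis
    by (rule L2_dominated[OF L_infinity_zero_ext(1)[OF S' Z]])
       (use C in \<open>auto elim!: AE_mp simp: zero_ext_def indicator_def\<close>)
qed

lemma zero_ext_mult_L2:
  fixes Z :: "'b::euclidean_space \<Rightarrow> real"
  assumes S: "S \<in> sets lebesgue" and Z: "Z \<in> L_infinity (lebesgue_on S)" and u: "u \<in> L2 lebesgue"
  shows "(\<lambda>x. zero_ext S Z x * u x) \<in> L2 lebesgue"
proof -
  note [measurable] = L_infinity_zero_ext(1)[OF S Z] L2_measurable[OF u]
  obtain C where C: "0 \<le> C" "AE p in lebesgue. \<bar>zero_ext S Z p\<bar> \<le> C" using L_infinity_zero_ext(2)[OF S Z] by blast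
  show ?thesis
  proof (rule L2_dominated[OF _ L2_cmult[OF u, of C]])
    show "AE x in lebesgue. \<bar>zero_ext S Z x * u x\<bar> \<le> \<bar>C * u x\<bar>"
      using C(2) by eventually_elim (use C(1) in \<open>auto simp: abs_mult intro!: mult_right_mono\<close>)
  qed measurable
qed

context frac_domain
begin

text \<open>A map with Lipschitz constant 1 that fixes 0 increases neither |u| nor any difference
  quotient. It serves for the positive and negative parts.\<close>

lemma X0_lipschitz_comp:
  assumes u: "u \<in> X0 s \<Omega>" and [measurable]: "g \<in> borel_measurable borel"
    and lip: "\<And>x y. \<bar>g x - g y\<bar> \<le> \<bar>x - y :: real\<bar>" and g0: "g 0 = 0"
  shows "(\<lambda>x. g (u x)) \<in> X0 s \<Omega>"
proof -
  note [measurable] = X0_measurable[OF u]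
  have m: "(\<lambda>x. g (u x)) \<in> borel_measurable lebesgue" by measurable
  have "(\<lambda>x. g (u x)) \<in> L2 lebesgue"
    by (rule L2_dominated[OF m X0_L2[OF u]]) (use lip[of _ 0] g0 in auto)
  moreover have "gquot s (\<lambda>x. g (u x)) \<in> L2 lebesgue"
    by (rule L2_dominated[OF borel_measurable_gquot[OF m] X0_gquot_L2[OF u]])
       (use lip in \<open>auto simp: gquot_def abs_divide intro!: divide_right_mono\<close>)
  moreover have "AE x in lebesgue. x \<notin> \<Omega> \<longrightarrow> g (u x) = 0"
    using X0_AE_zero[OF u] by eventually_elim (use g0 in auto)
  ultimately show ?thesis by (simp add: X0_iff)
qed

lemma frac_form_eq_zero_imp_AE:
  assumes u: "u \<in> X0 s \<Omega>" and z: "frac_form s u u = 0"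
  shows "AE x in lebesgue. u x = 0"
proof -
  obtain C where "0 \<le> C"
    "\<And>u. u \<in> X0 s \<Omega> \<Longrightarrow> (LINT x|lebesgue. (u x)\<^sup>2) \<le> C * (LINT p|lebesgue. (gquot s u p)\<^sup>2)"
    by (rule X0_poincare[OF bounded_domain s_pos]) (rule that)
  from this(2)[OF u] have "(LINT x|lebesgue. (u x)\<^sup>2) \<le> 0"
    by (simp add: gquot_square_integral z)
  then have "(LINT x|lebesgue. (u x)\<^sup>2) = 0" by (intro antisym) auto
  then have "AE x in lebesgue. (u x)\<^sup>2 = 0"
    by (subst (asm) integral_nonneg_eq_0_iff_AE) (use L2_square_integrable[OF X0_L2[OF u]] in auto)
  then show ?thesis by simp
qed

end

section \<open>Minimization, nontriviality and sign\<close>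

context nonlocal_problem
begin

text \<open>In the kernel part, the tensor squares of \<open>u n\<close> are bounded in L2 and
  converge almost everywhere, so they pair with \<open>K0\<close>, which is square integrable on a
  bounded set. In the potential part, u_n^2 = (u_n - v)^2 + 2 v u_n - v^2: the first term vanishes
  by strong L2 convergence, the second is a weak limit.\<close>

lemma lower_form_limit:
  fixes u :: "nat \<Rightarrow> 'a \<Rightarrow> real"
  assumes u: "\<And>n. u n \<in> X0 s \<Omega>" and v: "v \<in> X0 s \<Omega>"
    and lim: "AE x in lebesgue. (\<lambda>n. u n x) \<longlonglongrightarrow> v x"
    and lim2: "(\<lambda>n. LINT x|lebesgue. (u n x - v x)\<^sup>2) \<longlonglongrightarrow> 0"
    and bd: "\<And>n. (LINT x|lebesgue. (u n x)\<^sup>2) \<le> C"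
  shows "(\<lambda>n. lower_form (u n) (u n)) \<longlonglongrightarrow> lower_form v v"
  unfolding lower_form_def
proof (intro tendsto_add)
  have C: "0 \<le> C" using order.trans[OF integral_nonneg_AE bd[of 0]] by simp
  have tens: "(\<lambda>p. w (fst p) * w (snd p)) \<in> L2 lebesgue"
    "(LINT p|lebesgue. (w (fst p) * w (snd p))\<^sup>2) = (LINT x|lebesgue. (w x)\<^sup>2) * (LINT x|lebesgue. (w x)\<^sup>2)"
    if w: "w \<in> X0 s \<Omega>" for w
  proof -
    note [measurable] = X0_measurable[OF w]
    note i = integrable_lebesgue_tensor[OF L2_square_integrable[OF X0_L2[OF w]] L2_square_integrable[OF X0_L2[OF w]]]
    show "(\<lambda>p. w (fst p) * w (snd p)) \<in> L2 lebesgue"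
      unfolding L2_def using i(1) by (auto simp: power_mult_distrib)
    show "(LINT p|lebesgue. (w (fst p) * w (snd p))\<^sup>2) = (LINT x|lebesgue. (w x)\<^sup>2) * (LINT x|lebesgue. (w x)\<^sup>2)"
      using i(2) by (simp add: power_mult_distrib)
  qed
  show "(\<lambda>n. LINT p|lebesgue. K0 p * (u n (fst p) * u n (snd p)))
      \<longlonglongrightarrow> (LINT p|lebesgue. K0 p * (v (fst p) * v (snd p)))"
  proof (rule L2_bounded_AE_weak_limit)
    show "AE p in lebesgue. (\<lambda>n. u n (fst p) * u n (snd p)) \<longlonglongrightarrow> v (fst p) * v (snd p)"
      using AE_lebesgue_fst[OF lim] AE_lebesgue_snd[OF lim] by eventually_elim (rule tendsto_mult)
    show "(LINT p|lebesgue. (u n (fst p) * u n (snd p))\<^sup>2) \<le> C * C" for n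
      unfolding tens(2)[OF u] using bd C by (intro mult_mono) auto
    show "K0 \<in> L2 lebesgue" by (rule zero_ext_L2[OF lmeasurable_domain_Times K_L_infinity])
  qed (use tens u v in \<open>auto intro: L2_measurable\<close>)
  obtain Ca where Ca: "0 \<le> Ca" "AE x in lebesgue. \<bar>a0 x\<bar> \<le> Ca"
    using L_infinity_zero_ext(2)[OF sets_domain(1) a_L_infinity] by blast
  note ai = integrable_zero_ext_mult[OF sets_domain(1) a_L_infinity]
  have i1: "integrable lebesgue (\<lambda>x. a0 x * (u n x - v x)\<^sup>2)" for n
    by (rule ai[OF L2_square_integrable[OF L2_diff[OF X0_L2[OF u] X0_L2[OF v]]]])
  have i2: "integrable lebesgue (\<lambda>x. a0 x * v x * u n x)" for n
    using ai[OF L2_mult_integrable[OF X0_L2[OF v] X0_L2[OF u[of n]]]] by (simp add: mult.assoc)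
  have i3: "integrable lebesgue (\<lambda>x. a0 x * v x * v x)"
    using ai[OF L2_mult_integrable[OF X0_L2[OF v] X0_L2[OF v]]] by (simp add: mult.assoc)
  have "(\<lambda>n. LINT x|lebesgue. a0 x * (u n x - v x)\<^sup>2) \<longlonglongrightarrow> 0"
  proof (rule Lim_null_comparison)
    show "(\<lambda>n. Ca * (LINT x|lebesgue. (u n x - v x)\<^sup>2)) \<longlonglongrightarrow> 0"
      using tendsto_mult[OF tendsto_const lim2, of Ca] by simp
    have "norm (LINT x|lebesgue. a0 x * (u n x - v x)\<^sup>2) \<le> Ca * (LINT x|lebesgue. (u n x - v x)\<^sup>2)" for n
    proof -
      have "norm (LINT x|lebesgue. a0 x * (u n x - v x)\<^sup>2) \<le> (LINT x|lebesgue. norm (a0 x * (u n x - v x)\<^sup>2))"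
        by (rule integral_norm_bound)
      also have "\<dots> \<le> (LINT x|lebesgue. Ca * (u n x - v x)\<^sup>2)"
      proof (rule integral_mono_AE)
        show "AE x in lebesgue. norm (a0 x * (u n x - v x)\<^sup>2) \<le> Ca * (u n x - v x)\<^sup>2"
          using Ca(2) by eventually_elim (auto simp: abs_mult intro!: mult_right_mono)
        show "integrable lebesgue (\<lambda>x. Ca * (u n x - v x)\<^sup>2)"
          by (intro integrable_mult_right L2_square_integrable L2_diff X0_L2[OF u] X0_L2[OF v])
      qed (use i1 in auto)
      finally show ?thesis by simp
    qed
    then show "\<forall>\<^sub>F n in sequentially. norm (LINT x|lebesgue. a0 x * (u n x - v x)\<^sup>2)
        \<le> Ca * (LINT x|lebesgue. (u n x - v x)\<^sup>2)" by simp
  qed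
  moreover have "(\<lambda>n. LINT x|lebesgue. a0 x * v x * u n x) \<longlonglongrightarrow> (LINT x|lebesgue. a0 x * v x * v x)"
    by (rule L2_bounded_AE_weak_limit[OF X0_L2[OF u] X0_measurable[OF v] lim bd
          zero_ext_mult_L2[OF sets_domain(1) a_L_infinity X0_L2[OF v]]])
  ultimately have "(\<lambda>n. (LINT x|lebesgue. a0 x * (u n x - v x)\<^sup>2) + 2 * (LINT x|lebesgue. a0 x * v x * u n x)
      - (LINT x|lebesgue. a0 x * v x * v x))
    \<longlonglongrightarrow> 0 + 2 * (LINT x|lebesgue. a0 x * v x * v x) - (LINT x|lebesgue. a0 x * v x * v x)"
    by (intro tendsto_intros)
  moreover have "(LINT x|lebesgue. a0 x * (u n x - v x)\<^sup>2) + 2 * (LINT x|lebesgue. a0 x * v x * u n x)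
      - (LINT x|lebesgue. a0 x * v x * v x) = (LINT x|lebesgue. a0 x * (u n x * u n x))" for n
  proof -
    have "a0 x * (u n x * u n x) = a0 x * (u n x - v x)\<^sup>2 + 2 * (a0 x * v x * u n x) - a0 x * v x * v x" for x
      by (simp add: power2_eq_square algebra_simps)
    then show ?thesis using i1[of n] i2[of n] i3 by simp
  qed
  ultimately show "(\<lambda>n. LINT x|lebesgue. a0 x * (u n x * u n x)) \<longlonglongrightarrow> (LINT x|lebesgue. a0 x * (v x * v x))"
    by (simp add: mult.assoc)
qed

text \<open>The nonlocal term is nonnegative as \<open>lam\<close> is negative; the linear term is
  absorbed by half of the coercivity through (\<alpha> norm / 2 - C)^2 / \<alpha> \<ge> 0, which
  leaves \<alpha> / 4.\<close>

lemma J_functional_coercive: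
  obtains C where "0 \<le> C"
    "\<And>u. u \<in> X0 s \<Omega> \<Longrightarrow> \<alpha> / 4 * frac_form s u u - C \<le> J_functional s q \<Omega> K Q a lam f u"
proof -
  obtain C where C: "0 \<le> C" "\<And>u. u \<in> X0 s \<Omega> \<Longrightarrow> \<bar>f u\<bar> \<le> C * X0_norm s u"
    by (rule X0_dual_bound[OF f_dual]) (rule that)
  have "\<alpha> / 4 * frac_form s u u - C\<^sup>2 / \<alpha> \<le> J_functional s q \<Omega> K Q a lam f u" if u: "u \<in> X0 s \<Omega>" for u
  proof -
    have "0 \<le> (\<alpha> * X0_norm s u / 2 - C)\<^sup>2 / \<alpha>" using \<alpha>_pos by simp
    also have "\<dots> = \<alpha> / 4 * frac_form s u u + C\<^sup>2 / \<alpha> - C * X0_norm s u"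
      using \<alpha>_pos by (simp add: X0_norm_square[symmetric] power2_eq_square field_simps)
    finally have "C * X0_norm s u \<le> \<alpha> / 4 * frac_form s u u + C\<^sup>2 / \<alpha>" by simp
    moreover have "f u \<le> C * X0_norm s u" using C(2)[OF u] by (simp add: abs_le_iff)
    moreover have "\<alpha> * frac_form s u u \<le> A_form s \<Omega> K a u u" using coercive[OF u] by (simp add: X0_norm_square)
    moreover have "lam / (2 * q) * R_functional u \<le> 0"
      using lam_neg q_gt R_functional_nonneg by (simp add: mult_nonpos_nonneg divide_nonpos_pos)
    ultimately show ?thesis unfolding J_functional_eq by simp
  qed
  then show ?thesis using that[of "C\<^sup>2 / \<alpha>"] \<alpha>_pos by simp
qed

lemma minimizer_exists:
  obtains u where "u \<in> X0 s \<Omega>"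
    "\<And>v. v \<in> X0 s \<Omega> \<Longrightarrow> J_functional s q \<Omega> K Q a lam f u \<le> J_functional s q \<Omega> K Q a lam f v"
proof -
  define J where "J = J_functional s q \<Omega> K Q a lam f"
  obtain C where C: "0 \<le> C"
    "\<And>u. u \<in> X0 s \<Omega> \<Longrightarrow> \<alpha> / 4 * frac_form s u u - C \<le> J_functional s q \<Omega> K Q a lam f u"
    by (rule J_functional_coercive) (rule that)
  note C = C[folded J_def]
  have lower: "- C \<le> J u" if "u \<in> X0 s \<Omega>" for u
  proof -
    have "0 \<le> \<alpha> / 4 * frac_form s u u" using \<alpha>_pos frac_form_nonneg[of u] by simp
    then show ?thesis using C(2)[OF that] by linarith
  qed
  obtain I :: real and w where w: "\<And>n. w n \<in> X0 s \<Omega>" "\<And>n. J (w n) < I + 1 / real (Suc n)"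
    and I: "\<And>v. v \<in> X0 s \<Omega> \<Longrightarrow> I \<le> J v"
    by (rule X0_minimizing_sequence[of "- C" J, OF lower]) (simp, rule that)
  have bdw: "frac_form s (w n) (w n) \<le> 4 * (I + 1 + C) / \<alpha>" for n
  proof -
    have "1 / real (Suc n) \<le> 1" by simp
    from less_le_trans[OF w(2)[of n] add_left_mono[OF this]] have "J (w n) \<le> I + 1" by simp
    with C(2)[OF w(1)[of n]] show ?thesis using \<alpha>_pos by (simp add: field_simps)
  qed
  obtain r v where r: "strict_mono (r :: nat \<Rightarrow> nat)" and v: "v \<in> X0 s \<Omega>"
    and lim: "AE x in lebesgue. (\<lambda>n. w (r n) x) \<longlonglongrightarrow> v x"
    and lim2: "(\<lambda>n. LINT x|lebesgue. (w (r n) x - v x)\<^sup>2) \<longlonglongrightarrow> 0"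
    by (rule X0_bounded_subseq[of w, OF w(1) bdw]) (rule that)
  define u where "u n = w (r n)" for n
  have u: "u n \<in> X0 s \<Omega>" and bd: "frac_form s (u n) (u n) \<le> 4 * (I + 1 + C) / \<alpha>" for n
    using w(1) bdw by (auto simp: u_def)
  obtain CP where CP: "0 \<le> CP"
    "\<And>u. u \<in> X0 s \<Omega> \<Longrightarrow> (LINT x|lebesgue. (u x)\<^sup>2) \<le> CP * (LINT p|lebesgue. (gquot s u p)\<^sup>2)"
    by (rule X0_poincare[OF bounded_domain s_pos]) (rule that)
  have bd2: "(LINT x|lebesgue. (u n x)\<^sup>2) \<le> CP * (2 / frac_const DIM('a) s * (4 * (I + 1 + C) / \<alpha>))" for n
  proof -
    have "CP * (2 / frac_const DIM('a) s * frac_form s (u n) (u n))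
      \<le> CP * (2 / frac_const DIM('a) s * (4 * (I + 1 + C) / \<alpha>))"
      using bd[of n] CP(1) frac_const_pos by (intro mult_left_mono) auto
    then show ?thesis using CP(2)[OF u[of n]] by (simp add: gquot_square_integral)
  qed
  have limu: "AE x in lebesgue. (\<lambda>n. u n x) \<longlonglongrightarrow> v x" using lim by (simp add: u_def)
  \<comment> \<open>A lower bound for the functional without its nonlocal term, with E(u_n, u_n)
    replaced by 2 E(v, u_n) - E(v, v); unlike the energy itself, it has a limit.\<close>
  define b where "b n = frac_form s v (u n) - frac_form s v v / 2 - lower_form (u n) (u n) / 2 - f (u n)" for n
  have "b \<longlonglongrightarrow> frac_form s v v - frac_form s v v / 2 - lower_form v v / 2 - f v"
    unfolding b_def
    by (intro tendsto_diff tendsto_divide tendsto_const frac_form_weak_limit[OF u bd v limu v]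
        lower_form_limit[OF u v limu _ bd2] X0_dual_weak_limit[OF f_dual u bd v limu])
       (use lim2 in \<open>simp_all add: u_def\<close>)
  moreover have "frac_form s v v - frac_form s v v / 2 - lower_form v v / 2 - f v = A_form s \<Omega> K a v v / 2 - f v"
    by (simp add: A_form_eq v diff_divide_distrib)
  ultimately have blim: "b \<longlonglongrightarrow> A_form s \<Omega> K a v v / 2 - f v" by (simp only:)
  define \<mu> where "\<mu> = - lam / (2 * q)"
  have \<mu>: "0 < \<mu>" using lam_neg q_gt by (simp add: \<mu>_def divide_neg_pos)
  have Jeq: "J z = A_form s \<Omega> K a z z / 2 + \<mu> * R_functional z - f z" for z
    by (simp add: J_def J_functional_eq \<mu>_def)
  \<comment> \<open>Near-minimality of \<open>u n\<close> is solved for the nonlocal term, giving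
    the varying bound to which Fatou applies.\<close>
  have Rle: "R_functional (u n) \<le> (I + 1 / real (Suc (r n)) - b n) / \<mu>" for n
  proof -
    have "frac_form s v v - 2 * frac_form s v (u n) + frac_form s (u n) (u n)
        = frac_form s (\<lambda>x. v x + -1 * u n x) (\<lambda>x. v x + -1 * u n x)"
      unfolding frac_form_add_cmult[OF v u] by simp
    then have "2 * frac_form s v (u n) - frac_form s v v \<le> frac_form s (u n) (u n)"
      using frac_form_nonneg[of "\<lambda>x. v x + -1 * u n x"] by linarith
    then have "b n + \<mu> * R_functional (u n) \<le> J (u n)"
      unfolding Jeq by (simp add: b_def A_form_eq u field_simps)
    also have "\<dots> < I + 1 / real (Suc (r n))" unfolding u_def by (rule w)
    finally show ?thesis using \<mu> by (simp add: pos_le_divide_eq algebra_simps)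
  qed
  have "R_functional v \<le> (I + 0 - (A_form s \<Omega> K a v v / 2 - f v)) / \<mu>"
    unfolding R_functional_def
  proof (rule integral_Fatou)
    show "integrable lebesgue (\<lambda>p. Q0 p * (\<bar>u n (fst p)\<bar> powr q * \<bar>u n (snd p)\<bar> powr q))" for n
      by (rule R_functional_integrable[OF u])
    show "AE p in lebesgue. 0 \<le> Q0 p * (\<bar>u n (fst p)\<bar> powr q * \<bar>u n (snd p)\<bar> powr q)" for n
      using zero_ext_nonneg[OF Q_nonneg] by eventually_elim simp
    show "(\<lambda>p. Q0 p * (\<bar>v (fst p)\<bar> powr q * \<bar>v (snd p)\<bar> powr q)) \<in> borel_measurable lebesgue"
      by (rule borel_measurable_integrable[OF R_functional_integrable[OF v]])
    have pw: "(\<lambda>n. \<bar>x n\<bar> powr q) \<longlonglongrightarrow> \<bar>y\<bar> powr q" if "x \<longlonglongrightarrow> y" for x :: "nat \<Rightarrow> real" and y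
      using isCont_tendsto_compose[OF DERIV_isCont[OF DERIV_abs_powr[OF q_gt]] that] .
    show "AE p in lebesgue. (\<lambda>n. Q0 p * (\<bar>u n (fst p)\<bar> powr q * \<bar>u n (snd p)\<bar> powr q))
        \<longlonglongrightarrow> Q0 p * (\<bar>v (fst p)\<bar> powr q * \<bar>v (snd p)\<bar> powr q)"
      using AE_lebesgue_fst[OF limu] AE_lebesgue_snd[OF limu]
      by eventually_elim (intro tendsto_mult tendsto_const pw)
    show "(LINT p|lebesgue. Q0 p * (\<bar>u n (fst p)\<bar> powr q * \<bar>u n (snd p)\<bar> powr q))
        \<le> (I + 1 / real (Suc (r n)) - b n) / \<mu>" for n
      using Rle[of n] by (simp add: R_functional_def)
    have "(\<lambda>n. 1 / real (Suc (r n))) \<longlonglongrightarrow> 0"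
      using LIMSEQ_subseq_LIMSEQ[OF LIMSEQ_Suc[OF lim_1_over_n] r] by (simp add: o_def)
    then show "(\<lambda>n. (I + 1 / real (Suc (r n)) - b n) / \<mu>)
        \<longlonglongrightarrow> (I + 0 - (A_form s \<Omega> K a v v / 2 - f v)) / \<mu>"
      using \<mu> by (intro tendsto_divide tendsto_diff tendsto_add tendsto_const blim) auto
  qed
  \<comment> \<open>Multiplied by \<mu> and rearranged, the Fatou bound is exactly this
    inequality.\<close>
  then have "J v \<le> I" using \<mu> by (simp add: Jeq pos_le_divide_eq algebra_simps)
  then have "J v \<le> J z" if "z \<in> X0 s \<Omega>" for z using I[OF that] by simp
  then show ?thesis using that[OF v] by (simp add: J_def)
qed

text \<open>If \<open>u\<close> vanished almost everywhere, every term of the weak equation except f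
  \<phi> would be zero, for any test function \<phi>.\<close>

lemma weak_solution_nontrivial:
  assumes "\<phi> \<in> X0 s \<Omega>" "f \<phi> \<noteq> 0" and w: "weak_solution s q \<Omega> K Q a lam f u"
  shows "\<not> (AE x in lebesgue. u x = 0)"
proof
  assume z: "AE x in lebesgue. u x = 0"
  have u: "u \<in> X0 s \<Omega>" using w by (simp add: weak_solution_def)
  have "AE p in lebesgue. gquot s u p = 0"
    using AE_lebesgue_fst[OF z] AE_lebesgue_snd[OF z] by eventually_elim (simp add: gquot_def)
  then have 1: "frac_form s u \<phi> = 0"
    unfolding frac_form_gquot by (subst integral_eq_zero_AE) auto
  have "(LINT p|lebesgue. K0 p * (\<phi> (fst p) * u (snd p))) = 0"
    by (rule integral_eq_zero_AE) (use AE_lebesgue_snd[OF z] in auto)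
  moreover have "(LINT x|lebesgue. a0 x * (u x * \<phi> x)) = 0"
    by (rule integral_eq_zero_AE) (use z in auto)
  ultimately have 2: "lower_form u \<phi> = 0" by (simp add: lower_form_def)
  have 3: "N_form u \<phi> = 0"
    unfolding N_form_def by (rule integral_eq_zero_AE) (use AE_lebesgue_fst[OF z] in auto)
  have "A_form s \<Omega> K a u \<phi> = lam * N_form u \<phi> + f \<phi>"
    using w assms(1) by (simp add: weak_solution_def N_op_integral[OF u])
  with 1 2 3 assms show False by (simp add: A_form_eq u)
qed

text \<open>Tested with the negative part \<open>m\<close>, the right side is nonnegative: u m \<le>
  0 while \<open>lam\<close> is negative, and f m \<ge> 0. With \<open>p\<close> the positive part,
  A(u, m) = A(p, m) - A(m, m) and A(p, m) \<le> 0, so A(m, m) \<le> 0 and coercivity forces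
  \<open>m\<close> to vanish.\<close>

lemma weak_solution_nonneg:
  assumes K: "AE (x, y) in lebesgue_on (\<Omega> \<times> \<Omega>). 0 \<le> K (x, y)" and f: "dual_nonneg s \<Omega> f"
    and w: "weak_solution s q \<Omega> K Q a lam f u"
  shows "AE x in lebesgue. 0 \<le> u x"
proof -
  have u: "u \<in> X0 s \<Omega>" using w by (simp add: weak_solution_def)
  define m where "m x = max 0 (- u x)" for x
  define p where "p x = max 0 (u x)" for x
  have m: "m \<in> X0 s \<Omega>" unfolding m_def[abs_def] by (rule X0_lipschitz_comp[OF u]) auto
  have p: "p \<in> X0 s \<Omega>" unfolding p_def[abs_def] by (rule X0_lipschitz_comp[OF u]) auto
  have "N_form u m = - (LINT z|lebesgue. - (Q0 z * ((\<bar>u (fst z)\<bar> powr (q - 2) * u (fst z) * m (fst z)) * \<bar>u (snd z)\<bar> powr q)))"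
    by (simp add: N_form_def)
  moreover have "0 \<le> (LINT z|lebesgue. - (Q0 z * ((\<bar>u (fst z)\<bar> powr (q - 2) * u (fst z) * m (fst z)) * \<bar>u (snd z)\<bar> powr q)))"
  proof (rule integral_nonneg_AE)
    have "u x * m x \<le> 0" for x by (auto simp: m_def max_def mult_nonneg_nonpos mult_nonpos_nonneg)
    from mult_nonneg_nonpos[OF powr_ge_zero this] have um: "\<bar>u x\<bar> powr (q - 2) * u x * m x \<le> 0" for x
      by (simp add: mult.assoc)
    show "AE z in lebesgue. 0 \<le> - (Q0 z * ((\<bar>u (fst z)\<bar> powr (q - 2) * u (fst z) * m (fst z)) * \<bar>u (snd z)\<bar> powr q))"
      using zero_ext_nonneg[OF Q_nonneg]
      by eventually_elim (simp only: neg_0_le_iff_le, intro mult_nonneg_nonpos mult_nonpos_nonneg um, auto)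
  qed
  ultimately have "N_form u m \<le> 0" by linarith
  then have "0 \<le> lam * N_form u m" using lam_neg by (simp add: mult_nonpos_nonpos)
  moreover have "0 \<le> f m" using f m by (auto simp: dual_nonneg_def m_def)
  moreover have "A_form s \<Omega> K a u m = lam * N_form u m + f m"
    using w m by (simp add: weak_solution_def N_op_integral[OF u])
  ultimately have Aum: "0 \<le> A_form s \<Omega> K a u m" by simp
  have u_eq: "u = (\<lambda>x. p x + -1 * m x)" by (auto simp: p_def m_def max_def)
  have "A_form s \<Omega> K a u m = A_form s \<Omega> K a p m - A_form s \<Omega> K a m m"
    by (subst u_eq, subst A_form_add_cmult_left[OF p m m]) simp
  moreover have "A_form s \<Omega> K a p m \<le> 0"
  proof -
    \<comment> \<open>Positive and negative parts vary in opposite directions, so their cross energy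
      is at most zero.\<close>
    have "(max 0 x - max 0 y) * (max 0 (- x) - max 0 (- y)) \<le> 0" for x y :: real
      by (auto simp: max_def mult_nonneg_nonpos mult_nonpos_nonneg)
    then have "gquot s p z * gquot s m z \<le> 0" for z
      by (simp add: gquot_def p_def m_def divide_nonpos_nonneg)
    then have "0 \<le> (LINT z|lebesgue. - (gquot s p z * gquot s m z))"
      by (intro integral_nonneg_AE) auto
    then have "frac_form s p m \<le> 0"
      using frac_const_pos by (simp add: frac_form_gquot mult_nonneg_nonpos)
    moreover have "0 \<le> lower_form p m"
    proof -
      have "0 \<le> (LINT z|lebesgue. K0 z * (m (fst z) * p (snd z)))"
        by (rule integral_nonneg_AE)
           (use zero_ext_nonneg[OF K] in \<open>eventually_elim, simp add: m_def p_def\<close>)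
      \<comment> \<open>At each point \<open>p\<close> or \<open>m\<close> is zero, so the local
        term vanishes, whereas the kernel couples distinct points and needs the sign of
        \<open>K\<close>.\<close>
      moreover have "(LINT x|lebesgue. a0 x * (p x * m x)) = 0"
        by (rule integral_eq_zero_AE) (auto simp: p_def m_def max_def)
      ultimately show ?thesis by (simp add: lower_form_def)
    qed
    ultimately show ?thesis by (simp add: A_form_eq p m)
  qed
  ultimately have "A_form s \<Omega> K a m m \<le> 0" using Aum by simp
  then have "\<alpha> * frac_form s m m \<le> 0" using coercive[OF m] by (simp add: X0_norm_square)
  then have "frac_form s m m = 0"
    using \<alpha>_pos frac_form_nonneg[of m] by (simp add: mult_le_0_iff)
  from frac_form_eq_zero_imp_AE[OF m this] show ?thesis
    by eventually_elim (auto simp: m_def max_def split: if_splits)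
qed

end

theorem theorem3p2:
  fixes \<Omega> :: "'a::euclidean_space set"
    and s q lam :: real
    and a :: "'a \<Rightarrow> real"
    and K Q :: "'a \<times> 'a \<Rightarrow> real"
    and f :: "('a \<Rightarrow> real) \<Rightarrow> real"
  assumes "DIM('a) \<ge> 2"
    and "bounded_lipschitz_domain \<Omega>"
    and "0 < s" and "s < 1"
    and "1 < q" and "q < 2 * real DIM('a) / (real DIM('a) - 2 * s)"
    and "a \<in> L_infinity (lebesgue_on \<Omega>)"
    and "AE x in lebesgue_on \<Omega>. 0 \<le> a x"
    and "\<not> (AE x in lebesgue_on \<Omega>. a x = 0)"
    and "K \<in> L_infinity (lebesgue_on (\<Omega> \<times> \<Omega>))"
    and "Q \<in> L_infinity (lebesgue_on (\<Omega> \<times> \<Omega>))"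
    and "AE (x, y) in lebesgue_on (\<Omega> \<times> \<Omega>). K (x, y) = K (y, x)"
    and "AE (x, y) in lebesgue_on (\<Omega> \<times> \<Omega>). Q (x, y) = Q (y, x)"
    and "AE (x, y) in lebesgue_on (\<Omega> \<times> \<Omega>). 0 \<le> Q (x, y)"
    and "lam < 0"
    and "f \<in> X0_dual s \<Omega>"
    and "\<exists>\<alpha>\<^sub>0>0. \<forall>u\<in>X0 s \<Omega>. A_form s \<Omega> K a u u \<ge> \<alpha>\<^sub>0 * (X0_norm s u)\<^sup>2"
  shows "(\<exists>u\<in>X0 s \<Omega>.
            (\<forall>v\<in>X0 s \<Omega>. J_functional s q \<Omega> K Q a lam f u \<le> J_functional s q \<Omega> K Q a lam f v) \<and>
            weak_solution s q \<Omega> K Q a lam f u)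
       \<and> ((\<exists>\<phi>\<in>X0 s \<Omega>. f \<phi> \<noteq> 0) \<longrightarrow>
            (\<forall>u. weak_solution s q \<Omega> K Q a lam f u \<longrightarrow> \<not> (AE x in lebesgue. u x = 0)))
       \<and> ((AE (x, y) in lebesgue_on (\<Omega> \<times> \<Omega>). 0 \<le> K (x, y)) \<and> dual_nonneg s \<Omega> f \<longrightarrow>
            (\<forall>u. weak_solution s q \<Omega> K Q a lam f u \<longrightarrow> (AE x in lebesgue_on \<Omega>. 0 \<le> u x)))"
proof -
  obtain \<alpha> where \<alpha>: "0 < \<alpha>" "\<forall>u\<in>X0 s \<Omega>. A_form s \<Omega> K a u u \<ge> \<alpha> * (X0_norm s u)\<^sup>2"
    using assms(17) by blast
  interpret nonlocal_problem \<Omega> s q lam a K Q f \<alpha>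
    by unfold_locales (use assms \<alpha> in \<open>auto simp: bounded_lipschitz_domain_def\<close>)
  have "AE x in lebesgue_on \<Omega>. 0 \<le> u x" if "AE x in lebesgue. 0 \<le> u x" for u :: "'a \<Rightarrow> real"
    using that sets_domain(1) by (auto simp: AE_restrict_space_iff elim: AE_mp)
  moreover obtain u where "u \<in> X0 s \<Omega>"
    "\<And>v. v \<in> X0 s \<Omega> \<Longrightarrow> J_functional s q \<Omega> K Q a lam f u \<le> J_functional s q \<Omega> K Q a lam f v"
    by (rule minimizer_exists) (rule that)
  ultimately show ?thesis
    using minimizer_weak_solution[of u] weak_solution_nontrivial weak_solution_nonneg by auto
qed

end
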